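(* Suppose that $\mathbf X\in\boldsymbol\Sigma\cup\boldsymbol\Theta$. Let $x\in\mathbb R^d$ be such that there exists an open neighbourhood $D\subset\mathbb R^d$ of $x$ with $\rho|_D\in\mathcal H_D(\beta,\mathsf L)$, $\beta\in(0,\ell+1]$. Then $$\mathbb E\big[(\hat\rho_{h,T}(x)-\rho(x))^2\big]\in\mathsf O\big(\Phi_{d,\beta}^2(T)\big),\quad\text{if}\quad h=h(T)\sim\begin{cases} T^{-1/\gamma},&d\le2,\ \gamma\in(0,\beta],\\ {T}^{-1/(2\beta+d-2)},&d\ge3,\end{cases}$$ where $$\Phi_{d,\beta}(T)=\begin{cases}1/\sqrt T,&d=1,\\ \sqrt{\log T/T},&d=2,\\ {T}^{-\frac{\beta}{2\beta+d-2}},&d\ge3.\end{cases}$$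
   Context: $\mathbf X=(X_t)_{t\ge 0}$ with laws $(\mathbb P^x)_{x\in\mathbb R^d}$ is a non-explosive Borel right Markov process with state space $(\mathbb R^d,\mathcal B(\mathbb R^d))$ and semigroup $P_t(x,B)=\mathbb P^x(X_t\in B)$. $\mathbb E=\mathbb E^\mu$, with $\mu$ the invariant distribution below; $\|\nu\|_{\mathrm{TV}}=\sup_{|f|\le1}|\nu(f)|$. A Borel set $B$ is $\mu$-full if $\mu(B)=1$. Conditions. (Basic assumption) For any $t>0$ there is a measurable transition density $p_t$ with $P_t(x,B)=\int_Bp_t(x,y)\,dy$, and there is a unique invariant probability measure $\mu$, absolutely continuous with density $\rho$. (Short-time bound) If $d=1$: $\sup_{x,y}p_t(x,y)\le\alpha(t)$ for $t\in(0,1]$ with a non-negative measurable $\alpha$ satisfying $\int_{0+}^1\alpha(t)\,dt<\infty$; if $d\ge2$: $\sup_{x,y}p_t(x,y)\le c_2t^{-d/2}$ for $t\in(0,1]$ and some $c_2>0$. (Local uniform convergence) There is a $\mu$-full set $\Lambda$ such that for every compact $\mathcal S\subset\mathbb R^d$ there is a non-negative measurable $r_{\mathcal S}$ on $(0,\infty)$ with $\sup_{x\in\mathcal S\cap\Lambda,y\in\mathcal S}|p_t(x,y)-\rho(y)|\le r_{\mathcal S}(t)$ for all $t>1$ and $c_{\mathcal S}=\int_1^\infty r_{\mathcal S}(t)\,dt<\infty$. (Monotonicity) $\mathcal S_1\subset\mathcal S_2$ implies $c_{\mathcal S_1}\le c_{\mathcal S_2}$. $\mathbf X$ is exponentially $\beta$-mixing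 if $\int\|P_t(x,\cdot)-\mu\|_{\mathrm{TV}}\,\mu(dx)\le c_\kappa e^{-\kappa t}$, $t\ge0$, for some $c_\kappa,\kappa>0$. Classes. $\boldsymbol\Sigma$: non-explosive, exponentially $\beta$-mixing Borel right Markov processes satisfying the basic assumption and the short-time bound (so $\rho$ has a bounded version), and, if $d=1$, additionally local uniform convergence with monotonicity. $\boldsymbol\Theta$: $d$-dimensional non-explosive Borel right processes satisfying the basic assumption, the short-time bound, and local uniform convergence with monotonicity. Hölder class: with $\lfloor\!\lfloor\beta\rfloor\!\rfloor$ the largest integer strictly smaller than $\beta$, $\mathcal H_D(\beta,\mathsf L)$ is the set of $f\in\mathcal C^{\lfloor\!\lfloor\beta\rfloor\!\rfloor}(D,\mathbb R)$ with $\max_{|\alpha|=\lfloor\!\lfloor\beta\rfloor\!\rfloor}\sup_{x\ne y\in D}|f^{(\alpha)}(x)-f^{(\alpha)}(y)|/\|x-y\|^{\beta-\lfloor\!\lfloor\beta\rfloor\!\rfloor}\le\mathsf L$ and $\sup_{x\in D}|f(x)|\le\mathsf L$ (here $\alpha$ ranges over multi-indices). Kernel: $K:\mathbb R^d\to\mathbb R$ is Lipschitz continuous, supported on $[-1/2,1/2]^d$, of order $\ell\in\mathbb N$: $x\mapsto x^\alpha K(x)$ is integrable for $|\alpha|\le\ell$, $\int K=1$, and $\int K(x)x^\alpha\,dx=0$ for multi-indices with $1\le|\alpha|\le\ell$. $\hat\rho_{h,T}(x)=\frac1T\int_0^TK_h(x-X_s)\,ds$, $K_h(\cdot)=h^{-d}K(\cdot/h)$.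 $\mathsf O$ refers to $T\to\infty$; $h(T)\sim g(T)$ means that $h(T)$ is of the order $g(T)$. *)

theory Defs
  imports "HOL-Probability.Probability" "HOL-Library.Landau_Symbols"
begin

section \<open>Borel right processes\<close>

definition transition ::
  "('s::topological_space \<Rightarrow> 'w measure) \<Rightarrow> (real \<Rightarrow> 'w \<Rightarrow> 's) \<Rightarrow> real \<Rightarrow> 's \<Rightarrow> 's measure"
  where "transition P X t x = distr (P x) borel (X t)"

text \<open>
  A filtration indexed by \<open>[0, \<infinity>]\<close>, so that stopping times may take the value \<open>\<infinity>\<close>.
\<close>

definition right_continuous_filtration :: "'w measure \<Rightarrow> (ennreal \<Rightarrow> 'w measure) \<Rightarrow> bool" where
  "right_continuous_filtration M F \<longleftrightarrow>
     filtration (space M) F \<and>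
     (\<forall>t. sets (F t) \<subseteq> sets M) \<and>
     (\<forall>t<\<infinity>. sets (F t) = (\<Inter>s\<in>{t<..}. sets (F s)))"

text \<open>
  \<open>\<P>\<^sup>x(X\<^bsub>\<tau>+u\<^esub> \<in> B | \<F>\<^sub>\<tau>) = P\<^sub>u(X\<^sub>\<tau>, B)\<close> on \<open>{\<tau> < \<infinity>}\<close>, written out by integrating over the events
  of \<open>\<F>\<^sub>\<tau>\<close>.  Constant \<open>\<tau>\<close> give the simple Markov property.
\<close>

definition strong_markov ::
  "'w measure \<Rightarrow> (ennreal \<Rightarrow> 'w measure) \<Rightarrow> (real \<Rightarrow> 'w \<Rightarrow> 's::topological_space) \<Rightarrow>
     ('s \<Rightarrow> 'w measure) \<Rightarrow> bool" where
  "strong_markov M F X P \<longleftrightarrow>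
     (\<forall>\<tau>. stopping_time F \<tau> \<longrightarrow>
       (\<forall>A\<in>sets (filtration.pre_sigma (space M) F \<tau>). \<forall>x. \<forall>u\<ge>0. \<forall>B\<in>sets borel.
          emeasure (P x) {\<omega>\<in>A. \<tau> \<omega> < \<infinity> \<and> X (enn2real (\<tau> \<omega>) + u) \<omega> \<in> B} =
          (\<integral>\<^sup>+\<omega>. indicator {\<omega>\<in>A. \<tau> \<omega> < \<infinity>} \<omega> *
                   emeasure (transition P X u (X (enn2real (\<tau> \<omega>)) \<omega>)) B \<partial>P x)))"

text \<open>
  The process is non-explosive: \<open>X t\<close> takes values in the state space for all \<open>t\<close>, without a
  cemetery.  Only the values \<open>X t\<close> with \<open>t \<ge> 0\<close> matter.  \<open>M\<close> is the \<open>\<sigma>\<close>-algebra before any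
  completion, so that \<open>x \<mapsto> \<P>\<^sup>x(A)\<close> is Borel measurable for all \<open>A\<close> in \<open>M\<close>; in particular the
  semigroup maps Borel functions to Borel functions.
\<close>

definition borel_right_process ::
  "'w measure \<Rightarrow> (ennreal \<Rightarrow> 'w measure) \<Rightarrow> (real \<Rightarrow> 'w \<Rightarrow> 's::polish_space) \<Rightarrow>
     ('s \<Rightarrow> 'w measure) \<Rightarrow> bool" where
  "borel_right_process M F X P \<longleftrightarrow>
     right_continuous_filtration M F \<and>
     (\<forall>t\<ge>0. X t \<in> F (ennreal t) \<rightarrow>\<^sub>M borel) \<and>
     P \<in> borel \<rightarrow>\<^sub>M prob_algebra M \<and>
     (\<forall>x. AE \<omega> in P x. X 0 \<omega> = x) \<and>
     (\<forall>\<omega>\<in>space M. \<forall>t\<ge>0. ((\<lambda>s. X s \<omega>) \<longlongrightarrow> X t \<omega>) (at_right t)) \<and>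
     strong_markov M F X P"

definition invariant_prob ::
  "(real \<Rightarrow> 'w \<Rightarrow> 's::topological_space) \<Rightarrow> ('s \<Rightarrow> 'w measure) \<Rightarrow> 's measure \<Rightarrow> bool" where
  "invariant_prob X P \<nu> \<longleftrightarrow>
     prob_space \<nu> \<and> sets \<nu> = sets borel \<and>
     (\<forall>t\<ge>0. \<forall>B\<in>sets borel. (\<integral>\<^sup>+x. emeasure (transition P X t x) B \<partial>\<nu>) = emeasure \<nu> B)"

definition tv_dist :: "'s::topological_space measure \<Rightarrow> 's measure \<Rightarrow> real" where
  "tv_dist \<nu>\<^sub>1 \<nu>\<^sub>2 =
     (SUP f\<in>{f \<in> borel_measurable borel. \<forall>y. \<bar>f y\<bar> \<le> 1}. \<bar>(\<integral>y. f y \<partial>\<nu>\<^sub>1) - (\<integral>y. f y \<partial>\<nu>\<^sub>2)\<bar>)"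

definition exp_beta_mixing ::
  "(real \<Rightarrow> 'w \<Rightarrow> 's::topological_space) \<Rightarrow> ('s \<Rightarrow> 'w measure) \<Rightarrow> 's measure \<Rightarrow> bool" where
  "exp_beta_mixing X P \<mu> \<longleftrightarrow>
     (\<exists>c>0. \<exists>\<kappa>>0. \<forall>t\<ge>0.
        (\<integral>\<^sup>+x. ennreal (tv_dist (transition P X t x) \<mu>) \<partial>\<mu>) \<le> ennreal (c * exp (- \<kappa> * t)))"


section \<open>Conditions on the transition and invariant densities\<close>

abbreviation density_measure :: "('s::euclidean_space \<Rightarrow> real) \<Rightarrow> 's measure" where
  "density_measure \<rho> \<equiv> density lborel (\<lambda>x. ennreal (\<rho> x))"

definition basic_assumption ::
  "(real \<Rightarrow> 'w \<Rightarrow> 's::euclidean_space) \<Rightarrow> ('s \<Rightarrow> 'w measure) \<Rightarrow>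
     (real \<Rightarrow> 's \<Rightarrow> 's \<Rightarrow> real) \<Rightarrow> ('s \<Rightarrow> real) \<Rightarrow> bool" where
  "basic_assumption X P p \<rho> \<longleftrightarrow>
     (\<forall>t>0. (\<lambda>(x, y). p t x y) \<in> borel_measurable (borel \<Otimes>\<^sub>M borel) \<and>
            (\<forall>x y. 0 \<le> p t x y) \<and>
            (\<forall>x. transition P X t x = density_measure (p t x))) \<and>
     \<rho> \<in> borel_measurable borel \<and> (\<forall>x. 0 \<le> \<rho> x) \<and>
     invariant_prob X P (density_measure \<rho>) \<and>
     (\<forall>\<nu>. invariant_prob X P \<nu> \<longrightarrow> \<nu> = density_measure \<rho>)"

definition short_time_bound :: "(real \<Rightarrow> 's::euclidean_space \<Rightarrow> 's \<Rightarrow> real) \<Rightarrow> bool" where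
  "short_time_bound p \<longleftrightarrow>
     (if DIM('s) = 1 then
        \<exists>\<alpha>. (\<forall>t\<in>{0<..1}. 0 \<le> \<alpha> t \<and> (\<forall>x y. p t x y \<le> \<alpha> t)) \<and>
            set_integrable lborel {0<..1} \<alpha>
      else
        \<exists>c>0. \<forall>t\<in>{0<..1}. \<forall>x y. p t x y \<le> c * t powr (- real DIM('s) / 2))"

definition local_uniform_convergence ::
  "(real \<Rightarrow> 's::euclidean_space \<Rightarrow> 's \<Rightarrow> real) \<Rightarrow> ('s \<Rightarrow> real) \<Rightarrow>
     's set \<Rightarrow> ('s set \<Rightarrow> real \<Rightarrow> real) \<Rightarrow> bool" where
  "local_uniform_convergence p \<rho> \<Lambda> r \<longleftrightarrow>
     \<Lambda> \<in> sets borel \<and> emeasure (density_measure \<rho>) \<Lambda> = 1 \<and>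
     (\<forall>S. compact S \<longrightarrow>
        set_borel_measurable borel {0<..} (r S) \<and>
        (\<forall>t>0. 0 \<le> r S t) \<and>
        (\<forall>t>1. \<forall>x\<in>S \<inter> \<Lambda>. \<forall>y\<in>S. \<bar>p t x y - \<rho> y\<bar> \<le> r S t) \<and>
        set_integrable lborel {1<..} (r S))"

definition monotone_rates :: "('s::euclidean_space set \<Rightarrow> real \<Rightarrow> real) \<Rightarrow> bool" where
  "monotone_rates r \<longleftrightarrow>
     (\<forall>S\<^sub>1 S\<^sub>2. compact S\<^sub>1 \<longrightarrow> compact S\<^sub>2 \<longrightarrow> S\<^sub>1 \<subseteq> S\<^sub>2 \<longrightarrow>
        (LBINT t:{1<..}. r S\<^sub>1 t) \<le> (LBINT t:{1<..}. r S\<^sub>2 t))"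

definition class_\<Sigma> ::
  "'w measure \<Rightarrow> (ennreal \<Rightarrow> 'w measure) \<Rightarrow> (real \<Rightarrow> 'w \<Rightarrow> 's::euclidean_space) \<Rightarrow>
     ('s \<Rightarrow> 'w measure) \<Rightarrow> ('s \<Rightarrow> real) \<Rightarrow> bool" where
  "class_\<Sigma> M F X P \<rho> \<longleftrightarrow>
     borel_right_process M F X P \<and>
     exp_beta_mixing X P (density_measure \<rho>) \<and>
     (\<exists>p. basic_assumption X P p \<rho> \<and> short_time_bound p \<and>
          (DIM('s) = 1 \<longrightarrow> (\<exists>\<Lambda> r. local_uniform_convergence p \<rho> \<Lambda> r \<and> monotone_rates r)))"

definition class_\<Theta> ::
  "'w measure \<Rightarrow> (ennreal \<Rightarrow> 'w measure) \<Rightarrow> (real \<Rightarrow> 'w \<Rightarrow> 's::euclidean_space) \<Rightarrow>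
     ('s \<Rightarrow> 'w measure) \<Rightarrow> ('s \<Rightarrow> real) \<Rightarrow> bool" where
  "class_\<Theta> M F X P \<rho> \<longleftrightarrow>
     borel_right_process M F X P \<and>
     (\<exists>p. basic_assumption X P p \<rho> \<and> short_time_bound p \<and>
          (\<exists>\<Lambda> r. local_uniform_convergence p \<rho> \<Lambda> r \<and> monotone_rates r))"


section \<open>Hoelder classes\<close>

definition partial_deriv ::
  "'n::finite \<Rightarrow> (real ^ 'n \<Rightarrow> real) \<Rightarrow> real ^ 'n \<Rightarrow> real" where
  "partial_deriv i f x = deriv (\<lambda>t. f (x + t *\<^sub>R axis i 1)) 0"

text \<open>
  \<open>partials [i\<^sub>1, \<dots>, i\<^sub>k] f = \<partial>\<^bsub>i\<^sub>1\<^esub> \<dots> \<partial>\<^bsub>i\<^sub>k\<^esub> f\<close>.  A list of coordinates stands for the multi-index \<open>\<alpha>\<close>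
  counting its entries, \<open>|\<alpha>|\<close> being its length; for \<open>f\<close> of class \<open>C\<^sup>k\<close> the order of
  differentiation is immaterial, so lists of length \<open>k\<close> yield exactly the \<open>f\<^bsup>(\<alpha>)\<^esup>\<close>, \<open>|\<alpha>| = k\<close>.
\<close>

definition partials ::
  "('n::finite) list \<Rightarrow> (real ^ 'n \<Rightarrow> real) \<Rightarrow> real ^ 'n \<Rightarrow> real" where
  "partials is f = foldr partial_deriv is f"

text \<open>
  For open \<open>D\<close> the next two notions depend only on the restriction of \<open>f\<close> to \<open>D\<close>.
\<close>

definition C_k_on :: "nat \<Rightarrow> (real ^ 'n::finite) set \<Rightarrow> (real ^ 'n \<Rightarrow> real) \<Rightarrow> bool" where
  "C_k_on k D f \<longleftrightarrow>
     (\<forall>is. length is < k \<longrightarrow>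
        (\<forall>i. \<forall>x\<in>D. (\<lambda>t. partials is f (x + t *\<^sub>R axis i 1)) field_differentiable (at 0))) \<and>
     (\<forall>is. length is \<le> k \<longrightarrow> continuous_on D (partials is f))"

text \<open>The largest integer strictly smaller than \<open>\<beta>\<close>, for \<open>\<beta> > 0\<close>.\<close>

definition strict_floor :: "real \<Rightarrow> nat" where
  "strict_floor \<beta> = nat (\<lceil>\<beta>\<rceil> - 1)"

definition holder_class ::
  "(real ^ 'n::finite) set \<Rightarrow> real \<Rightarrow> real \<Rightarrow> (real ^ 'n \<Rightarrow> real) set" where
  "holder_class D \<beta> L =
     {f. C_k_on (strict_floor \<beta>) D f \<and>
         (\<forall>is. length is = strict_floor \<beta> \<longrightarrow>
            (\<forall>x\<in>D. \<forall>y\<in>D. x \<noteq> y \<longrightarrow>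
               \<bar>partials is f x - partials is f y\<bar> / norm (x - y) powr (\<beta> - real (strict_floor \<beta>))
                 \<le> L)) \<and>
         (\<forall>x\<in>D. \<bar>f x\<bar> \<le> L)}"


section \<open>Kernel density estimation\<close>

definition monomial_fun :: "('n::finite \<Rightarrow> nat) \<Rightarrow> real ^ 'n \<Rightarrow> real" where
  "monomial_fun \<alpha> x = (\<Prod>i\<in>UNIV. (x $ i) ^ \<alpha> i)"

definition kernel_of_order :: "nat \<Rightarrow> (real ^ 'n::finite \<Rightarrow> real) \<Rightarrow> bool" where
  "kernel_of_order l K \<longleftrightarrow>
     (\<exists>C. C-lipschitz_on UNIV K) \<and>
     (\<forall>x. K x \<noteq> 0 \<longrightarrow> (\<forall>i. \<bar>x $ i\<bar> \<le> 1 / 2)) \<and>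
     (\<forall>\<alpha>. (\<Sum>i\<in>UNIV. \<alpha> i) \<le> l \<longrightarrow> integrable lborel (\<lambda>x. monomial_fun \<alpha> x * K x)) \<and>
     (\<integral>x. K x \<partial>lborel) = 1 \<and>
     (\<forall>\<alpha>. 1 \<le> (\<Sum>i\<in>UNIV. \<alpha> i) \<longrightarrow> (\<Sum>i\<in>UNIV. \<alpha> i) \<le> l \<longrightarrow>
        (\<integral>x. K x * monomial_fun \<alpha> x \<partial>lborel) = 0)"

definition scaled_kernel :: "(real ^ 'n::finite \<Rightarrow> real) \<Rightarrow> real \<Rightarrow> real ^ 'n \<Rightarrow> real" where
  "scaled_kernel K h y = K (y /\<^sub>R h) / h ^ CARD('n)"

definition density_estimator ::
  "(real ^ 'n::finite \<Rightarrow> real) \<Rightarrow> (real \<Rightarrow> 'w \<Rightarrow> real ^ 'n) \<Rightarrow> real \<Rightarrow> real \<Rightarrow> real ^ 'n \<Rightarrow>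
     'w \<Rightarrow> real" where
  "density_estimator K X h T x \<omega> = (1 / T) * (LBINT s:{0..T}. scaled_kernel K h (x - X s \<omega>))"

definition rate_\<Phi> :: "nat \<Rightarrow> real \<Rightarrow> real \<Rightarrow> real" where
  "rate_\<Phi> d \<beta> T =
     (if d = 1 then 1 / sqrt T
      else if d = 2 then sqrt (ln T / T)
      else T powr (- \<beta> / (2 * \<beta> + real d - 2)))"

end

theory Submission
  imports Defs
begin

text \<open>
  The mean square error splits into a squared bias and a variance.  Write \<open>\<mu>\<close> for the invariant law,
  \<open>Q\<^sub>u\<close> for the semigroup, \<open>f = K\<^sub>h(x - \<cdot>)\<close> and \<open>\<mu>(f)\<close> for the mean of \<open>f\<close>.  By stationarity
  \<open>\<mu>(f)\<close> is the mean of the estimator.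

  Bias.  The substitution \<open>y = x - h u\<close> turns \<open>\<mu>(f)\<close> into \<open>\<integral>K(u) \<rho>(x - h u) du\<close>.  Taylor's formula on
  the line through \<open>x\<close> in the direction \<open>u\<close> replaces \<open>\<rho>(x - h u)\<close> by a polynomial in \<open>u\<close> of degree below \<open>\<beta>\<close>, hence at
  most the order of the kernel, up to an error \<open>O(h\<^sup>\<beta>)\<close> (\<open>holder_taylor\<close>).  The vanishing moments of \<open>K\<close>
  reduce the polynomial to its constant term \<open>\<rho>(x)\<close> (\<open>kernel_smoothing_bias\<close>).

  Variance.  The Markov property and stationarity show that \<open>f(X\<^sub>s)\<close> and \<open>f(X\<^sub>s\<^sub>+\<^sub>u)\<close> have the covariance
  \<open>c(u) = \<integral>f (Q\<^sub>u f - \<mu>(f)) d\<mu>\<close>, and Fubini's theorem bounds the variance of the time average by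
  \<open>(2 / T) \<integral>\<bar>c(u)\<bar> du\<close> over \<open>u > 0\<close>.  So everything depends on how this integral grows as \<open>h\<close> tends to 0,
  where \<open>f\<close> has a bounded \<open>L\<^sup>1\<close> norm, a support in a fixed compact set, and values of order \<open>h\<^sup>-\<^sup>d\<close>.
  Four bounds for \<open>c(u)\<close> are combined.

    \<^item> \<open>\<bar>Q\<^sub>u f\<bar> \<le> sup \<bar>f\<bar>\<close> gives \<open>O(h\<^sup>-\<^sup>d)\<close>; it is used for \<open>u \<le> h\<^sup>2\<close> when \<open>d \<ge> 2\<close>.
    \<^item> A transition density bounded by \<open>A\<close> gives \<open>O(A + 1)\<close>, uniformly in \<open>h\<close>; this handles the other
      \<open>u \<le> 1\<close>, where \<open>A\<close> is \<open>\<alpha>(u)\<close> or a multiple of \<open>u\<^bsup>-d/2\<^esup>\<close>.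
    \<^item> Local uniform convergence gives \<open>O(r(u))\<close> for \<open>u > 1\<close>, which is integrable.
    \<^item> Exponential mixing gives only \<open>O(h\<^bsup>-2d\<^esup> e\<^bsup>-\<theta>u\<^esup>)\<close>.  Chapman-Kolmogorov extends the density bound
      at time 1 to all later times, so that mixing is needed only beyond \<open>u = (2 d / \<theta>) ln (1 / h)\<close>.

  The short times dominate: \<open>\<integral>\<bar>c\<bar>\<close> is of the order \<open>1\<close>, \<open>1 + ln (1 / h)\<close> or \<open>h\<^bsup>2-d\<^esup>\<close> in dimension 1, 2 or
  above (\<open>autocov_dominated\<close>), and the logarithmic range needed for mixing costs no more than that when
  \<open>d \<ge> 2\<close>.  Inserting the bandwidth (\<open>mean_square_rate\<close>) balances \<open>h\<^bsup>2-d\<^esup> / T\<close> against \<open>h\<^bsup>2\<beta>\<^esup>\<close> for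
  \<open>d \<ge> 3\<close>; for \<open>d \<le> 2\<close> any bandwidth \<open>T\<^bsup>-1/\<gamma>\<^esup>\<close> with \<open>\<gamma> \<le> \<beta>\<close> makes the bias
  negligible and still leaves \<open>ln (1 / h)\<close> of the order \<open>ln T\<close>.
\<close>

section \<open>Pair laws of a stationary Markov process\<close>

text \<open>
  A right process started from an invariant law.  The laws of \<open>X\<close> under \<open>P x\<close> are averaged over
  \<open>\<mu>\<close> to give the stationary measure \<open>N\<close>.
\<close>

locale stationary_right_process =
  fixes M :: "'w measure" and F :: "ennreal \<Rightarrow> 'w measure"
    and X :: "real \<Rightarrow> 'w \<Rightarrow> 's::polish_space" and P :: "'s \<Rightarrow> 'w measure"
    and \<mu> :: "'s measure"
  assumes right_process: "borel_right_process M F X P"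
    and invariant: "invariant_prob X P \<mu>"
begin

abbreviation N :: "'w measure" where "N \<equiv> \<mu> \<bind> P"
abbreviation Q :: "real \<Rightarrow> 's \<Rightarrow> 's measure" where "Q \<equiv> transition P X"

lemma filtration: "filtration (space M) F" and sets_F: "sets (F t) \<subseteq> sets M"
  using right_process by (auto simp: borel_right_process_def right_continuous_filtration_def)

lemma measurable_X_F: "0 \<le> t \<Longrightarrow> X t \<in> F (ennreal t) \<rightarrow>\<^sub>M borel"
  using right_process by (auto simp: borel_right_process_def)

lemma measurable_X[measurable]: "0 \<le> t \<Longrightarrow> X t \<in> M \<rightarrow>\<^sub>M borel"
  using measurable_X_F[of t] sets_F[of "ennreal t"] filtration.space_F[OF filtration]
  by (auto simp: measurable_def)

lemma measurable_P_prob: "P \<in> borel \<rightarrow>\<^sub>M prob_algebra M"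
  using right_process by (auto simp: borel_right_process_def)

lemma measurable_P[measurable]: "P \<in> borel \<rightarrow>\<^sub>M subprob_algebra M"
  by (rule measurable_prob_algebraD[OF measurable_P_prob])

lemma prob_space_P: "prob_space (P x)" and sets_P[simp, measurable_cong]: "sets (P x) = sets M"
  using measurable_space[OF measurable_P_prob, of x] by (auto simp: space_prob_algebra)

lemma space_P[simp]: "space (P x) = space M"
  by (rule sets_eq_imp_space_eq[OF sets_P])

lemma sets_mu[simp, measurable_cong]: "sets \<mu> = sets borel" and prob_space_mu: "prob_space \<mu>"
  using invariant by (auto simp: invariant_prob_def)

lemma space_mu[simp]: "space \<mu> = UNIV"
  using sets_eq_imp_space_eq[OF sets_mu] by simp

sublocale mu: prob_space \<mu> by (rule prob_space_mu)

lemma measurable_Q_prob: "0 \<le> u \<Longrightarrow> Q u \<in> borel \<rightarrow>\<^sub>M prob_algebra borel"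
  unfolding transition_def
  by (rule measurable_compose[OF measurable_P_prob measurable_distr_prob_space[OF measurable_X]])

lemma measurable_Q[measurable]: "0 \<le> u \<Longrightarrow> Q u \<in> borel \<rightarrow>\<^sub>M subprob_algebra borel"
  by (rule measurable_prob_algebraD[OF measurable_Q_prob])

lemma sets_Q[simp, measurable_cong]: "sets (Q u y) = sets borel"
  by (simp add: transition_def)

lemma space_Q[simp]: "space (Q u y) = UNIV"
  by (simp add: transition_def)

lemma prob_space_Q: "0 \<le> u \<Longrightarrow> prob_space (Q u y)"
  unfolding transition_def
  by (intro prob_space.prob_space_distr prob_space_P) simp_all

lemma mu_in_prob_algebra: "\<mu> \<in> space (prob_algebra borel)"
  by (simp add: space_prob_algebra prob_space_mu)

lemma sets_N[simp, measurable_cong]: "sets N = sets M"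
  by (rule sets_bind'[OF mu_in_prob_algebra measurable_P_prob])

lemma space_N[simp]: "space N = space M"
  by (rule sets_eq_imp_space_eq[OF sets_N])

sublocale N: prob_space N
  by (rule prob_space_bind'[OF mu_in_prob_algebra measurable_P_prob])

lemma emeasure_N: "A \<in> sets M \<Longrightarrow> emeasure N A = (\<integral>\<^sup>+x. emeasure (P x) A \<partial>\<mu>)"
  by (rule emeasure_bind) (auto simp: measurable_cong_sets[OF sets_mu refl])

lemma law_X:
  assumes t: "0 \<le> t"
  shows "distr N borel (X t) = \<mu>"
proof (rule measure_eqI)
  fix B assume "B \<in> sets (distr N borel (X t))"
  then have B[measurable]: "B \<in> sets borel" by simp
  note [measurable] = measurable_X[OF t]
  have "emeasure (distr N borel (X t)) B = emeasure N (X t -` B \<inter> space M)"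
    by (simp add: emeasure_distr)
  also have "\<dots> = (\<integral>\<^sup>+x. emeasure (P x) (X t -` B \<inter> space M) \<partial>\<mu>)"
    by (rule emeasure_N) measurable
  also have "\<dots> = (\<integral>\<^sup>+x. emeasure (Q t x) B \<partial>\<mu>)"
    by (simp add: transition_def emeasure_distr)
  also have "\<dots> = emeasure \<mu> B"
    using invariant t B by (auto simp: invariant_prob_def)
  finally show "emeasure (distr N borel (X t)) B = emeasure \<mu> B" .
qed simp

text \<open>
  The simple Markov property is the strong one at a constant stopping time.
\<close>

lemma markov_property:
  assumes s: "0 \<le> s" and u: "0 \<le> u" and A: "A \<in> sets borel" and B: "B \<in> sets borel"
  shows "emeasure (P x) {\<omega>\<in>space M. X s \<omega> \<in> A \<and> X (s + u) \<omega> \<in> B} =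
    (\<integral>\<^sup>+y. indicator A y * emeasure (Q u y) B \<partial>Q s x)"
proof -
  note [measurable] = measurable_X[OF s] A B measurable_Q[OF u]
  define \<tau> :: "'w \<Rightarrow> ennreal" where "\<tau> = (\<lambda>_. ennreal s)"
  have \<tau>: "stopping_time F \<tau>"
    unfolding \<tau>_def by (rule stopping_time_const)
  define A' where "A' = {\<omega>\<in>space M. X s \<omega> \<in> A}"
  have A'F: "A' \<in> sets (F (ennreal s))"
  proof -
    have "X s -` A \<inter> space (F (ennreal s)) \<in> sets (F (ennreal s))"
      by (rule measurable_sets[OF measurable_X_F[OF s] A])
    also have "X s -` A \<inter> space (F (ennreal s)) = A'"
      by (auto simp: A'_def filtration.space_F[OF filtration])
    finally show ?thesis .
  qed
  have markov: "strong_markov M F X P"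
    using right_process by (simp add: borel_right_process_def)
  have "A' \<in> sets (filtration.pre_sigma (space M) F \<tau>)"
  proof (rule filtration.sets_pre_sigmaI[OF filtration \<tau>])
    fix t
    show "{\<omega>\<in>A'. \<tau> \<omega> \<le> t} \<in> sets (F t)"
    proof (cases "ennreal s \<le> t")
      case True
      then show ?thesis
        using A'F filtration.sets_F_mono[OF filtration True] by (simp add: \<tau>_def subset_iff)
    next
      case False
      then show ?thesis by (simp add: \<tau>_def)
    qed
  qed
  from markov[unfolded strong_markov_def, rule_format, OF \<tau> this u B]
  have "emeasure (P x) {\<omega>\<in>A'. \<tau> \<omega> < \<infinity> \<and> X (enn2real (\<tau> \<omega>) + u) \<omega> \<in> B} =
      (\<integral>\<^sup>+\<omega>. indicator {\<omega>\<in>A'. \<tau> \<omega> < \<infinity>} \<omega> * emeasure (Q u (X (enn2real (\<tau> \<omega>)) \<omega>)) B \<partial>P x)"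
    .
  moreover have \<tau>_s: "enn2real (\<tau> \<omega>) = s" "\<tau> \<omega> < \<infinity>" for \<omega>
    using s by (simp_all add: \<tau>_def)
  moreover have "{\<omega>\<in>A'. X (s + u) \<omega> \<in> B} = {\<omega>\<in>space M. X s \<omega> \<in> A \<and> X (s + u) \<omega> \<in> B}"
    unfolding A'_def by blast
  ultimately have "emeasure (P x) {\<omega>\<in>space M. X s \<omega> \<in> A \<and> X (s + u) \<omega> \<in> B} =
      (\<integral>\<^sup>+\<omega>. indicator A' \<omega> * emeasure (Q u (X s \<omega>)) B \<partial>P x)"
    by (simp only: simp_thms Collect_mem_eq)
  also have "\<dots> = (\<integral>\<^sup>+\<omega>. indicator A (X s \<omega>) * emeasure (Q u (X s \<omega>)) B \<partial>P x)"
    by (intro nn_integral_cong) (auto simp: A'_def indicator_def)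
  also have "\<dots> = (\<integral>\<^sup>+y. indicator A y * emeasure (Q u y) B \<partial>Q s x)"
    unfolding transition_def[of P X s] by (subst nn_integral_distr) auto
  finally show ?thesis .
qed

text \<open>
  Chapman-Kolmogorov: \<open>Q\<^sub>s\<^sub>+\<^sub>u(x, B)\<close> is an average of the values \<open>Q\<^sub>u(y, B)\<close>, so a bound that is uniform
  in the starting point persists at later times.
\<close>

lemma Q_bound_extend:
  fixes c :: ennreal and \<nu> :: "'s measure"
  assumes s: "0 \<le> s" and u: "0 \<le> u" and B: "B \<in> sets borel"
    and bound: "\<And>y. emeasure (Q u y) B \<le> c"
  shows "emeasure (Q (s + u) x) B \<le> c"
proof -
  note [measurable] = measurable_X[OF s] B measurable_X[of "s + u"] measurable_Q[OF u]
  interpret prob_space "Q s x" by (rule prob_space_Q[OF s])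
  have "emeasure (Q (s + u) x) B = emeasure (P x) {\<omega>\<in>space M. X s \<omega> \<in> UNIV \<and> X (s + u) \<omega> \<in> B}"
    using s u by (auto simp: transition_def emeasure_distr intro!: arg_cong[where f="emeasure (P x)"])
  also have "\<dots> = (\<integral>\<^sup>+y. emeasure (Q u y) B \<partial>Q s x)"
    by (subst markov_property[OF s u _ B]) auto
  also have "\<dots> \<le> (\<integral>\<^sup>+y. c \<partial>Q s x)"
    by (intro nn_integral_mono bound)
  also have "\<dots> = c"
    by (simp add: emeasure_space_1[simplified])
  finally show ?thesis .
qed

text \<open>
  The law of \<open>(y, X\<^sub>u)\<close> for a process started at \<open>y\<close>; it carries the first coordinate along so that the
  joint law of two time points becomes a Giry composition.
\<close>

definition pair_kernel :: "real \<Rightarrow> 's \<Rightarrow> ('s \<times> 's) measure" where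
  "pair_kernel u y = distr (Q u y) (borel \<Otimes>\<^sub>M borel) (Pair y)"

lemma measurable_pair_kernel:
  "0 \<le> u \<Longrightarrow> pair_kernel u \<in> borel \<rightarrow>\<^sub>M subprob_algebra (borel \<Otimes>\<^sub>M borel)"
  unfolding pair_kernel_def by (rule measurable_distr2[where M=borel]) auto

text \<open>
  On rectangles this is the Markov property at time \<open>s\<close>, integrated over the starting point, together
  with \<open>\<mu> Q\<^sub>s = \<mu>\<close>.  Rectangles form an intersection-stable generator.
\<close>

lemma joint_law:
  assumes s: "0 \<le> s" and u: "0 \<le> u"
  shows "distr N (borel \<Otimes>\<^sub>M borel) (\<lambda>\<omega>. (X s \<omega>, X (s + u) \<omega>)) = \<mu> \<bind> pair_kernel u"
    (is "?L = ?R")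
proof -
  have su: "0 \<le> s + u" using s u by simp
  note [measurable] = measurable_X[OF s] measurable_X[OF su] measurable_Q[OF u]
  have pk: "pair_kernel u \<in> \<mu> \<rightarrow>\<^sub>M subprob_algebra (borel \<Otimes>\<^sub>M borel)"
    using measurable_pair_kernel[OF u] by (simp add: measurable_cong_sets[OF sets_mu refl])
  have setsR: "sets ?R = sets (borel \<Otimes>\<^sub>M borel)"
    by (rule sets_bind_measurable[OF pk]) simp
  have finite_L: "finite_measure ?L"
    by (rule N.finite_measure_distr) measurable
  let ?E = "{a \<times> b |a b. a \<in> sets (borel::'s measure) \<and> b \<in> sets (borel::'s measure)}"
  show ?thesis
  proof (rule measure_eqI_generator_eq[where E="?E" and \<Omega>=UNIV and A="\<lambda>_. UNIV"])
    fix C assume "C \<in> ?E"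
    then obtain A B where C: "C = A \<times> B" and [measurable]: "A \<in> sets borel" "B \<in> sets borel"
      by auto
    have "emeasure ?L C = emeasure N {\<omega>\<in>space M. X s \<omega> \<in> A \<and> X (s + u) \<omega> \<in> B}"
      unfolding C by (subst emeasure_distr) (auto intro!: arg_cong[where f="emeasure N"])
    also have "\<dots> = (\<integral>\<^sup>+x. emeasure (P x) {\<omega>\<in>space M. X s \<omega> \<in> A \<and> X (s + u) \<omega> \<in> B} \<partial>\<mu>)"
      by (rule emeasure_N) measurable
    also have "\<dots> = (\<integral>\<^sup>+x. \<integral>\<^sup>+y. indicator A y * emeasure (Q u y) B \<partial>Q s x \<partial>\<mu>)"
      by (simp add: markov_property[OF s u])
    also have "\<dots> = (\<integral>\<^sup>+y. indicator A y * emeasure (Q u y) B \<partial>(\<mu> \<bind> Q s))"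
      by (rule nn_integral_bind[symmetric, where B=borel])
         (auto simp: measurable_cong_sets[OF sets_mu refl] s)
    also have "\<mu> \<bind> Q s = \<mu>"
    proof (rule measure_eqI)
      have Qs: "Q s \<in> \<mu> \<rightarrow>\<^sub>M subprob_algebra borel"
        using measurable_Q[OF s] by (simp add: measurable_cong_sets[OF sets_mu refl])
      show "sets (\<mu> \<bind> Q s) = sets \<mu>"
        using sets_bind_measurable[OF Qs] by simp
      fix B assume "B \<in> sets (\<mu> \<bind> Q s)"
      then have "B \<in> sets borel" using sets_bind_measurable[OF Qs] by simp
      then show "emeasure (\<mu> \<bind> Q s) B = emeasure \<mu> B"
        using invariant s by (subst emeasure_bind[OF _ Qs]) (auto simp: invariant_prob_def)
    qed
    also have "(\<integral>\<^sup>+y. indicator A y * emeasure (Q u y) B \<partial>\<mu>) = (\<integral>\<^sup>+y. emeasure (pair_kernel u y) C \<partial>\<mu>)"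
      by (intro nn_integral_cong)
         (auto simp: pair_kernel_def emeasure_distr C indicator_def vimage_def)
    also have "\<dots> = emeasure ?R C"
      by (rule emeasure_bind[OF _ pk, symmetric]) (auto simp: C)
    finally show "emeasure ?L C = emeasure ?R C" .
  next
    show "Int_stable ?E" by (rule Int_stable_pair_measure_generator)
    show "sets ?L = sigma_sets UNIV ?E"
      by (simp add: sets_pair_measure)
    show "sets ?R = sigma_sets UNIV ?E"
      unfolding setsR by (simp add: sets_pair_measure)
    show "range (\<lambda>_. UNIV) \<subseteq> ?E"
      by (intro image_subsetI CollectI exI[of _ UNIV]) simp
    show "emeasure ?L UNIV \<noteq> \<infinity>" for i :: nat
      by (simp add: finite_measure.emeasure_finite[OF finite_L])
  qed auto
qed

lemma expectation_X:
  fixes f :: "'s \<Rightarrow> real"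
  assumes t: "0 \<le> t" and [measurable]: "f \<in> borel_measurable borel"
  shows "(\<integral>\<omega>. f (X t \<omega>) \<partial>N) = (\<integral>y. f y \<partial>\<mu>)"
proof -
  note [measurable] = measurable_X[OF t]
  have "(\<integral>\<omega>. f (X t \<omega>) \<partial>N) = (\<integral>y. f y \<partial>distr N borel (X t))"
    by (rule integral_distr[symmetric]) auto
  then show ?thesis by (simp only: law_X[OF t])
qed

lemma expectation_X_pair:
  fixes f g :: "'s \<Rightarrow> real"
  assumes s: "0 \<le> s" and u: "0 \<le> u"
    and [measurable]: "f \<in> borel_measurable borel" "g \<in> borel_measurable borel"
    and bounded: "\<And>y. \<bar>f y\<bar> \<le> a" "\<And>y. \<bar>g y\<bar> \<le> b"
  shows "(\<integral>\<omega>. f (X s \<omega>) * g (X (s + u) \<omega>) \<partial>N) = (\<integral>y. f y * (\<integral>z. g z \<partial>Q u y) \<partial>\<mu>)"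
proof -
  have su: "0 \<le> s + u" using s u by simp
  note [measurable] = measurable_X[OF s] measurable_X[OF su]
  have ab: "\<bar>f y * g z\<bar> \<le> a * b" for y z
    unfolding abs_mult by (intro mult_mono bounded) (use bounded(1)[of y] in auto)
  have pk: "pair_kernel u \<in> \<mu> \<rightarrow>\<^sub>M subprob_algebra (borel \<Otimes>\<^sub>M borel)"
    using measurable_pair_kernel[OF u] by (simp add: measurable_cong_sets[OF sets_mu refl])
  have "(\<integral>\<omega>. f (X s \<omega>) * g (X (s + u) \<omega>) \<partial>N) =
      (\<integral>(y, z). f y * g z \<partial>distr N (borel \<Otimes>\<^sub>M borel) (\<lambda>\<omega>. (X s \<omega>, X (s + u) \<omega>)))"
    by (subst integral_distr) auto
  also have "\<dots> = (\<integral>(y, z). f y * g z \<partial>(\<mu> \<bind> pair_kernel u))"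
    by (simp only: joint_law[OF s u])
  also have "\<dots> = (\<integral>y. (\<integral>(y, z). f y * g z \<partial>pair_kernel u y) \<partial>\<mu>)"
  proof (rule integral_bind[where K="borel \<Otimes>\<^sub>M borel" and B="a * b" and B'=1])
    have "emeasure (pair_kernel u y) (space (pair_kernel u y)) \<le> ennreal 1" for y
    proof -
      have "prob_space (pair_kernel u y)"
        unfolding pair_kernel_def by (rule prob_space.prob_space_distr[OF prob_space_Q[OF u]]) simp
      then show ?thesis by (simp add: prob_space.emeasure_space_1)
    qed
    then show "AE y in \<mu>. emeasure (pair_kernel u y) (space (pair_kernel u y)) \<le> ennreal 1"
      by simp
  qed (use pk ab in \<open>auto simp: mu.finite_measure_axioms\<close>)
  also have "\<dots> = (\<integral>y. f y * (\<integral>z. g z \<partial>Q u y) \<partial>\<mu>)"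
    by (simp add: pair_kernel_def integral_distr)
  finally show ?thesis .
qed

end

section \<open>Second moments of time integrals\<close>

lemma norm_integral_le_nn_integral:
  fixes f :: "'a \<Rightarrow> 'b::{banach, second_countable_topology}"
  shows "ennreal (norm (integral\<^sup>L M f)) \<le> (\<integral>\<^sup>+x. ennreal (norm (f x)) \<partial>M)"
  by (cases "integrable M f") (auto simp: integral_norm_bound_ennreal not_integrable_integral_eq)

lemma nn_integral_lag:
  fixes \<phi> :: "real \<Rightarrow> ennreal"
  assumes [measurable]: "\<phi> \<in> borel_measurable borel"
  shows "(\<integral>\<^sup>+t. \<phi> (t - s) * indicator {s<..} t \<partial>lborel) = (\<integral>\<^sup>+u. \<phi> u * indicator {0<..} u \<partial>lborel)"
    and "(\<integral>\<^sup>+t. \<phi> (s - t) * indicator {..<s} t \<partial>lborel) = (\<integral>\<^sup>+u. \<phi> u * indicator {0<..} u \<partial>lborel)"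
proof -
  show "(\<integral>\<^sup>+t. \<phi> (t - s) * indicator {s<..} t \<partial>lborel) = (\<integral>\<^sup>+u. \<phi> u * indicator {0<..} u \<partial>lborel)"
    by (subst nn_integral_real_affine[where c=1 and t=s]) (auto intro!: nn_integral_cong simp: indicator_def)
  show "(\<integral>\<^sup>+t. \<phi> (s - t) * indicator {..<s} t \<partial>lborel) = (\<integral>\<^sup>+u. \<phi> u * indicator {0<..} u \<partial>lborel)"
    by (subst nn_integral_real_affine[where c="-1" and t=s]) (auto intro!: nn_integral_cong simp: indicator_def)
qed

text \<open>
  Expanding the square gives \<open>\<integral>\<integral>E[Z\<^sub>s Z\<^sub>t] ds dt\<close> over \<open>[0, T]\<^sup>2\<close>.  For fixed \<open>s\<close> the inner integral is at
  most \<open>2 I\<close>, once for the lags to the right of \<open>s\<close> and once for those to the left.  Only positive lags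
  need a bound because the diagonal is a null set.
\<close>

lemma (in prob_space) second_moment_time_integral:
  fixes Z :: "real \<Rightarrow> 'a \<Rightarrow> real" and \<phi> :: "real \<Rightarrow> ennreal"
  assumes Z[measurable]: "case_prod Z \<in> borel_measurable (borel \<Otimes>\<^sub>M M)"
    and bounded: "\<And>s \<omega>. \<bar>Z s \<omega>\<bar> \<le> b" and T: "0 \<le> T"
    and [measurable]: "\<phi> \<in> borel_measurable borel"
    and corr: "\<And>s u. 0 \<le> s \<Longrightarrow> 0 < u \<Longrightarrow> ennreal \<bar>expectation (\<lambda>\<omega>. Z s \<omega> * Z (s + u) \<omega>)\<bar> \<le> \<phi> u"
    and I: "(\<integral>\<^sup>+u. \<phi> u * indicator {0<..} u \<partial>lborel) \<le> ennreal I" and "0 \<le> I"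
  shows "expectation (\<lambda>\<omega>. (LBINT s:{0..T}. Z s \<omega>)\<^sup>2) \<le> 2 * T * I"
proof -
  \<comment> \<open>Lebesgue measure restricted to \<open>[0, T]\<close>, kept on the whole line; being finite, it makes the bounded
      integrands below integrable\<close>
  define \<nu> where "\<nu> = density lborel (indicator {0..T} :: real \<Rightarrow> ennreal)"
  have [measurable_cong, simp]: "sets \<nu> = sets borel" by (simp add: \<nu>_def)
  have sp[simp]: "space \<nu> = UNIV" by (simp add: \<nu>_def)
  interpret \<nu>: finite_measure \<nu>
    by standard (simp add: \<nu>_def emeasure_density T)
  interpret pr: finite_measure "\<nu> \<Otimes>\<^sub>M M"
    by (rule finite_measure_pair_measure) unfold_locales
  interpret pr2: pair_sigma_finite \<nu> M ..
  have Z'[measurable]: "case_prod Z \<in> borel_measurable (\<nu> \<Otimes>\<^sub>M M)"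
    using Z by simp
  have [measurable]: "Z s \<in> borel_measurable M" for s
    using measurable_compose[OF measurable_Pair1' Z, of s] by simp
  have b0: "0 \<le> b" using bounded[of 0 undefined] by linarith
  define Y where "Y \<omega> = (\<integral>s. Z s \<omega> \<partial>\<nu>)" for \<omega>
  have Y_eq: "(LBINT s:{0..T}. Z s \<omega>) = Y \<omega>" if "\<omega> \<in> space M" for \<omega>
  proof -
    have m: "(\<lambda>s. Z s \<omega>) \<in> borel_measurable borel"
      using measurable_compose[OF measurable_Pair2'[OF that] Z] by simp
    have "Y \<omega> = (\<integral>s. Z s \<omega> \<partial>density lborel (\<lambda>s. ennreal (indicator {0..T} s)))"
      by (simp add: Y_def \<nu>_def ennreal_indicator)
    also have "\<dots> = (LBINT s:{0..T}. Z s \<omega>)"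
      using m by (subst integral_density) (auto simp: set_lebesgue_integral_def)
    finally show ?thesis by simp
  qed
  have Ym[measurable]: "Y \<in> borel_measurable M"
    unfolding Y_def by measurable
  define B where "B = b * measure \<nu> UNIV"
  have Yb: "\<bar>Y \<omega>\<bar> \<le> B" if "\<omega> \<in> space M" for \<omega>
  proof -
    have m: "(\<lambda>s. Z s \<omega>) \<in> borel_measurable \<nu>"
      using measurable_compose[OF measurable_Pair2'[OF that] Z] by simp
    have "\<bar>Y \<omega>\<bar> \<le> (\<integral>s. \<bar>Z s \<omega>\<bar> \<partial>\<nu>)" unfolding Y_def by (rule integral_abs_bound)
    also have "\<dots> \<le> (\<integral>s. b \<partial>\<nu>)"
      by (intro integral_mono \<nu>.integrable_const_bound[where B=b]) (use m bounded b0 in auto)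
    finally show ?thesis by (simp add: B_def mult.commute)
  qed
  have B0: "0 \<le> B" using b0 by (simp add: B_def)
  define e where "e s t = expectation (\<lambda>\<omega>. Z s \<omega> * Z t \<omega>)" for s t
  have "expectation (\<lambda>\<omega>. (LBINT s:{0..T}. Z s \<omega>)\<^sup>2) = expectation (\<lambda>\<omega>. (Y \<omega>)\<^sup>2)"
    by (intro Bochner_Integration.integral_cong) (auto simp: Y_eq)
  also have "\<dots> = (\<integral>\<omega>. (\<integral>s. Z s \<omega> * Y \<omega> \<partial>\<nu>) \<partial>M)"
    by (simp add: Y_def power2_eq_square)
  also have "\<dots> = (\<integral>s. (\<integral>\<omega>. Z s \<omega> * Y \<omega> \<partial>M) \<partial>\<nu>)"
  proof (rule pr2.Fubini_integral)
    show "integrable (\<nu> \<Otimes>\<^sub>M M) (\<lambda>(s, \<omega>). Z s \<omega> * Y \<omega>)"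
      by (rule pr.integrable_const_bound[where B="b * B"])
         (auto intro!: AE_I2 mult_mono simp: abs_mult bounded Yb space_pair_measure b0)
  qed
  also have "\<dots> = (\<integral>s. (\<integral>t. e s t \<partial>\<nu>) \<partial>\<nu>)"
  proof (intro Bochner_Integration.integral_cong refl)
    fix s
    have "(\<integral>\<omega>. Z s \<omega> * Y \<omega> \<partial>M) = (\<integral>\<omega>. (\<integral>t. Z s \<omega> * Z t \<omega> \<partial>\<nu>) \<partial>M)"
      by (simp add: Y_def)
    also have "\<dots> = (\<integral>t. e s t \<partial>\<nu>)"
      unfolding e_def
    proof (rule pr2.Fubini_integral)
      show "integrable (\<nu> \<Otimes>\<^sub>M M) (\<lambda>(t, \<omega>). Z s \<omega> * Z t \<omega>)"
        by (rule pr.integrable_const_bound[where B="b * b"])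
           (auto intro!: AE_I2 mult_mono simp: abs_mult bounded space_pair_measure b0)
    qed
    finally show "(\<integral>\<omega>. Z s \<omega> * Y \<omega> \<partial>M) = (\<integral>t. e s t \<partial>\<nu>)" .
  qed
  finally have eq: "expectation (\<lambda>\<omega>. (LBINT s:{0..T}. Z s \<omega>)\<^sup>2) = (\<integral>s. (\<integral>t. e s t \<partial>\<nu>) \<partial>\<nu>)" .
  have e_bound: "ennreal \<bar>e s t\<bar> \<le> \<phi> (t - s) * indicator {s<..} t + \<phi> (s - t) * indicator {..<s} t"
    if "0 \<le> s" "0 \<le> t" "s \<noteq> t" for s t
  proof (cases "s < t")
    case True
    with corr[of s "t - s"] that show ?thesis by (simp add: e_def)
  next
    case False
    with corr[of t "s - t"] that show ?thesis by (simp add: e_def mult.commute)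
  qed
  have inner: "ennreal \<bar>\<integral>t. e s t \<partial>\<nu>\<bar> \<le> ennreal (2 * I)" if s: "0 \<le> s" for s
  proof -
    have "ennreal \<bar>\<integral>t. e s t \<partial>\<nu>\<bar> \<le> (\<integral>\<^sup>+t. ennreal \<bar>e s t\<bar> \<partial>\<nu>)"
      using norm_integral_le_nn_integral[of \<nu> "e s"] by simp
    also have "\<dots> = (\<integral>\<^sup>+t. indicator {0..T} t * ennreal \<bar>e s t\<bar> \<partial>lborel)"
      unfolding \<nu>_def e_def by (subst nn_integral_density) auto
    also have "\<dots> \<le> (\<integral>\<^sup>+t. \<phi> (t - s) * indicator {s<..} t + \<phi> (s - t) * indicator {..<s} t \<partial>lborel)"
    proof (rule nn_integral_mono_AE)
      show "AE t in lborel. indicator {0..T} t * ennreal \<bar>e s t\<bar>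
          \<le> \<phi> (t - s) * indicator {s<..} t + \<phi> (s - t) * indicator {..<s} t"
        using AE_lborel_singleton[of s]
      proof eventually_elim
        case (elim t)
        then show ?case using e_bound[OF s, of t] by (cases "t \<in> {0..T}") auto
      qed
    qed
    also have "\<dots> = 2 * (\<integral>\<^sup>+u. \<phi> u * indicator {0<..} u \<partial>lborel)"
      by (subst nn_integral_add) (auto simp: nn_integral_lag mult_2)
    also have "\<dots> \<le> 2 * ennreal I" by (intro mult_left_mono I) simp
    also have "\<dots> = ennreal (2 * I)" using \<open>0 \<le> I\<close> by (simp add: ennreal_mult)
    finally show ?thesis .
  qed
  have "ennreal \<bar>\<integral>s. (\<integral>t. e s t \<partial>\<nu>) \<partial>\<nu>\<bar> \<le> (\<integral>\<^sup>+s. ennreal \<bar>\<integral>t. e s t \<partial>\<nu>\<bar> \<partial>\<nu>)"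
    using norm_integral_le_nn_integral[of \<nu> "\<lambda>s. \<integral>t. e s t \<partial>\<nu>"] by simp
  also have "\<dots> \<le> (\<integral>\<^sup>+s. ennreal (2 * I) \<partial>\<nu>)"
  proof (rule nn_integral_mono_AE)
    have "AE s in \<nu>. 0 \<le> s"
      unfolding \<nu>_def by (subst AE_density) (auto simp: indicator_def)
    then show "AE s in \<nu>. ennreal \<bar>\<integral>t. e s t \<partial>\<nu>\<bar> \<le> ennreal (2 * I)"
    proof eventually_elim
      case (elim s)
      then show ?case by (rule inner)
    qed
  qed
  also have "\<dots> = ennreal (2 * I) * emeasure \<nu> UNIV" by simp
  also have "\<dots> = ennreal (2 * T * I)"
    using T \<open>0 \<le> I\<close> by (simp add: \<nu>_def emeasure_density ennreal_mult[symmetric] mult_ac)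
  finally have "\<bar>\<integral>s. (\<integral>t. e s t \<partial>\<nu>) \<partial>\<nu>\<bar> \<le> 2 * T * I"
    using T \<open>0 \<le> I\<close> by (simp add: ennreal_le_iff)
  then show ?thesis unfolding eq by linarith
qed

context stationary_right_process begin

lemma right_continuous_path:
  "\<omega> \<in> space M \<Longrightarrow> 0 \<le> t \<Longrightarrow> ((\<lambda>s. X s \<omega>) \<longlongrightarrow> X t \<omega>) (at_right t)"
  using right_process by (auto simp: borel_right_process_def)

text \<open>
  Right-continuous paths are the pointwise limits of their values at the next point of a grid of mesh
  \<open>1 / (n + 1)\<close>, and the process on a grid takes countably many times.  The grid point lies strictly to
  the right of the time, where the paths are continuous.  Negative times, at which nothing is known about
  \<open>X\<close>, are sent to 0.
\<close>

lemma measurable_X_joint: "(\<lambda>(s, \<omega>). X (max 0 s) \<omega>) \<in> borel \<Otimes>\<^sub>M M \<rightarrow>\<^sub>M borel"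
proof (rule borel_measurable_LIMSEQ_metric)
  define k where "k n s = nat \<lfloor>real (Suc n) * max 0 s\<rfloor>" for n s
  fix n :: nat
  show "(\<lambda>(s, \<omega>). X ((real (k n s) + 1) / real (Suc n)) \<omega>) \<in> borel \<Otimes>\<^sub>M M \<rightarrow>\<^sub>M borel"
  proof -
    have "(\<lambda>p. X ((real (k n (fst p)) + 1) / real (Suc n)) (snd p)) \<in> borel \<Otimes>\<^sub>M M \<rightarrow>\<^sub>M borel"
    proof (rule measurable_compose_countable[where f="\<lambda>j p. X ((real j + 1) / real (Suc n)) (snd p)"])
      show "(\<lambda>p. X ((real j + 1) / real (Suc n)) (snd p)) \<in> borel \<Otimes>\<^sub>M M \<rightarrow>\<^sub>M borel" for j
        by (rule measurable_compose[OF measurable_snd measurable_X]) simp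
      show "(\<lambda>p. k n (fst p)) \<in> borel \<Otimes>\<^sub>M M \<rightarrow>\<^sub>M count_space UNIV"
        unfolding k_def by measurable
    qed
    then show ?thesis by (simp add: case_prod_beta)
  qed
next
  define k where "k n s = nat \<lfloor>real (Suc n) * max 0 s\<rfloor>" for n s
  fix p assume "p \<in> space ((borel :: real measure) \<Otimes>\<^sub>M M)"
  then obtain s \<omega> where p: "p = (s, \<omega>)" and \<omega>: "\<omega> \<in> space M"
    by (auto simp: space_pair_measure)
  define m where "m = max 0 s"
  have m: "0 \<le> m" by (simp add: m_def)
  let ?\<tau> = "\<lambda>n. (real (k n s) + 1) / real (Suc n)"
  have k1: "real (Suc n) * m < real (k n s) + 1" and k2: "real (k n s) \<le> real (Suc n) * m" for n
  proof -
    have "0 \<le> real (Suc n) * m" using m by simp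
    then have "real (k n s) = of_int \<lfloor>real (Suc n) * m\<rfloor>" by (simp add: k_def m_def[symmetric])
    then show "real (Suc n) * m < real (k n s) + 1" "real (k n s) \<le> real (Suc n) * m"
      by linarith+
  qed
  have gt: "m < ?\<tau> n" for n
    using k1[of n] by (simp add: pos_less_divide_eq mult.commute del: of_nat_Suc)
  have le: "?\<tau> n \<le> m + 1 / real (Suc n)" for n
    using k2[of n] by (simp add: field_simps del: of_nat_Suc)
  have "?\<tau> \<longlonglongrightarrow> m"
  proof (rule tendsto_sandwich[of "\<lambda>_. m" _ _ "\<lambda>n. m + 1 / real (Suc n)"])
    show "(\<lambda>n. m + 1 / real (Suc n)) \<longlonglongrightarrow> m"
      using tendsto_add[OF tendsto_const[of m] LIMSEQ_Suc[OF lim_1_over_n]] by simp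
  qed (use gt le in \<open>auto intro!: always_eventually less_imp_le simp del: of_nat_Suc\<close>)
  then have "filterlim ?\<tau> (at_right m) sequentially"
    unfolding filterlim_at using gt by (auto intro!: always_eventually simp del: of_nat_Suc)
  from filterlim_compose[OF right_continuous_path[OF \<omega> m] this]
  show "(\<lambda>n. (\<lambda>(s, \<omega>). X ((real (k n s) + 1) / real (Suc n)) \<omega>) p) \<longlonglongrightarrow> (\<lambda>(s, \<omega>). X (max 0 s) \<omega>) p"
    by (simp add: p m_def)
qed

end

section \<open>Autocovariances\<close>

text \<open>
  In the stationary regime this is the covariance of \<open>f (X s)\<close> and \<open>f (X (s + u))\<close>.  Keeping the
  difference \<open>Q\<^sub>u f - \<mu>(f)\<close> in one factor is what lets convergence to equilibrium be used.
\<close>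

definition autocov ::
  "('s \<Rightarrow> 'w measure) \<Rightarrow> (real \<Rightarrow> 'w \<Rightarrow> 's::topological_space) \<Rightarrow> 's measure \<Rightarrow> ('s \<Rightarrow> real) \<Rightarrow> real \<Rightarrow> real"
  where "autocov P X \<mu> f u = (\<integral>y. f y * ((\<integral>z. f z \<partial>transition P X u y) - (\<integral>z. f z \<partial>\<mu>)) \<partial>\<mu>)"

lemma (in prob_space) abs_integral_le_const:
  fixes f :: "'a \<Rightarrow> real"
  assumes "\<And>x. \<bar>f x\<bar> \<le> b"
  shows "\<bar>\<integral>x. f x \<partial>M\<bar> \<le> b"
proof -
  have "0 \<le> b" using assms[of undefined] by linarith
  have "ennreal \<bar>\<integral>x. f x \<partial>M\<bar> \<le> (\<integral>\<^sup>+x. ennreal \<bar>f x\<bar> \<partial>M)"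
    using norm_integral_le_nn_integral[of M f] by simp
  also have "\<dots> \<le> (\<integral>\<^sup>+x. ennreal b \<partial>M)"
    by (intro nn_integral_mono ennreal_leI assms)
  also have "\<dots> = ennreal b" by (simp add: emeasure_space_1)
  finally show ?thesis using \<open>0 \<le> b\<close> by simp
qed

text \<open>
  After division by \<open>b\<close> the function competes in the supremum that defines the distance.
\<close>

lemma abs_integral_diff_le_tv_dist:
  fixes f :: "'s::topological_space \<Rightarrow> real"
  assumes "prob_space \<nu>\<^sub>1" "prob_space \<nu>\<^sub>2"
    and f: "f \<in> borel_measurable borel" and bounded: "\<And>y. \<bar>f y\<bar> \<le> b" and b: "0 < b"
  shows "\<bar>(\<integral>y. f y \<partial>\<nu>\<^sub>1) - (\<integral>y. f y \<partial>\<nu>\<^sub>2)\<bar> \<le> b * tv_dist \<nu>\<^sub>1 \<nu>\<^sub>2"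
proof -
  interpret n1: prob_space \<nu>\<^sub>1 by fact
  interpret n2: prob_space \<nu>\<^sub>2 by fact
  let ?U = "{f \<in> borel_measurable borel. \<forall>y. \<bar>f y\<bar> \<le> 1} :: ('s \<Rightarrow> real) set"
  let ?D = "\<lambda>f. \<bar>(\<integral>y. f y \<partial>\<nu>\<^sub>1) - (\<integral>y. f y \<partial>\<nu>\<^sub>2)\<bar>"
  have "?D g \<le> 2" if "g \<in> ?U" for g
    using n1.abs_integral_le_const[of g 1] n2.abs_integral_le_const[of g 1] that by force
  then have "bdd_above (?D ` ?U)" by (intro bdd_aboveI[of _ 2]) auto
  moreover have "(\<lambda>y. f y / b) \<in> ?U"
    using f b bounded by (auto simp: abs_divide)
  ultimately have "?D (\<lambda>y. f y / b) \<le> tv_dist \<nu>\<^sub>1 \<nu>\<^sub>2"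
    unfolding tv_dist_def by (rule cSUP_upper[rotated])
  also have "?D (\<lambda>y. f y / b) = ?D f / b"
    using b by (simp add: abs_divide diff_divide_distrib[symmetric])
  finally show ?thesis using b by (simp add: field_simps)
qed

context stationary_right_process begin

context
  fixes f :: "'s \<Rightarrow> real" and b :: real
  assumes f[measurable]: "f \<in> borel_measurable borel" and bounded: "\<And>y. \<bar>f y\<bar> \<le> b"
begin

lemma Q_integral_measurable[measurable]:
  "0 \<le> u \<Longrightarrow> (\<lambda>y. \<integral>z. f z \<partial>Q u y) \<in> borel_measurable borel"
  using measurable_compose[OF measurable_Q integral_measurable_subprob_algebra[OF f]] by simp

lemma integrable_X: "0 \<le> t \<Longrightarrow> integrable N (\<lambda>\<omega>. f (X t \<omega>))"
  by (rule N.integrable_const_bound[where B=b])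
     (auto simp: bounded intro: measurable_compose[OF measurable_X f])

text \<open>
  Only one of the two factors has to be centred, since the centred one has mean zero.
\<close>

lemma covariance_X:
  assumes s: "0 \<le> s" and u: "0 \<le> u"
  shows "(\<integral>\<omega>. (f (X s \<omega>) - (\<integral>y. f y \<partial>\<mu>)) * (f (X (s + u) \<omega>) - (\<integral>y. f y \<partial>\<mu>)) \<partial>N) = autocov P X \<mu> f u"
proof -
  define m where "m = (\<integral>y. f y \<partial>\<mu>)"
  have su: "0 \<le> s + u" using s u by simp
  note [measurable] = measurable_X[OF s] measurable_X[OF su]
  interpret Qu: prob_space "Q u y" for y by (rule prob_space_Q[OF u])
  have m: "\<bar>m\<bar> \<le> b" unfolding m_def by (rule mu.abs_integral_le_const[OF bounded])
  have bm: "\<bar>f y - m\<bar> \<le> 2 * b" for y using bounded[of y] m by linarith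
  have b0: "0 \<le> b" using m by linarith
  have int: "integrable N (\<lambda>\<omega>. f (X s \<omega>) * (f (X (s + u) \<omega>) - m))"
    by (rule N.integrable_const_bound[where B="b * (2 * b)"])
       (auto intro!: AE_I2 mult_mono simp: abs_mult bounded bm b0)
  have intQ: "integrable (Q u y) f" for y
    by (rule Qu.integrable_const_bound[where B=b]) (auto simp: bounded)
  have "(\<integral>\<omega>. (f (X s \<omega>) - m) * (f (X (s + u) \<omega>) - m) \<partial>N) =
      (\<integral>\<omega>. f (X s \<omega>) * (f (X (s + u) \<omega>) - m) - m * (f (X (s + u) \<omega>) - m) \<partial>N)"
    by (simp add: algebra_simps)
  also have "\<dots> = (\<integral>\<omega>. f (X s \<omega>) * (f (X (s + u) \<omega>) - m) \<partial>N) - m * (\<integral>\<omega>. f (X (s + u) \<omega>) - m \<partial>N)"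
    using int integrable_X[OF su] by (subst Bochner_Integration.integral_diff) auto
  also have "(\<integral>\<omega>. f (X (s + u) \<omega>) - m \<partial>N) = 0"
    using integrable_X[OF su] N.prob_space by (simp add: expectation_X[OF su f] m_def)
  also have "(\<integral>\<omega>. f (X s \<omega>) * (f (X (s + u) \<omega>) - m) \<partial>N) = (\<integral>y. f y * (\<integral>z. f z - m \<partial>Q u y) \<partial>\<mu>)"
    by (rule expectation_X_pair[OF s u _ _ bounded bm]) measurable
  also have "\<dots> = autocov P X \<mu> f u"
    using intQ Qu.prob_space by (simp add: autocov_def m_def[symmetric])
  finally show ?thesis by (simp add: m_def)
qed

lemma variance_time_average:
  assumes T: "0 < T" and [measurable]: "\<phi> \<in> borel_measurable borel"
    and cov: "\<And>u. 0 < u \<Longrightarrow> ennreal \<bar>autocov P X \<mu> f u\<bar> \<le> \<phi> u"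
    and I: "(\<integral>\<^sup>+u. \<phi> u * indicator {0<..} u \<partial>lborel) \<le> ennreal I" and I0: "0 \<le> I"
  shows "(\<integral>\<omega>. ((1 / T) * (LBINT s:{0..T}. f (X s \<omega>)) - (\<integral>y. f y \<partial>\<mu>))\<^sup>2 \<partial>N) \<le> 2 * I / T"
proof -
  define m where "m = (\<integral>y. f y \<partial>\<mu>)"
  define Z where "Z s \<omega> = f (X (max 0 s) \<omega>) - m" for s \<omega>
  have m: "\<bar>m\<bar> \<le> b" unfolding m_def by (rule mu.abs_integral_le_const[OF bounded])
  have fX: "(\<lambda>(s, \<omega>). f (X (max 0 s) \<omega>)) \<in> borel_measurable (borel \<Otimes>\<^sub>M M)"
    using measurable_compose[OF measurable_X_joint f] by (simp add: case_prod_beta)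
  then have Z: "case_prod Z \<in> borel_measurable (borel \<Otimes>\<^sub>M N)"
    unfolding Z_def by measurable
  have "(\<integral>\<omega>. (LBINT s:{0..T}. Z s \<omega>)\<^sup>2 \<partial>N) \<le> 2 * T * I"
  proof (rule N.second_moment_time_integral[OF Z _ _ _ _ I I0])
    show "\<bar>Z s \<omega>\<bar> \<le> 2 * b" for s \<omega>
      using bounded[of "X (max 0 s) \<omega>"] m by (simp add: Z_def)
    show "ennreal \<bar>N.expectation (\<lambda>\<omega>. Z s \<omega> * Z (s + u) \<omega>)\<bar> \<le> \<phi> u" if "0 \<le> s" "0 < u" for s u
      using cov[OF that(2)] covariance_X[of s u] that by (simp add: Z_def m_def max_def)
  qed (use T in auto)
  moreover have "((1 / T) * (LBINT s:{0..T}. f (X s \<omega>)) - m)\<^sup>2 = (LBINT s:{0..T}. Z s \<omega>)\<^sup>2 / T\<^sup>2"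
    if \<omega>: "\<omega> \<in> space M" for \<omega>
  proof -
    have meas: "(\<lambda>s. f (X (max 0 s) \<omega>)) \<in> borel_measurable borel"
      using measurable_compose[OF measurable_Pair2'[OF \<omega>] fX] by simp
    have int: "set_integrable lborel {0..T} (\<lambda>s. f (X (max 0 s) \<omega>))"
      unfolding set_integrable_def
      by (rule integrableI_bounded_set_indicator[where B=b]) (use meas bounded T in auto)
    have "(LBINT s:{0..T}. Z s \<omega>) = (LBINT s:{0..T}. f (X (max 0 s) \<omega>)) - (LBINT s:{0..T}. m)"
      unfolding Z_def by (rule set_integral_diff(2)[OF int])
        (auto simp: set_integrable_def T less_imp_le intro!: integrable_real_indicator)
    also have "(LBINT s:{0..T}. m) = T * m"
      using T by (simp add: set_lebesgue_integral_def)
    also have "(LBINT s:{0..T}. f (X (max 0 s) \<omega>)) = (LBINT s:{0..T}. f (X s \<omega>))"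
      by (rule set_lebesgue_integral_cong) auto
    finally have "(1 / T) * (LBINT s:{0..T}. f (X s \<omega>)) - m = (LBINT s:{0..T}. Z s \<omega>) / T"
      using T by (simp add: field_simps)
    then show ?thesis by (simp add: power_divide)
  qed
  then have "(\<integral>\<omega>. ((1 / T) * (LBINT s:{0..T}. f (X s \<omega>)) - m)\<^sup>2 \<partial>N)
      = (\<integral>\<omega>. (LBINT s:{0..T}. Z s \<omega>)\<^sup>2 / T\<^sup>2 \<partial>N)"
    by (intro Bochner_Integration.integral_cong) simp_all
  ultimately show ?thesis
    using T by (simp add: m_def field_simps power2_eq_square)
qed

text \<open>
  For an arbitrary target \<open>a\<close> the elementary \<open>(u + v)\<^sup>2 \<le> 2 u\<^sup>2 + 2 v\<^sup>2\<close> separates fluctuation and bias.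
\<close>

lemma mean_square_error_time_average:
  assumes T: "0 < T" and \<phi>: "\<phi> \<in> borel_measurable borel"
    and cov: "\<And>u. 0 < u \<Longrightarrow> ennreal \<bar>autocov P X \<mu> f u\<bar> \<le> \<phi> u"
    and I: "(\<integral>\<^sup>+u. \<phi> u * indicator {0<..} u \<partial>lborel) \<le> ennreal I" and I0: "0 \<le> I"
  shows "(\<integral>\<omega>. ((1 / T) * (LBINT s:{0..T}. f (X s \<omega>)) - a)\<^sup>2 \<partial>N) \<le> 4 * I / T + 2 * ((\<integral>y. f y \<partial>\<mu>) - a)\<^sup>2"
proof -
  define m where "m = (\<integral>y. f y \<partial>\<mu>)"
  define A where "A \<omega> = (1 / T) * (LBINT s:{0..T}. f (X s \<omega>))" for \<omega>
  have fX: "(\<lambda>(s, \<omega>). f (X (max 0 s) \<omega>)) \<in> borel_measurable (borel \<Otimes>\<^sub>M M)"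
    using measurable_compose[OF measurable_X_joint f] by (simp add: case_prod_beta)
  have "(\<lambda>(\<omega>, s). f (X (max 0 s) \<omega>)) \<in> borel_measurable (M \<Otimes>\<^sub>M borel)"
    using measurable_compose[OF measurable_pair_swap' fX] by (simp add: case_prod_beta)
  then have meas: "(\<lambda>(\<omega>, s). indicator {0..T} s * f (X (max 0 s) \<omega>)) \<in> borel_measurable (N \<Otimes>\<^sub>M lborel)"
    by measurable
  have A_eq: "A \<omega> = (1 / T) * (\<integral>s. indicator {0..T} s * f (X (max 0 s) \<omega>) \<partial>lborel)" for \<omega>
    unfolding A_def set_lebesgue_integral_def
    by (intro arg_cong2[where f="(*)"] refl Bochner_Integration.integral_cong) (auto simp: indicator_def)
  have A_meas: "A \<in> borel_measurable N"
    unfolding A_eq using lborel.borel_measurable_lebesgue_integral[OF meas] by measurable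
  have A_bound: "\<bar>A \<omega>\<bar> \<le> b" for \<omega>
  proof -
    have "0 \<le> b" using bounded[of undefined] by linarith
    have "ennreal \<bar>\<integral>s. indicator {0..T} s * f (X (max 0 s) \<omega>) \<partial>lborel\<bar>
        \<le> (\<integral>\<^sup>+s. ennreal \<bar>indicator {0..T} s * f (X (max 0 s) \<omega>)\<bar> \<partial>lborel)"
      using norm_integral_le_nn_integral[of lborel "\<lambda>s. indicator {0..T} s * f (X (max 0 s) \<omega>)"] by simp
    also have "\<dots> \<le> (\<integral>\<^sup>+s. ennreal b * indicator {0..T} s \<partial>lborel)"
      by (intro nn_integral_mono) (auto simp: indicator_def bounded intro!: ennreal_leI)
    also have "\<dots> = ennreal (b * T)" using T \<open>0 \<le> b\<close> by (simp add: nn_integral_cmult ennreal_mult)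
    finally show ?thesis using T \<open>0 \<le> b\<close> unfolding A_eq by (simp add: abs_mult field_simps)
  qed
  have int: "integrable N (\<lambda>\<omega>. (A \<omega> - c)\<^sup>2)" for c
  proof (rule N.integrable_const_bound[where B="(b + \<bar>c\<bar>)\<^sup>2"])
    have "\<bar>A \<omega> - c\<bar> \<le> \<bar>b + \<bar>c\<bar>\<bar>" for \<omega> using A_bound[of \<omega>] by linarith
    then show "AE \<omega> in N. norm ((A \<omega> - c)\<^sup>2) \<le> (b + \<bar>c\<bar>)\<^sup>2" by (simp add: abs_le_square_iff)
  qed (use A_meas in measurable)
  have "(\<integral>\<omega>. (A \<omega> - a)\<^sup>2 \<partial>N) \<le> (\<integral>\<omega>. 2 * (A \<omega> - m)\<^sup>2 + 2 * (m - a)\<^sup>2 \<partial>N)"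
  proof (rule integral_mono)
    fix \<omega>
    have "0 \<le> ((A \<omega> - m) - (m - a))\<^sup>2" by simp
    then show "(A \<omega> - a)\<^sup>2 \<le> 2 * (A \<omega> - m)\<^sup>2 + 2 * (m - a)\<^sup>2"
      by (simp add: power2_eq_square algebra_simps)
  qed (use int in auto)
  also have "\<dots> = 2 * (\<integral>\<omega>. (A \<omega> - m)\<^sup>2 \<partial>N) + 2 * (m - a)\<^sup>2"
    using int N.prob_space by simp
  also have "\<dots> \<le> 2 * (2 * I / T) + 2 * (m - a)\<^sup>2"
    using variance_time_average[OF T \<phi> cov I I0] by (simp add: A_def m_def)
  finally show ?thesis by (simp add: A_def m_def)
qed

text \<open>
  The three bounds through \<open>Q\<^sub>u f - \<mu>(f)\<close> below all have this form; the difference matters only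
  where \<open>f\<close> does not vanish, so a local estimate on the support of \<open>f\<close> is enough.
\<close>

lemma autocov_le:
  assumes u: "0 \<le> u" and "0 \<le> c"
    and diff: "AE y in \<mu>. f y \<noteq> 0 \<longrightarrow> \<bar>(\<integral>z. f z \<partial>Q u y) - (\<integral>z. f z \<partial>\<mu>)\<bar> \<le> c"
    and a: "(\<integral>\<^sup>+y. ennreal \<bar>f y\<bar> \<partial>\<mu>) \<le> ennreal a" and "0 \<le> a"
  shows "\<bar>autocov P X \<mu> f u\<bar> \<le> c * a"
proof -
  let ?d = "\<lambda>y. (\<integral>z. f z \<partial>Q u y) - (\<integral>z. f z \<partial>\<mu>)"
  have "ennreal \<bar>autocov P X \<mu> f u\<bar> \<le> (\<integral>\<^sup>+y. ennreal \<bar>f y * ?d y\<bar> \<partial>\<mu>)"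
    unfolding autocov_def using norm_integral_le_nn_integral[of \<mu> "\<lambda>y. f y * ?d y"] by simp
  also have "\<dots> \<le> (\<integral>\<^sup>+y. ennreal c * ennreal \<bar>f y\<bar> \<partial>\<mu>)"
  proof (rule nn_integral_mono_AE)
    show "AE y in \<mu>. ennreal \<bar>f y * ?d y\<bar> \<le> ennreal c * ennreal \<bar>f y\<bar>"
      using diff
    proof eventually_elim
      case (elim y)
      then have "\<bar>f y * ?d y\<bar> \<le> c * \<bar>f y\<bar>"
        by (cases "f y = 0") (auto simp: abs_mult mult.commute intro!: mult_left_mono)
      then show ?case using \<open>0 \<le> c\<close> by (simp add: ennreal_mult[symmetric])
    qed
  qed
  also have "\<dots> = ennreal c * (\<integral>\<^sup>+y. ennreal \<bar>f y\<bar> \<partial>\<mu>)"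
    by (rule nn_integral_cmult) simp
  also have "\<dots> \<le> ennreal c * ennreal a" by (intro mult_left_mono a) simp
  also have "\<dots> = ennreal (c * a)" using \<open>0 \<le> c\<close> \<open>0 \<le> a\<close> by (simp add: ennreal_mult)
  finally show ?thesis using \<open>0 \<le> c\<close> \<open>0 \<le> a\<close> by simp
qed

text \<open>
  Total variation controls bounded functions only through their supremum, which enters twice: as the
  size of \<open>f\<close> under the outer integral and as the size of the test function.
\<close>

lemma autocov_le_tv_dist:
  assumes u: "0 \<le> u" and b: "0 < b" and \<delta>: "0 \<le> \<delta>"
    and mixing: "(\<integral>\<^sup>+y. ennreal (tv_dist (Q u y) \<mu>) \<partial>\<mu>) \<le> ennreal \<delta>"
  shows "\<bar>autocov P X \<mu> f u\<bar> \<le> b\<^sup>2 * \<delta>"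
proof -
  let ?d = "\<lambda>y. (\<integral>z. f z \<partial>Q u y) - (\<integral>z. f z \<partial>\<mu>)"
  note [measurable] = Q_integral_measurable[OF u]
  have "ennreal \<bar>autocov P X \<mu> f u\<bar> \<le> (\<integral>\<^sup>+y. ennreal \<bar>f y * ?d y\<bar> \<partial>\<mu>)"
    unfolding autocov_def using norm_integral_le_nn_integral[of \<mu> "\<lambda>y. f y * ?d y"] by simp
  also have "\<dots> \<le> (\<integral>\<^sup>+y. ennreal (b\<^sup>2) * ennreal (\<bar>?d y\<bar> / b) \<partial>\<mu>)"
  proof (rule nn_integral_mono)
    fix y
    have "\<bar>f y * ?d y\<bar> \<le> b * \<bar>?d y\<bar>"
      unfolding abs_mult by (intro mult_right_mono bounded) simp
    also have "\<dots> = b\<^sup>2 * (\<bar>?d y\<bar> / b)" using b by (simp add: power2_eq_square)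
    finally show "ennreal \<bar>f y * ?d y\<bar> \<le> ennreal (b\<^sup>2) * ennreal (\<bar>?d y\<bar> / b)"
      using b by (subst ennreal_mult[symmetric]) (auto intro: ennreal_leI)
  qed
  also have "\<dots> = ennreal (b\<^sup>2) * (\<integral>\<^sup>+y. ennreal (\<bar>?d y\<bar> / b) \<partial>\<mu>)"
    by (rule nn_integral_cmult) measurable
  also have "(\<integral>\<^sup>+y. ennreal (\<bar>?d y\<bar> / b) \<partial>\<mu>) \<le> (\<integral>\<^sup>+y. ennreal (tv_dist (Q u y) \<mu>) \<partial>\<mu>)"
  proof (intro nn_integral_mono ennreal_leI)
    fix y
    show "\<bar>?d y\<bar> / b \<le> tv_dist (Q u y) \<mu>"
      using abs_integral_diff_le_tv_dist[OF prob_space_Q[OF u, of y] prob_space_mu f bounded b] b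
      by (simp add: field_simps)
  qed
  also note mixing
  finally have "ennreal \<bar>autocov P X \<mu> f u\<bar> \<le> ennreal (b\<^sup>2) * ennreal \<delta>"
    by (simp add: mult_left_mono)
  then show ?thesis using \<delta> by (simp add: ennreal_mult[symmetric])
qed

end
end

section \<open>Integrated autocovariances of concentrated functions\<close>

text \<open>
  The majorant carries the measurability in the lag, so that \<open>c\<close> itself can be arbitrary.
\<close>

definition dominated_on :: "(real \<Rightarrow> real) \<Rightarrow> real set \<Rightarrow> real \<Rightarrow> bool" where
  "dominated_on c J I \<longleftrightarrow> (\<exists>\<phi>\<in>borel_measurable borel. (\<forall>u\<in>J. ennreal \<bar>c u\<bar> \<le> \<phi> u) \<and>
     (\<integral>\<^sup>+u. \<phi> u * indicator J u \<partial>lborel) \<le> ennreal I)"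

lemma dominated_onI:
  assumes "\<phi> \<in> borel_measurable borel" "\<And>u. u \<in> J \<Longrightarrow> ennreal \<bar>c u\<bar> \<le> \<phi> u"
    and "(\<integral>\<^sup>+u. \<phi> u * indicator J u \<partial>lborel) \<le> ennreal I"
  shows "dominated_on c J I"
  using assms unfolding dominated_on_def by blast

lemma dominated_on_mono: "dominated_on c J I \<Longrightarrow> I \<le> I' \<Longrightarrow> dominated_on c J I'"
  unfolding dominated_on_def by (meson ennreal_leI order_trans)

lemma dominated_on_Un:
  assumes "dominated_on c A I" "dominated_on c B J" and [measurable]: "A \<in> sets borel" "B \<in> sets borel"
    and "0 \<le> I" "0 \<le> J"
  shows "dominated_on c (A \<union> B) (I + J)"
proof -
  obtain \<phi> where [measurable]: "\<phi> \<in> borel_measurable borel" and \<phi>: "\<And>u. u \<in> A \<Longrightarrow> ennreal \<bar>c u\<bar> \<le> \<phi> u"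
      "(\<integral>\<^sup>+u. \<phi> u * indicator A u \<partial>lborel) \<le> ennreal I"
    using assms(1) unfolding dominated_on_def by blast
  obtain \<phi>' where [measurable]: "\<phi>' \<in> borel_measurable borel" and \<phi>': "\<And>u. u \<in> B \<Longrightarrow> ennreal \<bar>c u\<bar> \<le> \<phi>' u"
      "(\<integral>\<^sup>+u. \<phi>' u * indicator B u \<partial>lborel) \<le> ennreal J"
    using assms(2) unfolding dominated_on_def by blast
  show ?thesis
  proof (rule dominated_onI)
    show "(\<lambda>u. \<phi> u * indicator A u + \<phi>' u * indicator B u) \<in> borel_measurable borel" by measurable
    show "ennreal \<bar>c u\<bar> \<le> \<phi> u * indicator A u + \<phi>' u * indicator B u" if "u \<in> A \<union> B" for u
      using that \<phi>(1)[of u] \<phi>'(1)[of u] by (cases "u \<in> A") (auto intro: add_increasing2)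
    have "(\<integral>\<^sup>+u. (\<phi> u * indicator A u + \<phi>' u * indicator B u) * indicator (A \<union> B) u \<partial>lborel)
        \<le> (\<integral>\<^sup>+u. \<phi> u * indicator A u + \<phi>' u * indicator B u \<partial>lborel)"
      by (intro nn_integral_mono) (auto simp: indicator_def)
    also have "\<dots> = (\<integral>\<^sup>+u. \<phi> u * indicator A u \<partial>lborel) + (\<integral>\<^sup>+u. \<phi>' u * indicator B u \<partial>lborel)"
      by (rule nn_integral_add) measurable
    also have "\<dots> \<le> ennreal I + ennreal J" by (intro add_mono \<phi>(2) \<phi>'(2))
    also have "\<dots> = ennreal (I + J)" using assms by simp
    finally show "(\<integral>\<^sup>+u. (\<phi> u * indicator A u + \<phi>' u * indicator B u) * indicator (A \<union> B) u \<partial>lborel) \<le> ennreal (I + J)" .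
  qed
qed

text \<open>
  The order of growth, as the bandwidth \<open>h\<close> decreases to 0, of \<open>\<integral>min (h\<^sup>-\<^sup>d) (u\<^bsup>-d/2\<^esup>) du\<close> over \<open>(0, 1]\<close> for
  \<open>d \<ge> 2\<close>; in dimension 1 an integrable bound in place of \<open>u\<^bsup>-d/2\<^esup>\<close> keeps the integral bounded.
\<close>

definition variance_factor :: "nat \<Rightarrow> real \<Rightarrow> real" where
  "variance_factor d h = (if d = 1 then 1 else if d = 2 then 1 + ln (1 / h) else h powr (2 - real d))"

lemma variance_factor_ge_1: "0 < h \<Longrightarrow> h \<le> 1 \<Longrightarrow> 0 < d \<Longrightarrow> 1 \<le> variance_factor d h"
proof -
  assume h: "0 < h" "h \<le> 1" and d: "0 < d"
  have "1 \<le> h powr (2 - real d)" if "3 \<le> d"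
  proof -
    have "h powr 0 \<le> h powr (2 - real d)" by (rule powr_mono') (use h that in auto)
    then show ?thesis using h by simp
  qed
  moreover have "0 \<le> ln (1 / h)" using h by (simp add: ln_div)
  ultimately show "1 \<le> variance_factor d h" using d by (auto simp: variance_factor_def)
qed

lemma ln_le_variance_factor:
  assumes h: "0 < h" "h \<le> 1" and d: "2 \<le> d"
  shows "ln (1 / h) \<le> variance_factor d h"
proof (cases "d = 2")
  case False
  have "ln (1 / h) \<le> 1 / h - 1" using h by (intro ln_le_minus_one) simp
  also have "\<dots> \<le> h powr (- 1)" using h by (simp add: powr_minus_divide)
  also have "\<dots> \<le> h powr (2 - real d)" by (rule powr_mono') (use h d False in auto)
  finally show ?thesis using d False by (simp add: variance_factor_def)
qed (use h in \<open>simp add: variance_factor_def\<close>)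

text \<open>
  The primitive at the lower end point \<open>h\<^sup>2\<close> is \<open>- 2 ln (1 / h)\<close> for \<open>d = 2\<close> and a multiple of \<open>h\<^bsup>2-d\<^esup>\<close>
  for \<open>d \<ge> 3\<close>.
\<close>

lemma nn_integral_powr_le_variance_factor:
  assumes h: "0 < h" "h \<le> 1" and d: "2 \<le> d"
  shows "(\<integral>\<^sup>+u. ennreal (u powr (- real d / 2)) * indicator {h\<^sup>2..1} u \<partial>lborel) \<le> ennreal (2 * variance_factor d h)"
proof -
  have h2: "0 < h\<^sup>2" "h\<^sup>2 \<le> 1" using h by (auto simp: power_le_one)
  define G :: "real \<Rightarrow> real" where
    "G u = (if d = 2 then ln u else u powr (1 - real d / 2) / (1 - real d / 2))" for u
  have "((\<lambda>u. u powr (- real d / 2)) has_integral (G 1 - G (h\<^sup>2))) {h\<^sup>2..1}"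
  proof (rule fundamental_theorem_of_calculus[OF h2(2)])
    fix u assume "u \<in> {h\<^sup>2..1}"
    then have "h\<^sup>2 \<le> u" by simp
    with h2(1) have u: "0 < u" by linarith
    have "(G has_real_derivative u powr (- real d / 2)) (at u)"
    proof (cases "d = 2")
      case True
      then have "G = ln" by (auto simp: G_def)
      then show ?thesis using u True by (auto intro!: derivative_eq_intros simp: powr_minus_divide)
    next
      case False
      then have "G = (\<lambda>u. u powr (1 - real d / 2) / (1 - real d / 2))" by (auto simp: G_def)
      moreover have "((\<lambda>u. u powr (1 - real d / 2) / (1 - real d / 2)) has_real_derivative
          (1 - real d / 2) * u powr (1 - real d / 2 - 1) / (1 - real d / 2)) (at u)"
        by (rule DERIV_cdivide[OF has_real_derivative_powr[OF u]])
      ultimately show ?thesis using False by simp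
    qed
    then show "(G has_vector_derivative u powr (- real d / 2)) (at u within {h\<^sup>2..1})"
      by (simp add: has_real_derivative_iff_has_vector_derivative has_vector_derivative_at_within)
  qed
  then have "(\<integral>\<^sup>+u. ennreal (indicator {h\<^sup>2..1} u * u powr (- real d / 2)) \<partial>lborel) = ennreal (G 1 - G (h\<^sup>2))"
    by (rule nn_integral_has_integral_lebesgue[rotated]) simp
  also have "(\<lambda>u. ennreal (indicator {h\<^sup>2..1} u * u powr (- real d / 2)))
      = (\<lambda>u. ennreal (u powr (- real d / 2)) * indicator {h\<^sup>2..1} u)"
    by (auto simp: indicator_def)
  also have "G 1 - G (h\<^sup>2) \<le> 2 * variance_factor d h"
  proof (cases "d = 2")
    case True
    then show ?thesis using h by (simp add: G_def variance_factor_def ln_div ln_realpow)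
  next
    case False
    define a where "a = real d / 2 - 1"
    have a: "1 / 2 \<le> a" using d False by (simp add: a_def)
    have "h\<^sup>2 powr (1 - real d / 2) = h powr (2 - real d)"
    proof -
      have "h\<^sup>2 powr (1 - real d / 2) = (h powr 2) powr (1 - real d / 2)"
        using h by simp
      also have "\<dots> = h powr (2 - real d)"
        by (simp only: powr_powr) (simp add: right_diff_distrib)
      finally show ?thesis .
    qed
    moreover have "1 - real d / 2 = - a" by (simp add: a_def)
    ultimately have "G 1 - G (h\<^sup>2) = (variance_factor d h - 1) / a"
      using d False by (simp add: G_def variance_factor_def diff_divide_distrib)
    also have "\<dots> \<le> (variance_factor d h - 1) / (1 / 2)"
      using variance_factor_ge_1[OF h, of d] d a by (intro divide_left_mono) auto
    finally show ?thesis by simp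
  qed
  finally show ?thesis by (simp add: ennreal_leI)
qed

locale transition_density_process = stationary_right_process M F X P "density_measure \<rho>"
  for M :: "'w measure" and F :: "ennreal \<Rightarrow> 'w measure"
    and X :: "real \<Rightarrow> 'w \<Rightarrow> 's::euclidean_space" and P :: "'s \<Rightarrow> 'w measure"
    and \<rho> :: "'s \<Rightarrow> real" +
  fixes p :: "real \<Rightarrow> 's \<Rightarrow> 's \<Rightarrow> real"
  assumes basic: "basic_assumption X P p \<rho>"
begin

lemma measurable_rho[measurable]: "\<rho> \<in> borel_measurable borel" and rho_nonneg: "0 \<le> \<rho> y"
  using basic by (auto simp: basic_assumption_def)

lemma p_nonneg: "0 < t \<Longrightarrow> 0 \<le> p t y z"
  and Q_density: "0 < t \<Longrightarrow> Q t y = density lborel (\<lambda>z. ennreal (p t y z))"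
  using basic by (auto simp: basic_assumption_def)

lemma measurable_p: "0 < t \<Longrightarrow> p t y \<in> borel_measurable borel"
proof -
  assume "0 < t"
  then have "(\<lambda>(x, y). p t x y) \<in> borel_measurable (borel \<Otimes>\<^sub>M borel)"
    using basic by (auto simp: basic_assumption_def)
  from measurable_compose[OF measurable_Pair1' this, of y] show ?thesis by simp
qed

abbreviation \<mu> :: "'s measure" where "\<mu> \<equiv> density_measure \<rho>"

lemma Q_le_of_density_le:
  assumes t: "0 < t" and bound: "\<And>z. p t y z \<le> A" and B: "B \<in> sets borel"
  shows "emeasure (Q t y) B \<le> ennreal A * emeasure lborel B"
proof -
  note [measurable] = measurable_p[OF t] B
  have "emeasure (Q t y) B = (\<integral>\<^sup>+z. ennreal (p t y z) * indicator B z \<partial>lborel)"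
    unfolding Q_density[OF t] by (rule emeasure_density) measurable
  also have "\<dots> \<le> (\<integral>\<^sup>+z. ennreal A * indicator B z \<partial>lborel)"
    by (intro nn_integral_mono mult_right_mono ennreal_leI bound) simp
  also have "\<dots> = ennreal A * emeasure lborel B" by (simp add: nn_integral_cmult)
  finally show ?thesis .
qed

context
  fixes f :: "'s \<Rightarrow> real" and S :: "'s set" and b k1 L :: real
  assumes f[measurable]: "f \<in> borel_measurable borel" and bounded: "\<And>y. \<bar>f y\<bar> \<le> b"
    and support: "\<And>y. f y \<noteq> 0 \<Longrightarrow> y \<in> S"
    and L1: "(\<integral>\<^sup>+y. ennreal \<bar>f y\<bar> \<partial>lborel) \<le> ennreal k1" and k1: "0 \<le> k1"
    and rho_le: "\<And>y. y \<in> S \<Longrightarrow> \<rho> y \<le> L" and L: "0 \<le> L"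
begin

lemma nn_integral_mu_le: "(\<integral>\<^sup>+y. ennreal \<bar>f y\<bar> \<partial>\<mu>) \<le> ennreal (L * k1)"
proof -
  have "(\<integral>\<^sup>+y. ennreal \<bar>f y\<bar> \<partial>\<mu>) = (\<integral>\<^sup>+y. ennreal (\<rho> y) * ennreal \<bar>f y\<bar> \<partial>lborel)"
    by (rule nn_integral_density) auto
  also have "\<dots> \<le> (\<integral>\<^sup>+y. ennreal L * ennreal \<bar>f y\<bar> \<partial>lborel)"
  proof (rule nn_integral_mono)
    fix y
    show "ennreal (\<rho> y) * ennreal \<bar>f y\<bar> \<le> ennreal L * ennreal \<bar>f y\<bar>"
      using rho_le[OF support, of y] by (cases "f y = 0") (auto intro!: mult_right_mono ennreal_leI)
  qed
  also have "\<dots> = ennreal L * (\<integral>\<^sup>+y. ennreal \<bar>f y\<bar> \<partial>lborel)" by (rule nn_integral_cmult) simp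
  also have "\<dots> \<le> ennreal L * ennreal k1" by (intro mult_left_mono L1) simp
  finally show ?thesis using L k1 by (simp add: ennreal_mult)
qed

lemma abs_mean_le: "\<bar>\<integral>y. f y \<partial>\<mu>\<bar> \<le> L * k1"
  using order_trans[OF norm_integral_le_nn_integral[of \<mu> f, simplified] nn_integral_mu_le] L k1 by simp

lemma autocov_le_sup: "0 \<le> u \<Longrightarrow> \<bar>autocov P X \<mu> f u\<bar> \<le> 2 * b * (L * k1)"
proof (rule autocov_le[OF f bounded _ _ _ nn_integral_mu_le])
  assume u: "0 \<le> u"
  have "\<bar>(\<integral>z. f z \<partial>Q u y) - (\<integral>z. f z \<partial>\<mu>)\<bar> \<le> 2 * b" for y
  proof -
    have "\<bar>\<integral>z. f z \<partial>Q u y\<bar> \<le> b"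
      by (rule prob_space.abs_integral_le_const[OF prob_space_Q[OF u] bounded])
    moreover have "\<bar>\<integral>z. f z \<partial>\<mu>\<bar> \<le> b" by (rule mu.abs_integral_le_const[OF bounded])
    ultimately show ?thesis by linarith
  qed
  then show "AE y in \<mu>. f y \<noteq> 0 \<longrightarrow> \<bar>(\<integral>z. f z \<partial>Q u y) - (\<integral>z. f z \<partial>\<mu>)\<bar> \<le> 2 * b" by simp
qed (use bounded[of undefined] L k1 in auto)

text \<open>
  A transition kernel dominated by \<open>A\<close> times Lebesgue measure turns the \<open>L\<^sup>1\<close> norm of \<open>f\<close>, which does not
  grow with the concentration of \<open>f\<close>, into a bound for \<open>Q\<^sub>u f\<close>.  The hypothesis is on measures of sets, not
  on densities, because Chapman-Kolmogorov yields it in this form.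
\<close>

lemma autocov_le_kernel_density:
  assumes u: "0 \<le> u" and A: "0 \<le> A"
    and bound: "\<And>y B. B \<in> sets borel \<Longrightarrow> emeasure (Q u y) B \<le> ennreal A * emeasure lborel B"
  shows "\<bar>autocov P X \<mu> f u\<bar> \<le> (A + L) * k1 * (L * k1)"
proof (rule autocov_le[OF f bounded u _ _ nn_integral_mu_le])
  have "\<bar>\<integral>z. f z \<partial>Q u y\<bar> \<le> A * k1" for y
  proof -
    have le: "Q u y \<le> density lborel (\<lambda>_. ennreal A)"
    proof -
      have "emeasure (Q u y) B \<le> emeasure (density lborel (\<lambda>_. ennreal A)) B" for B
        using bound[of B y] by (cases "B \<in> sets borel") (auto simp: emeasure_density_const emeasure_notin_sets)
      then show ?thesis by (auto simp: le_measure_iff le_fun_def)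
    qed
    have "ennreal \<bar>\<integral>z. f z \<partial>Q u y\<bar> \<le> (\<integral>\<^sup>+z. ennreal \<bar>f z\<bar> \<partial>Q u y)"
      using norm_integral_le_nn_integral[of "Q u y" f] by simp
    also have "\<dots> \<le> (\<integral>\<^sup>+z. ennreal \<bar>f z\<bar> \<partial>density lborel (\<lambda>_. ennreal A))"
      by (rule nn_integral_mono_measure[OF _ le]) simp
    also have "\<dots> = ennreal A * (\<integral>\<^sup>+z. ennreal \<bar>f z\<bar> \<partial>lborel)"
      by (subst nn_integral_density) (auto simp: nn_integral_cmult)
    also have "\<dots> \<le> ennreal A * ennreal k1" by (intro mult_left_mono L1) simp
    finally show ?thesis using A k1 by (simp add: ennreal_mult[symmetric])
  qed
  then have "\<bar>(\<integral>z. f z \<partial>Q u y) - (\<integral>z. f z \<partial>\<mu>)\<bar> \<le> (A + L) * k1" for y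
    unfolding distrib_right
    by (rule order_trans[OF abs_triangle_ineq4 add_mono[OF _ abs_mean_le]])
  then show "AE y in \<mu>. f y \<noteq> 0 \<longrightarrow> \<bar>(\<integral>z. f z \<partial>Q u y) - (\<integral>z. f z \<partial>\<mu>)\<bar> \<le> (A + L) * k1" by simp
qed (use A L k1 in auto)

text \<open>
  Both \<open>Q\<^sub>u f\<close> and \<open>\<mu>(f)\<close> are Lebesgue integrals of \<open>f\<close> against densities, whose difference is at most
  \<open>r\<close> on the support of \<open>f\<close>.
\<close>

lemma autocov_le_uniform:
  assumes u: "0 < u" and r: "0 \<le> r"
    and close: "AE y in \<mu>. y \<in> S \<longrightarrow> (\<forall>z\<in>S. \<bar>p u y z - \<rho> z\<bar> \<le> r)"
  shows "\<bar>autocov P X \<mu> f u\<bar> \<le> r * k1 * (L * k1)"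
proof (rule autocov_le[OF f bounded _ _ _ nn_integral_mu_le])
  note [measurable] = measurable_p[OF u]
  show "AE y in \<mu>. f y \<noteq> 0 \<longrightarrow> \<bar>(\<integral>z. f z \<partial>Q u y) - (\<integral>z. f z \<partial>\<mu>)\<bar> \<le> r * k1"
    using close
  proof eventually_elim
    case (elim y)
    show ?case
    proof
      assume "f y \<noteq> 0"
      then have close': "\<bar>p u y z - \<rho> z\<bar> \<le> r" if "z \<in> S" for z
        using elim support that by blast
      interpret Qy: prob_space "Q u y" using prob_space_Q[of u y] u by simp
      have "integrable (Q u y) f"
        by (rule Qy.integrable_const_bound[where B=b]) (auto simp: bounded)
      then have int1: "integrable lborel (\<lambda>z. p u y z * f z)"
        unfolding Q_density[OF u] by (subst (asm) integrable_density) (auto simp: p_nonneg[OF u])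
      have "integrable \<mu> f"
        by (rule mu.integrable_const_bound[where B=b]) (auto simp: bounded)
      then have int2: "integrable lborel (\<lambda>z. \<rho> z * f z)"
        by (subst (asm) integrable_density) (auto simp: rho_nonneg)
      have "(\<integral>z. f z \<partial>Q u y) - (\<integral>z. f z \<partial>\<mu>) = (\<integral>z. p u y z * f z \<partial>lborel) - (\<integral>z. \<rho> z * f z \<partial>lborel)"
        unfolding Q_density[OF u] by (simp add: integral_density p_nonneg[OF u] rho_nonneg)
      also have "\<dots> = (\<integral>z. p u y z * f z - \<rho> z * f z \<partial>lborel)"
        using int1 int2 by simp
      finally have "ennreal \<bar>(\<integral>z. f z \<partial>Q u y) - (\<integral>z. f z \<partial>\<mu>)\<bar>
          \<le> (\<integral>\<^sup>+z. ennreal \<bar>p u y z * f z - \<rho> z * f z\<bar> \<partial>lborel)"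
        using norm_integral_le_nn_integral[of lborel "\<lambda>z. p u y z * f z - \<rho> z * f z"] by simp
      also have "\<dots> \<le> (\<integral>\<^sup>+z. ennreal r * ennreal \<bar>f z\<bar> \<partial>lborel)"
      proof (rule nn_integral_mono)
        fix z
        have "\<bar>p u y z * f z - \<rho> z * f z\<bar> \<le> r * \<bar>f z\<bar>"
          using close'[OF support, of z]
          by (cases "f z = 0") (auto simp: left_diff_distrib[symmetric] abs_mult intro!: mult_right_mono)
        then show "ennreal \<bar>p u y z * f z - \<rho> z * f z\<bar> \<le> ennreal r * ennreal \<bar>f z\<bar>"
          using r by (simp add: ennreal_mult[symmetric])
      qed
      also have "\<dots> = ennreal r * (\<integral>\<^sup>+z. ennreal \<bar>f z\<bar> \<partial>lborel)" by (rule nn_integral_cmult) simp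
      also have "\<dots> \<le> ennreal r * ennreal k1" by (intro mult_left_mono L1) simp
      finally show "\<bar>(\<integral>z. f z \<partial>Q u y) - (\<integral>z. f z \<partial>\<mu>)\<bar> \<le> r * k1"
        using r k1 by (simp add: ennreal_mult[symmetric])
    qed
  qed
qed (use u r L k1 in auto)


end

lemma short_time_integrable_dominated:
  assumes \<alpha>: "\<And>t y z. t \<in> {0<..1} \<Longrightarrow> p t y z \<le> \<alpha> t" "\<And>t. t \<in> {0<..1} \<Longrightarrow> 0 \<le> \<alpha> t"
    and int: "set_integrable lborel {0<..1} \<alpha>"
    and f: "f \<in> borel_measurable borel" "\<And>y. \<bar>f y\<bar> \<le> b" "\<And>y. f y \<noteq> 0 \<Longrightarrow> y \<in> S"
      "(\<integral>\<^sup>+y. ennreal \<bar>f y\<bar> \<partial>lborel) \<le> ennreal k1" "0 \<le> k1"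
    and L: "\<And>y. y \<in> S \<Longrightarrow> \<rho> y \<le> L" "0 \<le> L"
  shows "dominated_on (autocov P X \<mu> f) {0<..1} (((LBINT t:{0<..1}. \<alpha> t) + L) * k1 * (L * k1))"
proof (rule dominated_onI)
  define a where "a t = indicator {0<..1} t * \<alpha> t" for t :: real
  have inta: "integrable lborel a" using int by (simp add: a_def[abs_def] set_integrable_def)
  then have [measurable]: "a \<in> borel_measurable borel" by auto
  have a0: "0 \<le> a t" for t using \<alpha>(2)[of t] by (simp add: a_def indicator_def)
  have k: "0 \<le> k1 * (L * k1)" using f(5) L(2) by simp
  let ?\<phi> = "\<lambda>t. (ennreal (a t) + ennreal L * indicator {0<..1} t) * ennreal (k1 * (L * k1))"
  show "?\<phi> \<in> borel_measurable borel" by measurable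
  show "ennreal \<bar>autocov P X \<mu> f u\<bar> \<le> ?\<phi> u" if u: "u \<in> {0<..1}" for u
  proof -
    have "\<bar>autocov P X \<mu> f u\<bar> \<le> (\<alpha> u + L) * k1 * (L * k1)"
      by (rule autocov_le_kernel_density[OF f L])
         (use u \<alpha> Q_le_of_density_le[of u _ "\<alpha> u"] in auto)
    then have "ennreal \<bar>autocov P X \<mu> f u\<bar> \<le> ennreal ((a u + L) * (k1 * (L * k1)))"
      using u by (intro ennreal_leI) (simp add: a_def mult_ac)
    also have "\<dots> = ?\<phi> u"
      using u a0 L(2) k by (simp add: ennreal_mult)
    finally show ?thesis .
  qed
  have "(\<integral>\<^sup>+t. ?\<phi> t * indicator {0<..1} t \<partial>lborel) \<le> (\<integral>\<^sup>+t. ?\<phi> t \<partial>lborel)"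
    by (intro nn_integral_mono) (auto simp: indicator_def)
  also have "\<dots> = ((\<integral>\<^sup>+t. ennreal (a t) \<partial>lborel) + ennreal L) * ennreal (k1 * (L * k1))"
    by (simp add: nn_integral_multc nn_integral_add nn_integral_cmult)
  also have "(\<integral>\<^sup>+t. ennreal (a t) \<partial>lborel) = ennreal (LBINT t:{0<..1}. \<alpha> t)"
    using nn_integral_eq_integral[OF inta] a0 by (simp add: a_def[abs_def] set_lebesgue_integral_def)
  also have "(ennreal (LBINT t:{0<..1}. \<alpha> t) + ennreal L) * ennreal (k1 * (L * k1))
      = ennreal (((LBINT t:{0<..1}. \<alpha> t) + L) * k1 * (L * k1))"
  proof -
    have "0 \<le> (LBINT t:{0<..1}. \<alpha> t)"
      using Bochner_Integration.integral_nonneg[of lborel a] a0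
      by (simp add: a_def[abs_def] set_lebesgue_integral_def)
    then show ?thesis using L(2) k by (simp add: ennreal_mult mult.assoc)
  qed
  finally show "(\<integral>\<^sup>+t. ?\<phi> t * indicator {0<..1} t \<partial>lborel)
      \<le> ennreal (((LBINT t:{0<..1}. \<alpha> t) + L) * k1 * (L * k1))" .
qed

text \<open>
  The two bounds \<open>O(h\<^sup>-\<^sup>d)\<close> and \<open>O(u\<^bsup>-d/2\<^esup>)\<close> cross at \<open>u = h\<^sup>2\<close>.  Below it the first contributes
  \<open>h\<^bsup>2-d\<^esup>\<close>; above it the second contributes the integral of \<open>u\<^bsup>-d/2\<^esup>\<close>.
\<close>

lemma short_time_powr_dominated:
  assumes dim: "2 \<le> DIM('s)" and c: "0 < c"
    and pc: "\<And>t y z. t \<in> {0<..1} \<Longrightarrow> p t y z \<le> c * t powr (- real DIM('s) / 2)"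
    and h: "0 < h" "h \<le> 1" and \<kappa>: "0 \<le> \<kappa>"
    and f: "f \<in> borel_measurable borel" "\<And>y. \<bar>f y\<bar> \<le> \<kappa> / h ^ DIM('s)" "\<And>y. f y \<noteq> 0 \<Longrightarrow> y \<in> S"
      "(\<integral>\<^sup>+y. ennreal \<bar>f y\<bar> \<partial>lborel) \<le> ennreal k1" "0 \<le> k1"
    and L: "\<And>y. y \<in> S \<Longrightarrow> \<rho> y \<le> L" "0 \<le> L"
  shows "dominated_on (autocov P X \<mu> f) {0<..1}
    ((2 * \<kappa> + 2 * (c + L) * k1) * (L * k1) * variance_factor DIM('s) h)"
proof (rule dominated_onI)
  let ?d = "DIM('s)"
  define C1 where "C1 = 2 * (\<kappa> / h ^ ?d) * (L * k1)"
  define C2 where "C2 = (c + L) * k1 * (L * k1)"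
  have C1: "0 \<le> C1" and C2: "0 \<le> C2" using c h \<kappa> f(5) L(2) by (auto simp: C1_def C2_def)
  have h2: "0 < h\<^sup>2" "h\<^sup>2 \<le> 1" using h by (auto simp: power_le_one)
  \<comment> \<open>the sum of the two pieces, rather than a case distinction, keeps the integral computation linear\<close>
  let ?\<phi> = "\<lambda>u. ennreal C1 * indicator {0..h\<^sup>2} u
      + ennreal C2 * (ennreal (u powr (- real ?d / 2)) * indicator {h\<^sup>2..1} u)"
  show "?\<phi> \<in> borel_measurable borel" by measurable
  show "ennreal \<bar>autocov P X \<mu> f u\<bar> \<le> ?\<phi> u" if u: "u \<in> {0<..1}" for u
  proof (cases "u \<le> h\<^sup>2")
    case True
    have "\<bar>autocov P X \<mu> f u\<bar> \<le> C1"
      unfolding C1_def by (rule autocov_le_sup[OF f L]) (use u in auto)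
    then show ?thesis using True u by (auto intro!: add_increasing2 ennreal_leI)
  next
    case False
    have pow: "1 \<le> u powr (- real ?d / 2)"
    proof -
      have "u powr 0 \<le> u powr (- real ?d / 2)" by (rule powr_mono') (use u in auto)
      then show ?thesis using u by simp
    qed
    have "\<bar>autocov P X \<mu> f u\<bar> \<le> (c * u powr (- real ?d / 2) + L) * k1 * (L * k1)"
      by (rule autocov_le_kernel_density[OF f L])
         (use u c pc Q_le_of_density_le[of u _ "c * u powr (- real ?d / 2)"] in auto)
    also have "\<dots> \<le> (c * u powr (- real ?d / 2) + L * u powr (- real ?d / 2)) * k1 * (L * k1)"
      using pow L(2) f(5) by (intro mult_right_mono add_left_mono) (auto simp: mult_le_cancel_left1)
    also have "\<dots> = C2 * u powr (- real ?d / 2)" by (simp add: C2_def algebra_simps)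
    finally have "ennreal \<bar>autocov P X \<mu> f u\<bar> \<le> ennreal (C2 * u powr (- real ?d / 2))" by (rule ennreal_leI)
    then show ?thesis using False u C2 by (simp add: ennreal_mult)
  qed
  have "(\<integral>\<^sup>+u. ?\<phi> u * indicator {0<..1} u \<partial>lborel) \<le> (\<integral>\<^sup>+u. ?\<phi> u \<partial>lborel)"
    by (intro nn_integral_mono) (auto simp: indicator_def)
  also have "\<dots> = ennreal C1 * ennreal (h\<^sup>2)
      + ennreal C2 * (\<integral>\<^sup>+u. ennreal (u powr (- real ?d / 2)) * indicator {h\<^sup>2..1} u \<partial>lborel)"
    by (simp add: nn_integral_add nn_integral_cmult)
  also have "\<dots> \<le> ennreal C1 * ennreal (h\<^sup>2) + ennreal C2 * ennreal (2 * variance_factor ?d h)"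
    by (intro add_left_mono mult_left_mono nn_integral_powr_le_variance_factor h dim) simp
  also have "\<dots> = ennreal (C1 * h\<^sup>2 + C2 * (2 * variance_factor ?d h))"
    using C1 C2 variance_factor_ge_1[OF h, of ?d] by (simp add: ennreal_mult)
  also have "\<dots> \<le> ennreal ((2 * \<kappa> + 2 * (c + L) * k1) * (L * k1) * variance_factor ?d h)"
  proof (rule ennreal_leI)
    have "h\<^sup>2 / h ^ ?d \<le> variance_factor ?d h"
    proof (cases "?d = 2")
      case True
      then show ?thesis using variance_factor_ge_1[OF h, of ?d] h by simp
    next
      case False
      then show ?thesis using dim h
        by (simp add: variance_factor_def powr_diff powr_realpow)
    qed
    then have "2 * \<kappa> * (L * k1) * (h\<^sup>2 / h ^ ?d) \<le> 2 * \<kappa> * (L * k1) * variance_factor ?d h"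
      using \<kappa> L(2) f(5) by (intro mult_left_mono) auto
    then show "C1 * h\<^sup>2 + C2 * (2 * variance_factor ?d h)
        \<le> (2 * \<kappa> + 2 * (c + L) * k1) * (L * k1) * variance_factor ?d h"
      by (simp add: C1_def C2_def algebra_simps)
  qed
  finally show "(\<integral>\<^sup>+u. ?\<phi> u * indicator {0<..1} u \<partial>lborel)
      \<le> ennreal ((2 * \<kappa> + 2 * (c + L) * k1) * (L * k1) * variance_factor ?d h)" .
qed

lemma long_time_uniform_dominated:
  assumes conv: "local_uniform_convergence p \<rho> \<Lambda> r" and S: "compact S"
    and f: "f \<in> borel_measurable borel" "\<And>y. \<bar>f y\<bar> \<le> b" "\<And>y. f y \<noteq> 0 \<Longrightarrow> y \<in> S"
      "(\<integral>\<^sup>+y. ennreal \<bar>f y\<bar> \<partial>lborel) \<le> ennreal k1" "0 \<le> k1"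
    and L: "\<And>y. y \<in> S \<Longrightarrow> \<rho> y \<le> L" "0 \<le> L"
  shows "dominated_on (autocov P X \<mu> f) {1<..} ((LBINT t:{1<..}. r S t) * k1 * (L * k1))"
proof (rule dominated_onI)
  define a where "a t = indicator {1<..} t * r S t" for t
  have \<Lambda>: "\<Lambda> \<in> sets borel" "emeasure \<mu> \<Lambda> = 1"
    and r: "\<And>t. 0 < t \<Longrightarrow> 0 \<le> r S t" "set_integrable lborel {1<..} (r S)"
      "\<And>t y z. 1 < t \<Longrightarrow> y \<in> S \<inter> \<Lambda> \<Longrightarrow> z \<in> S \<Longrightarrow> \<bar>p t y z - \<rho> z\<bar> \<le> r S t"
    using conv S unfolding local_uniform_convergence_def by blast+
  have inta: "integrable lborel a" using r(2) by (simp add: a_def[abs_def] set_integrable_def)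
  then have [measurable]: "a \<in> borel_measurable borel" by auto
  have a0: "0 \<le> a t" for t using r(1)[of t] by (simp add: a_def indicator_def)
  have k: "0 \<le> k1 * (L * k1)" using f(5) L(2) by simp
  have AE: "AE y in \<mu>. y \<in> \<Lambda>"
    using \<Lambda> by (intro mu.AE_in_set_eq_1[THEN iffD2]) (auto simp: measure_def)
  show "(\<lambda>t. ennreal (a t) * ennreal (k1 * (L * k1))) \<in> borel_measurable borel" by measurable
  show "ennreal \<bar>autocov P X \<mu> f u\<bar> \<le> ennreal (a u) * ennreal (k1 * (L * k1))" if u: "u \<in> {1<..}" for u
  proof -
    have "\<bar>autocov P X \<mu> f u\<bar> \<le> r S u * k1 * (L * k1)"
    proof (rule autocov_le_uniform[OF f L])
      show "AE y in \<mu>. y \<in> S \<longrightarrow> (\<forall>z\<in>S. \<bar>p u y z - \<rho> z\<bar> \<le> r S u)"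
        using AE by eventually_elim (use r(3) u in auto)
    qed (use u r(1) in auto)
    then show ?thesis
      using u a0[of u] k by (simp add: ennreal_mult[symmetric] a_def mult.assoc ennreal_leI)
  qed
  have "(\<integral>\<^sup>+t. ennreal (a t) * ennreal (k1 * (L * k1)) * indicator {1<..} t \<partial>lborel)
      \<le> (\<integral>\<^sup>+t. ennreal (a t) * ennreal (k1 * (L * k1)) \<partial>lborel)"
    by (intro nn_integral_mono) (auto simp: indicator_def)
  also have "\<dots> = (\<integral>\<^sup>+t. ennreal (a t) \<partial>lborel) * ennreal (k1 * (L * k1))"
    by (simp add: nn_integral_multc)
  also have "(\<integral>\<^sup>+t. ennreal (a t) \<partial>lborel) = ennreal (LBINT t:{1<..}. r S t)"
    using nn_integral_eq_integral[OF inta] a0 by (simp add: a_def[abs_def] set_lebesgue_integral_def)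
  finally show "(\<integral>\<^sup>+t. ennreal (a t) * ennreal (k1 * (L * k1)) * indicator {1<..} t \<partial>lborel)
      \<le> ennreal ((LBINT t:{1<..}. r S t) * k1 * (L * k1))"
    using k by (simp add: ennreal_mult''[symmetric] mult.assoc)
qed

text \<open>
  Up to the lag \<open>A\<close> the autocovariance is bounded independently of \<open>h\<close>.  The choice of \<open>A\<close> makes
  \<open>e\<^bsup>-\<theta>A\<^esup> = h\<^bsup>2d\<^esup>\<close>, which cancels the factor \<open>h\<^bsup>-2d\<^esup>\<close> in the mixing bound.
\<close>

lemma long_time_mixing_dominated:
  assumes dim: "2 \<le> DIM('s)" and c: "0 < c" and p1: "\<And>y z. p 1 y z \<le> c"
    and mix: "0 < cm" "0 < \<theta>"
      "\<And>t. 0 \<le> t \<Longrightarrow> (\<integral>\<^sup>+y. ennreal (tv_dist (Q t y) \<mu>) \<partial>\<mu>) \<le> ennreal (cm * exp (- \<theta> * t))"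
    and h: "0 < h" "h \<le> 1" and \<kappa>: "0 < \<kappa>"
    and f: "f \<in> borel_measurable borel" "\<And>y. \<bar>f y\<bar> \<le> \<kappa> / h ^ DIM('s)" "\<And>y. f y \<noteq> 0 \<Longrightarrow> y \<in> S"
      "(\<integral>\<^sup>+y. ennreal \<bar>f y\<bar> \<partial>lborel) \<le> ennreal k1" "0 \<le> k1"
    and L: "\<And>y. y \<in> S \<Longrightarrow> \<rho> y \<le> L" "0 \<le> L"
  shows "dominated_on (autocov P X \<mu> f) {1<..}
    (((c + L) * k1 * (L * k1) * (2 * real DIM('s) / \<theta>) + \<kappa>\<^sup>2 * cm / \<theta>) * variance_factor DIM('s) h)"
proof (rule dominated_onI)
  let ?d = "DIM('s)"
  define C1 where "C1 = (c + L) * k1 * (L * k1)"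
  define C2 where "C2 = (\<kappa> / h ^ ?d)\<^sup>2 * cm"
  define A where "A = 2 * real ?d / \<theta> * ln (1 / h)"
  have C1: "0 \<le> C1" and C2: "0 \<le> C2" using c mix(1) f(5) L(2) by (auto simp: C1_def C2_def)
  have "0 \<le> ln (1 / h)" using h by (simp add: ln_div)
  then have A: "0 \<le> A" unfolding A_def using mix(2) by (intro mult_nonneg_nonneg) auto
  let ?\<phi> = "\<lambda>u. ennreal C1 * indicator {0..A} u + ennreal C2 * (ennreal (exp (- \<theta> * u)) * indicator {A..} u)"
  show "?\<phi> \<in> borel_measurable borel" by measurable
  show "ennreal \<bar>autocov P X \<mu> f u\<bar> \<le> ?\<phi> u" if u: "u \<in> {1<..}" for u
  proof (cases "u \<le> A")
    case True
    have "\<bar>autocov P X \<mu> f u\<bar> \<le> C1"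
      unfolding C1_def
    proof (rule autocov_le_kernel_density[OF f L])
      fix y :: 's and B :: "'s set" assume "B \<in> sets borel"
      then show "emeasure (Q u y) B \<le> ennreal c * emeasure lborel B"
        using Q_bound_extend[of "u - 1" 1 B] Q_le_of_density_le[of 1 _ c B] u p1 by auto
    qed (use u c in auto)
    then show ?thesis using True u by (auto intro!: add_increasing2 ennreal_leI)
  next
    case False
    have "\<bar>autocov P X \<mu> f u\<bar> \<le> (\<kappa> / h ^ ?d)\<^sup>2 * (cm * exp (- \<theta> * u))"
      by (rule autocov_le_tv_dist[OF f(1,2)]) (use u mix h \<kappa> in auto)
    also have "\<dots> = C2 * exp (- \<theta> * u)" by (simp add: C2_def)
    finally have "ennreal \<bar>autocov P X \<mu> f u\<bar> \<le> ennreal (C2 * exp (- \<theta> * u))" by (rule ennreal_leI)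
    then show ?thesis using False C2 by (simp add: ennreal_mult)
  qed
  have exp: "(\<integral>\<^sup>+u. ennreal (exp (- \<theta> * u)) * indicator {A..} u \<partial>lborel) = ennreal (0 - (- exp (- \<theta> * A) / \<theta>))"
  proof (rule nn_integral_FTC_atLeast)
    show "((\<lambda>u. - exp (- \<theta> * u) / \<theta>) has_real_derivative exp (- \<theta> * u)) (at u)" for u
      using mix(2) by (auto intro!: derivative_eq_intros)
    have "filterlim (\<lambda>u. - \<theta> * u) at_bot at_top"
      by (rule filterlim_tendsto_neg_mult_at_bot[OF tendsto_const _ filterlim_ident]) (use mix(2) in simp)
    from tendsto_divide[OF tendsto_minus[OF filterlim_compose[OF exp_at_bot this]] tendsto_const[of \<theta>]]
    show "((\<lambda>u. - exp (- \<theta> * u) / \<theta>) \<longlongrightarrow> 0) at_top"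
      using mix(2) by simp
  qed auto
  have "(\<integral>\<^sup>+u. ?\<phi> u * indicator {1<..} u \<partial>lborel) \<le> (\<integral>\<^sup>+u. ?\<phi> u \<partial>lborel)"
    by (intro nn_integral_mono) (auto simp: indicator_def)
  also have "\<dots> = ennreal C1 * ennreal A
      + ennreal C2 * (\<integral>\<^sup>+u. ennreal (exp (- \<theta> * u)) * indicator {A..} u \<partial>lborel)"
    using A by (simp add: nn_integral_add nn_integral_cmult)
  also have "\<dots> = ennreal (C1 * A + C2 * (exp (- \<theta> * A) / \<theta>))"
    unfolding exp using A C1 C2 mix(2) by (simp add: ennreal_mult del: times_divide_eq_right)
  also have "\<dots> \<le> ennreal ((C1 * (2 * real ?d / \<theta>) + \<kappa>\<^sup>2 * cm / \<theta>) * variance_factor ?d h)"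
  proof (rule ennreal_leI)
    have "exp (- \<theta> * A) = exp (real (2 * ?d) * ln h)"
      using h mix(2) by (simp add: A_def ln_div)
    also have "\<dots> = h ^ (2 * ?d)"
      using h by (simp only: exp_of_nat_mult exp_ln)
    finally have "C2 * (exp (- \<theta> * A) / \<theta>) = \<kappa>\<^sup>2 * cm / \<theta> * 1"
      using h by (simp add: C2_def power_divide power_mult[symmetric] mult.commute)
    also have "\<dots> \<le> \<kappa>\<^sup>2 * cm / \<theta> * variance_factor ?d h"
      using variance_factor_ge_1[OF h, of ?d] mix by (intro mult_left_mono) auto
    finally have 1: "C2 * (exp (- \<theta> * A) / \<theta>) \<le> \<kappa>\<^sup>2 * cm / \<theta> * variance_factor ?d h" .
    have "A \<le> 2 * real ?d / \<theta> * variance_factor ?d h"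
      unfolding A_def using ln_le_variance_factor[OF h dim] mix(2) by (intro mult_left_mono) auto
    then have "C1 * A \<le> C1 * (2 * real ?d / \<theta> * variance_factor ?d h)"
      using C1 by (rule mult_left_mono)
    with 1 show "C1 * A + C2 * (exp (- \<theta> * A) / \<theta>) \<le> (C1 * (2 * real ?d / \<theta>) + \<kappa>\<^sup>2 * cm / \<theta>) * variance_factor ?d h"
      by (simp add: distrib_right mult.assoc)
  qed
  finally show "(\<integral>\<^sup>+u. ?\<phi> u * indicator {1<..} u \<partial>lborel)
      \<le> ennreal (((c + L) * k1 * (L * k1) * (2 * real ?d / \<theta>) + \<kappa>\<^sup>2 * cm / \<theta>) * variance_factor ?d h)"
    by (simp add: C1_def)
qed

end

text \<open>
  The properties shared by all kernels \<open>K\<^sub>h(x - \<cdot>)\<close> with bandwidth \<open>h\<close> small enough: height of order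
  \<open>h\<^sup>-\<^sup>d\<close>, support in a fixed set, bounded \<open>L\<^sup>1\<close> norm.
\<close>

definition concentrated :: "'s::euclidean_space set \<Rightarrow> real \<Rightarrow> real \<Rightarrow> real \<Rightarrow> ('s \<Rightarrow> real) \<Rightarrow> bool" where
  "concentrated S \<kappa> k1 h f \<longleftrightarrow> f \<in> borel_measurable borel \<and> (\<forall>y. \<bar>f y\<bar> \<le> \<kappa> / h ^ DIM('s)) \<and>
     (\<forall>y. f y \<noteq> 0 \<longrightarrow> y \<in> S) \<and> (\<integral>\<^sup>+y. ennreal \<bar>f y\<bar> \<partial>lborel) \<le> ennreal k1"

text \<open>
  The constant is fixed before the bandwidth and the function, so that the bound holds along a bandwidth
  that shrinks with the time horizon.  Lags up to 1 and lags beyond 1 are treated separately; their bounds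
  add up because each is at most a multiple of the variance factor, which is at least 1.
\<close>

lemma (in transition_density_process) autocov_dominated:
  assumes short: "short_time_bound p"
    and long: "(\<exists>\<Lambda> r. local_uniform_convergence p \<rho> \<Lambda> r) \<or> (2 \<le> DIM('s) \<and> exp_beta_mixing X P \<mu>)"
    and S: "compact S" and L: "\<And>y. y \<in> S \<Longrightarrow> \<rho> y \<le> L" "0 \<le> L" and \<kappa>: "0 < \<kappa>" and k1: "0 \<le> k1"
  obtains C where "0 \<le> C"
    and "\<And>h f. 0 < h \<Longrightarrow> h \<le> 1 \<Longrightarrow> concentrated S \<kappa> k1 h f \<Longrightarrow>
      dominated_on (autocov P X \<mu> f) {0<..} (C * variance_factor DIM('s) h)"
proof -
  let ?V = "variance_factor DIM('s)"
  have V1: "1 \<le> ?V h" if "0 < h" "h \<le> 1" for h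
    using variance_factor_ge_1[OF that, of "DIM('s)"] by simp
  have scale: "dominated_on c J (I * ?V h)" if "dominated_on c J I" "0 \<le> I" "0 < h" "h \<le> 1" for c J I h
    by (rule dominated_on_mono[OF that(1)]) (use V1[OF that(3,4)] that(2) in \<open>simp add: mult_le_cancel_left1\<close>)
  have conc: "f \<in> borel_measurable borel" "\<And>y. \<bar>f y\<bar> \<le> \<kappa> / h ^ DIM('s)" "\<And>y. f y \<noteq> 0 \<Longrightarrow> y \<in> S"
      "(\<integral>\<^sup>+y. ennreal \<bar>f y\<bar> \<partial>lborel) \<le> ennreal k1" if "concentrated S \<kappa> k1 h f" for h f
    using that by (auto simp: concentrated_def)
  have short_ex: "\<exists>C\<ge>0. \<forall>h f. 0 < h \<longrightarrow> h \<le> 1 \<longrightarrow> concentrated S \<kappa> k1 h f \<longrightarrow>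
      dominated_on (autocov P X \<mu> f) {0<..1} (C * ?V h)"
  proof (cases "DIM('s) = 1")
    case True
    obtain \<alpha> where \<alpha>: "\<And>t. t \<in> {0<..1} \<Longrightarrow> 0 \<le> \<alpha> t" "\<And>t y z. t \<in> {0<..1} \<Longrightarrow> p t y z \<le> \<alpha> t"
        "set_integrable lborel {0<..1} \<alpha>"
      using short[unfolded short_time_bound_def if_P[OF True]] by blast
    let ?C = "((LBINT t:{0<..1}. \<alpha> t) + L) * k1 * (L * k1)"
    have "0 \<le> (LBINT t:{0<..1}. \<alpha> t)"
      unfolding set_lebesgue_integral_def
      by (rule Bochner_Integration.integral_nonneg) (use \<alpha>(1) in \<open>simp add: indicator_def\<close>)
    then have C: "0 \<le> ?C" using L(2) k1 by simp
    show ?thesis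
    proof (intro exI[of _ ?C] conjI C allI impI)
      fix h f assume h: "0 < h" "h \<le> 1" and f: "concentrated S \<kappa> k1 h f"
      show "dominated_on (autocov P X \<mu> f) {0<..1} (?C * ?V h)"
        by (rule scale[OF short_time_integrable_dominated[OF \<alpha>(2,1,3) conc[OF f] k1 L] C h])
    qed
  next
    case False
    then have dim: "2 \<le> DIM('s)" using DIM_positive[where 'a='s] by linarith
    obtain c where c: "0 < c" "\<And>t y z. t \<in> {0<..1} \<Longrightarrow> p t y z \<le> c * t powr (- real DIM('s) / 2)"
      using short False unfolding short_time_bound_def by auto
    show ?thesis
    proof (intro exI[of _ "(2 * \<kappa> + 2 * (c + L) * k1) * (L * k1)"] conjI allI impI)
      show "0 \<le> (2 * \<kappa> + 2 * (c + L) * k1) * (L * k1)" using \<kappa> c(1) L(2) k1 by simp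
      fix h f assume h: "0 < h" "h \<le> 1" and f: "concentrated S \<kappa> k1 h f"
      show "dominated_on (autocov P X \<mu> f) {0<..1} ((2 * \<kappa> + 2 * (c + L) * k1) * (L * k1) * ?V h)"
        by (rule short_time_powr_dominated[OF dim c h less_imp_le[OF \<kappa>] conc[OF f] k1 L])
    qed
  qed
  have long_ex: "\<exists>C\<ge>0. \<forall>h f. 0 < h \<longrightarrow> h \<le> 1 \<longrightarrow> concentrated S \<kappa> k1 h f \<longrightarrow>
      dominated_on (autocov P X \<mu> f) {1<..} (C * ?V h)"
    using long
  proof (elim disjE conjE exE)
    fix \<Lambda> r assume conv: "local_uniform_convergence p \<rho> \<Lambda> r"
    let ?C = "(LBINT t:{1<..}. r S t) * k1 * (L * k1)"
    have "0 \<le> r S t" if "0 < t" for t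
      using conv S that unfolding local_uniform_convergence_def by blast
    then have "0 \<le> (LBINT t:{1<..}. r S t)"
      unfolding set_lebesgue_integral_def
      by (intro Bochner_Integration.integral_nonneg) (simp add: indicator_def)
    then have C: "0 \<le> ?C" using L(2) k1 by simp
    show ?thesis
    proof (intro exI[of _ ?C] conjI C allI impI)
      fix h f assume h: "0 < h" "h \<le> 1" and f: "concentrated S \<kappa> k1 h f"
      show "dominated_on (autocov P X \<mu> f) {1<..} (?C * ?V h)"
        by (rule scale[OF long_time_uniform_dominated[OF conv S conc[OF f] k1 L] C h])
    qed
  next
    assume dim: "2 \<le> DIM('s)" and "exp_beta_mixing X P \<mu>"
    then obtain cm \<theta> where mix: "0 < cm" "0 < \<theta>"
        "\<And>t. 0 \<le> t \<Longrightarrow> (\<integral>\<^sup>+y. ennreal (tv_dist (Q t y) \<mu>) \<partial>\<mu>) \<le> ennreal (cm * exp (- \<theta> * t))"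
      unfolding exp_beta_mixing_def by blast
    obtain c where c: "0 < c" "\<And>t y z. t \<in> {0<..1} \<Longrightarrow> p t y z \<le> c * t powr (- real DIM('s) / 2)"
      using short dim unfolding short_time_bound_def by auto
    have p1: "p 1 y z \<le> c" for y z using c(2)[of 1 y z] by simp
    let ?C = "(c + L) * k1 * (L * k1) * (2 * real DIM('s) / \<theta>) + \<kappa>\<^sup>2 * cm / \<theta>"
    show ?thesis
    proof (intro exI[of _ ?C] conjI allI impI)
      show "0 \<le> ?C" using mix(1,2) c(1) L(2) k1 by simp
      fix h f assume h: "0 < h" "h \<le> 1" and f: "concentrated S \<kappa> k1 h f"
      show "dominated_on (autocov P X \<mu> f) {1<..} (?C * ?V h)"
        by (rule long_time_mixing_dominated[OF dim c(1) p1 mix h \<kappa> conc[OF f] k1 L])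
    qed
  qed
  obtain C1 where C1: "0 \<le> C1" and dom1: "\<And>h f. 0 < h \<Longrightarrow> h \<le> 1 \<Longrightarrow> concentrated S \<kappa> k1 h f \<Longrightarrow>
      dominated_on (autocov P X \<mu> f) {0<..1} (C1 * ?V h)" using short_ex by blast
  obtain C2 where C2: "0 \<le> C2" and dom2: "\<And>h f. 0 < h \<Longrightarrow> h \<le> 1 \<Longrightarrow> concentrated S \<kappa> k1 h f \<Longrightarrow>
      dominated_on (autocov P X \<mu> f) {1<..} (C2 * ?V h)" using long_ex by blast
  show thesis
  proof (rule that)
    show "0 \<le> C1 + C2" using C1 C2 by simp
    fix h f assume h: "0 < h" "h \<le> 1" and f: "concentrated S \<kappa> k1 h f"
    have "{0<..} = {0<..1} \<union> {1 :: real<..}" by auto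
    moreover have "dominated_on (autocov P X \<mu> f) ({0<..1} \<union> {1<..}) (C1 * ?V h + C2 * ?V h)"
      by (rule dominated_on_Un[OF dom1[OF h f] dom2[OF h f]]) (use C1 C2 V1[OF h] in auto)
    ultimately show "dominated_on (autocov P X \<mu> f) {0<..} ((C1 + C2) * ?V h)"
      by (simp add: distrib_right)
  qed
qed

text \<open>
  In dimension 1 both classes of processes provide local uniform convergence; in higher dimension the
  first class provides mixing and the second one local uniform convergence.
\<close>

lemma mean_square_error_of_time_average:
  fixes M :: "'w measure" and X :: "real \<Rightarrow> 'w \<Rightarrow> 's::euclidean_space"
  assumes cls: "class_\<Sigma> M F X P \<rho> \<or> class_\<Theta> M F X P \<rho>"
    and S: "compact S" and L: "\<And>y. y \<in> S \<Longrightarrow> \<rho> y \<le> L" "0 \<le> L" and \<kappa>: "0 < \<kappa>" and k1: "0 \<le> k1"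
  obtains C where "0 \<le> C"
    and "\<And>h f T a. 0 < h \<Longrightarrow> h \<le> 1 \<Longrightarrow> concentrated S \<kappa> k1 h f \<Longrightarrow> 0 < T \<Longrightarrow>
      (\<integral>\<omega>. ((1 / T) * (LBINT s:{0..T}. f (X s \<omega>)) - a)\<^sup>2 \<partial>(density_measure \<rho> \<bind> P))
        \<le> C * (variance_factor DIM('s) h / T) + 2 * ((\<integral>y. f y \<partial>density_measure \<rho>) - a)\<^sup>2"
proof -
  obtain p where right: "borel_right_process M F X P" and basic: "basic_assumption X P p \<rho>"
    and short: "short_time_bound p"
    and long: "(\<exists>\<Lambda> r. local_uniform_convergence p \<rho> \<Lambda> r) \<or> (2 \<le> DIM('s) \<and> exp_beta_mixing X P (density_measure \<rho>))"
  proof -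
    have "2 \<le> DIM('s)" if "DIM('s) \<noteq> 1" using that DIM_positive[where 'a='s] by linarith
    then show thesis using cls that unfolding class_\<Sigma>_def class_\<Theta>_def by blast
  qed
  interpret transition_density_process M F X P \<rho> p
    by unfold_locales (use right basic in \<open>auto simp: basic_assumption_def\<close>)
  obtain C where C: "0 \<le> C" and dom: "\<And>h f. 0 < h \<Longrightarrow> h \<le> 1 \<Longrightarrow> concentrated S \<kappa> k1 h f \<Longrightarrow>
      dominated_on (autocov P X \<mu> f) {0<..} (C * variance_factor DIM('s) h)"
    using autocov_dominated[OF short long S L \<kappa> k1] by blast
  show thesis
  proof (rule that)
    show "0 \<le> 4 * C" using C by simp
    fix h f and T a :: real assume h: "0 < h" "h \<le> 1" and f: "concentrated S \<kappa> k1 h f" and T: "0 < T"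
    obtain \<phi> where \<phi>: "\<phi> \<in> borel_measurable borel" "\<And>u. 0 < u \<Longrightarrow> ennreal \<bar>autocov P X \<mu> f u\<bar> \<le> \<phi> u"
        "(\<integral>\<^sup>+u. \<phi> u * indicator {0<..} u \<partial>lborel) \<le> ennreal (C * variance_factor DIM('s) h)"
      using dom[OF h f] unfolding dominated_on_def by auto
    have fb: "f \<in> borel_measurable borel" "\<And>y. \<bar>f y\<bar> \<le> \<kappa> / h ^ DIM('s)"
      using f by (auto simp: concentrated_def)
    have "0 \<le> C * variance_factor DIM('s) h"
      using C variance_factor_ge_1[OF h, of "DIM('s)"] by simp
    from mean_square_error_time_average[OF fb T \<phi> this, of a]
    show "(\<integral>\<omega>. ((1 / T) * (LBINT s:{0..T}. f (X s \<omega>)) - a)\<^sup>2 \<partial>(density_measure \<rho> \<bind> P))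
        \<le> 4 * C * (variance_factor DIM('s) h / T) + 2 * ((\<integral>y. f y \<partial>density_measure \<rho>) - a)\<^sup>2"
      by (simp add: mult.assoc)
  qed
qed

section \<open>Taylor expansion and kernel bias\<close>

text \<open>
  Changing one coordinate at a time, each step is controlled by the mean value theorem in that coordinate
  alone.  All intermediate points keep the distance from \<open>x\<close> below \<open>\<delta>\<close>, since dropping or shrinking
  coordinates does not increase the norm.
\<close>

lemma increment_from_partials:
  fixes f :: "real ^ 'n::finite \<Rightarrow> real"
  assumes diff: "\<And>i y. norm (y - x) < \<delta> \<Longrightarrow> (\<lambda>t. f (y + t *\<^sub>R axis i 1)) field_differentiable (at 0)"
    and close: "\<And>i y. norm (y - x) < \<delta> \<Longrightarrow> \<bar>partial_deriv i f y - partial_deriv i f x\<bar> \<le> e"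
    and v: "norm v < \<delta>" and "finite S" and supp: "\<And>i. i \<notin> S \<Longrightarrow> v $ i = 0"
  shows "\<bar>f (x + v) - f x - (\<Sum>i\<in>S. v $ i * partial_deriv i f x)\<bar> \<le> e * (\<Sum>i\<in>S. \<bar>v $ i\<bar>)"
  using \<open>finite S\<close> v supp
proof (induction S arbitrary: v rule: finite_induct)
  case empty
  then have "v = 0" by (simp add: vec_eq_iff)
  then show ?case by simp
next
  case (insert j S)
  define w where "w = v - (v $ j) *\<^sub>R axis j 1"
  have w_nth: "w $ i = (if i = j then 0 else v $ i)" for i
    by (simp add: w_def axis_def)
  have segment: "norm (w + s *\<^sub>R axis j 1) < \<delta>" if "\<bar>s\<bar> \<le> \<bar>v $ j\<bar>" for s
  proof -
    have "norm (w + s *\<^sub>R axis j 1) \<le> norm v"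
      by (rule norm_le_componentwise_cart) (use that in \<open>auto simp: w_nth axis_def\<close>)
    then show ?thesis using insert.prems(1) by simp
  qed
  define g where "g s = f (x + w + s *\<^sub>R axis j 1)" for s
  have g: "(g has_real_derivative partial_deriv j f (x + w + s *\<^sub>R axis j 1)) (at s)"
    if "\<bar>s\<bar> \<le> \<bar>v $ j\<bar>" for s
  proof -
    let ?y = "x + w + s *\<^sub>R axis j 1"
    have "norm (?y - x) < \<delta>" using segment[OF that] by (simp add: algebra_simps)
    from diff[OF this, of j] have "((\<lambda>t. f (?y + t *\<^sub>R axis j 1)) has_real_derivative partial_deriv j f ?y) (at 0)"
      unfolding partial_deriv_def using DERIV_deriv_iff_field_differentiable by blast
    moreover have "(\<lambda>t. f (?y + t *\<^sub>R axis j 1)) = (\<lambda>t. g (t + s))"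
      by (simp add: g_def algebra_simps)
    ultimately show ?thesis using DERIV_shift[of g _ 0 s] by simp
  qed
  have step: "\<exists>s. \<bar>s\<bar> \<le> \<bar>v $ j\<bar> \<and> g (v $ j) - g 0 = v $ j * partial_deriv j f (x + w + s *\<^sub>R axis j 1)"
  proof (cases "v $ j" "0 :: real" rule: linorder_cases)
    case equal
    then show ?thesis by (intro exI[of _ 0]) simp
  next
    case greater
    have "\<exists>z. 0 < z \<and> z < v $ j \<and> g (v $ j) - g 0 = (v $ j - 0) * partial_deriv j f (x + w + z *\<^sub>R axis j 1)"
      by (rule MVT2[OF greater]) (use g greater in auto)
    then show ?thesis using greater by force
  next
    case less
    have "\<exists>z. v $ j < z \<and> z < 0 \<and> g 0 - g (v $ j) = (0 - v $ j) * partial_deriv j f (x + w + z *\<^sub>R axis j 1)"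
      by (rule MVT2[OF less]) (use g less in auto)
    then obtain z where z: "v $ j < z" "z < 0" "g 0 - g (v $ j) = (0 - v $ j) * partial_deriv j f (x + w + z *\<^sub>R axis j 1)"
      by blast
    then show ?thesis using less by (intro exI[of _ z]) (auto simp: algebra_simps)
  qed
  then obtain s where s: "\<bar>s\<bar> \<le> \<bar>v $ j\<bar>"
    and gs: "g (v $ j) - g 0 = v $ j * partial_deriv j f (x + w + s *\<^sub>R axis j 1)" by blast
  have "\<bar>partial_deriv j f (x + w + s *\<^sub>R axis j 1) - partial_deriv j f x\<bar> \<le> e"
    using segment[OF s] by (intro close) (simp add: algebra_simps)
  then have last: "\<bar>g (v $ j) - g 0 - v $ j * partial_deriv j f x\<bar> \<le> e * \<bar>v $ j\<bar>"
    unfolding gs by (simp add: right_diff_distrib[symmetric] abs_mult mult.commute[of e] mult_left_mono)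
  have "\<bar>f (x + w) - f x - (\<Sum>i\<in>S. w $ i * partial_deriv i f x)\<bar> \<le> e * (\<Sum>i\<in>S. \<bar>w $ i\<bar>)"
    using insert.IH[of w] segment[of 0] insert.prems(2) by (auto simp: w_nth)
  moreover have "(\<Sum>i\<in>S. w $ i * partial_deriv i f x) = (\<Sum>i\<in>S. v $ i * partial_deriv i f x)"
    and "(\<Sum>i\<in>S. \<bar>w $ i\<bar>) = (\<Sum>i\<in>S. \<bar>v $ i\<bar>)"
    using insert.hyps by (auto simp: w_nth intro!: sum.cong)
  moreover have "g 0 = f (x + w)" "g (v $ j) = f (x + v)"
    by (simp_all add: g_def w_def)
  ultimately show ?case
    using last insert.hyps by (simp add: distrib_left)
qed

text \<open>
  Near \<open>x\<close> the partial derivatives differ from their values at \<open>x\<close> by as little as desired, which is the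
  error allowed in the previous estimate.
\<close>

lemma has_derivative_from_partials:
  fixes f :: "real ^ 'n::finite \<Rightarrow> real"
  assumes D: "open D" "x \<in> D"
    and diff: "\<And>i y. y \<in> D \<Longrightarrow> (\<lambda>t. f (y + t *\<^sub>R axis i 1)) field_differentiable (at 0)"
    and cont: "\<And>i. continuous_on D (partial_deriv i f)"
  shows "(f has_derivative (\<lambda>v. \<Sum>i\<in>UNIV. v $ i * partial_deriv i f x)) (at x)"
  unfolding has_derivative_within_alt
proof (intro conjI allI impI)
  show "bounded_linear (\<lambda>v. \<Sum>i\<in>UNIV. v $ i * partial_deriv i f x)"
    by (intro bounded_linear_sum bounded_linear_mult_const bounded_linear_vec_nth)
  fix e :: real assume e: "0 < e"
  define e' where "e' = e / real CARD('n)"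
  have e': "0 < e'" using e by (simp add: e'_def)
  have "\<forall>i. \<forall>\<^sub>F y in nhds x. \<bar>partial_deriv i f y - partial_deriv i f x\<bar> \<le> e'"
  proof
    fix i
    have "isCont (partial_deriv i f) x"
      using cont[of i] D continuous_on_eq_continuous_at by blast
    then have "(partial_deriv i f \<longlongrightarrow> partial_deriv i f x) (nhds x)"
      by (simp add: isCont_def tendsto_at_iff_tendsto_nhds)
    from tendstoD[OF this e'] show "\<forall>\<^sub>F y in nhds x. \<bar>partial_deriv i f y - partial_deriv i f x\<bar> \<le> e'"
      by eventually_elim (simp add: dist_real_def)
  qed
  then have "\<forall>\<^sub>F y in nhds x. y \<in> D \<and> (\<forall>i. \<bar>partial_deriv i f y - partial_deriv i f x\<bar> \<le> e')"
    using D by (intro eventually_conj eventually_nhds_in_open eventually_all_finite) auto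
  then obtain \<delta> where \<delta>: "0 < \<delta>"
    and close: "\<And>y. dist y x < \<delta> \<Longrightarrow> y \<in> D \<and> (\<forall>i. \<bar>partial_deriv i f y - partial_deriv i f x\<bar> \<le> e')"
    unfolding eventually_nhds_metric by blast
  show "\<exists>d>0. \<forall>y\<in>UNIV. norm (y - x) < d \<longrightarrow>
      norm (f y - f x - (\<Sum>i\<in>UNIV. (y - x) $ i * partial_deriv i f x)) \<le> e * norm (y - x)"
  proof (intro exI[of _ \<delta>] conjI \<delta> ballI impI)
    fix y assume y: "norm (y - x) < \<delta>"
    have "\<bar>f (x + (y - x)) - f x - (\<Sum>i\<in>UNIV. (y - x) $ i * partial_deriv i f x)\<bar> \<le> e' * (\<Sum>i\<in>UNIV. \<bar>(y - x) $ i\<bar>)"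
      by (rule increment_from_partials[where \<delta>=\<delta>])
         (use diff close y in \<open>auto simp: dist_norm\<close>)
    also have "\<dots> \<le> e' * (\<Sum>i\<in>(UNIV :: 'n set). norm (y - x))"
      using e' by (intro mult_left_mono sum_mono component_le_norm_cart) auto
    also have "\<dots> = e * norm (y - x)" by (simp add: e'_def)
    finally show "norm (f y - f x - (\<Sum>i\<in>UNIV. (y - x) $ i * partial_deriv i f x)) \<le> e * norm (y - x)"
      by simp
  qed
qed

text \<open>
  The \<open>m\<close>-th derivative at \<open>t = 0\<close> of \<open>f (y + t v)\<close>.  Summing over lists of coordinates, and not over
  multi-indices, absorbs the multinomial coefficients.
\<close>

definition line_deriv :: "(real ^ 'n::finite \<Rightarrow> real) \<Rightarrow> nat \<Rightarrow> real ^ 'n \<Rightarrow> real ^ 'n \<Rightarrow> real" where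
  "line_deriv f m y v = (\<Sum>is\<in>{is. length is = m}. (\<Prod>i\<leftarrow>is. v $ i) * partials is f y)"

lemma line_deriv_Suc:
  "line_deriv f (Suc m) y v = (\<Sum>is\<in>{is. length is = m}. (\<Prod>i\<leftarrow>is. v $ i) * (\<Sum>i\<in>UNIV. v $ i * partials (i # is) f y))"
proof -
  have eq: "{is :: 'a list. length is = Suc m} = (\<lambda>(i, is). i # is) ` (UNIV \<times> {is. length is = m})"
    by (auto simp: length_Suc_conv image_iff)
  have "line_deriv f (Suc m) y v =
      (\<Sum>(i, is)\<in>UNIV \<times> {is. length is = m}. (\<Prod>i\<leftarrow>i # is. v $ i) * partials (i # is) f y)"
    unfolding line_deriv_def eq by (subst sum.reindex) (auto simp: inj_on_def case_prod_beta)
  also have "\<dots> = (\<Sum>i\<in>UNIV. \<Sum>is\<in>{is. length is = m}. (\<Prod>i\<leftarrow>i # is. v $ i) * partials (i # is) f y)"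
    by (rule sum.cartesian_product[symmetric])
  also have "\<dots> = (\<Sum>is\<in>{is. length is = m}. \<Sum>i\<in>UNIV. (\<Prod>i\<leftarrow>i # is. v $ i) * partials (i # is) f y)"
    by (rule sum.swap)
  finally show ?thesis by (simp add: sum_distrib_left mult_ac)
qed

text \<open>
  Each partial derivative of order \<open>m < k\<close> has continuous partial derivatives, hence is differentiable,
  and the chain rule prepends one coordinate to its list.
\<close>

lemma line_deriv_has_derivative:
  fixes f :: "real ^ 'n::finite \<Rightarrow> real"
  assumes D: "open D" and C: "C_k_on k D f" and m: "m < k" and y: "x + t *\<^sub>R v \<in> D"
  shows "((\<lambda>t. line_deriv f m (x + t *\<^sub>R v) v) has_real_derivative line_deriv f (Suc m) (x + t *\<^sub>R v) v) (at t)"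
  unfolding line_deriv_Suc unfolding line_deriv_def
proof (intro DERIV_sum DERIV_cmult)
  fix "is" :: "'n list" assume "is \<in> {is. length is = m}"
  then have len: "length is < k" using m by simp
  let ?g = "partials is f"
  have pd: "partial_deriv i ?g = partials (i # is) f" for i
    by (simp add: partials_def)
  have "(?g has_derivative (\<lambda>w. \<Sum>i\<in>UNIV. w $ i * partials (i # is) f (x + t *\<^sub>R v))) (at (x + t *\<^sub>R v))"
    unfolding pd[symmetric]
  proof (rule has_derivative_from_partials[OF D y])
    show "(\<lambda>t. ?g (y + t *\<^sub>R axis i 1)) field_differentiable (at 0)" if "y \<in> D" for i y
      using C len that unfolding C_k_on_def by blast
    show "continuous_on D (partial_deriv i ?g)" for i
      unfolding pd using C len unfolding C_k_on_def by (metis Suc_leI length_Cons)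
  qed
  moreover have "((\<lambda>t. x + t *\<^sub>R v) has_derivative (\<lambda>s. s *\<^sub>R v)) (at t)"
    by (auto intro!: derivative_eq_intros)
  ultimately have "((\<lambda>t. ?g (x + t *\<^sub>R v)) has_derivative
      (\<lambda>s. \<Sum>i\<in>UNIV. (s *\<^sub>R v) $ i * partials (i # is) f (x + t *\<^sub>R v))) (at t)"
    using has_derivative_compose by blast
  moreover have "(\<lambda>s. \<Sum>i\<in>UNIV. (s *\<^sub>R v) $ i * partials (i # is) f (x + t *\<^sub>R v))
      = (*) (\<Sum>i\<in>UNIV. v $ i * partials (i # is) f (x + t *\<^sub>R v))"
    by (rule ext) (simp add: sum_distrib_left sum_distrib_right mult_ac)
  ultimately show "((\<lambda>t. ?g (x + t *\<^sub>R v)) has_real_derivative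
      (\<Sum>i\<in>UNIV. v $ i * partials (i # is) f (x + t *\<^sub>R v))) (at t)"
    by (simp only: has_field_derivative_def)
qed

text \<open>
  One-dimensional Taylor expansion with Lagrange remainder on the segment from \<open>x - v\<close> to \<open>x + v\<close>.
  The remainder has the \<open>k\<close>-th derivative at a point of that segment; replacing it by the one at \<open>x\<close>
  completes the polynomial, and the Hoelder condition on the \<open>CARD('n) ^ k\<close> partial derivatives pays for it.
\<close>

lemma holder_taylor:
  fixes f :: "real ^ 'n::finite \<Rightarrow> real"
  assumes f: "f \<in> holder_class D \<beta> L" and D: "open D" and \<beta>: "0 < \<beta>" and r: "0 < r" and ball: "cball x r \<subseteq> D"
  defines "k \<equiv> strict_floor \<beta>"
  assumes v: "norm v \<le> r"
  shows "\<bar>f (x + v) - (\<Sum>m\<le>k. line_deriv f m x v / fact m)\<bar> \<le> L * real CARD('n) ^ k * norm v powr \<beta>"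
proof -
  have k: "real k < \<beta>" "\<beta> \<le> real k + 1"
    using \<beta> unfolding k_def strict_floor_def by (auto; linarith)+
  have xD: "x \<in> D" using ball r by auto
  have C: "C_k_on k D f" and fL: "\<bar>f x\<bar> \<le> L"
    and hol: "\<And>is y z. length is = k \<Longrightarrow> y \<in> D \<Longrightarrow> z \<in> D \<Longrightarrow> y \<noteq> z \<Longrightarrow>
      \<bar>partials is f y - partials is f z\<bar> / norm (y - z) powr (\<beta> - real k) \<le> L"
    using f xD unfolding holder_class_def k_def by blast+
  have L: "0 \<le> L" using fL by linarith
  have line: "x + t *\<^sub>R v \<in> D" if "\<bar>t\<bar> \<le> 1" for t
  proof -
    have "\<bar>t\<bar> * norm v \<le> 1 * r" using that v by (intro mult_mono) auto
    then show ?thesis using ball by (auto simp: dist_norm subset_iff)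
  qed
  have "\<exists>t. \<bar>t\<bar> \<le> \<bar>1\<bar> \<and> f (x + 1 *\<^sub>R v) = (\<Sum>m<k. line_deriv f m (x + 0 *\<^sub>R v) v / fact m * 1 ^ m)
      + line_deriv f k (x + t *\<^sub>R v) v / fact k * 1 ^ k"
  proof (rule Maclaurin_bi_le)
    show "(\<lambda>t. line_deriv f 0 (x + t *\<^sub>R v) v) = (\<lambda>t. f (x + t *\<^sub>R v))"
      by (simp add: line_deriv_def partials_def)
  qed (use line_deriv_has_derivative[OF D C] line in auto)
  then obtain t where t: "\<bar>t\<bar> \<le> 1"
    and eq: "f (x + v) = (\<Sum>m<k. line_deriv f m x v / fact m) + line_deriv f k (x + t *\<^sub>R v) v / fact k"
    by auto
  have part: "\<bar>partials is f (x + t *\<^sub>R v) - partials is f x\<bar> \<le> L * norm v powr (\<beta> - real k)"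
    if "length is = k" for "is"
  proof (cases "t *\<^sub>R v = 0")
    case True
    then show ?thesis using L by (simp add: \<open>t *\<^sub>R v = 0\<close>)
  next
    case False
    have "\<bar>partials is f (x + t *\<^sub>R v) - partials is f x\<bar> \<le> L * norm (t *\<^sub>R v) powr (\<beta> - real k)"
      using hol[OF that line[OF t] xD] False by (simp add: pos_divide_le_eq)
    also have "\<dots> \<le> L * norm v powr (\<beta> - real k)"
      using t k by (intro mult_left_mono powr_mono2 L) (auto simp: mult_left_le_one_le)
    finally show ?thesis .
  qed
  have prod: "\<bar>\<Prod>i\<leftarrow>is. v $ i\<bar> \<le> norm v ^ length is" for "is" :: "'n list"
    by (induction "is") (auto simp: abs_mult intro!: mult_mono component_le_norm_cart)
  have "f (x + v) - (\<Sum>m\<le>k. line_deriv f m x v / fact m)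
      = (line_deriv f k (x + t *\<^sub>R v) v - line_deriv f k x v) / fact k"
    unfolding eq by (simp add: lessThan_Suc_atMost[symmetric] diff_divide_distrib)
  also have "\<bar>\<dots>\<bar> \<le> \<bar>line_deriv f k (x + t *\<^sub>R v) v - line_deriv f k x v\<bar>"
    by (simp add: abs_divide divide_le_eq mult_left_le fact_ge_1 mult_le_cancel_left1)
  also have "\<dots> = \<bar>\<Sum>is\<in>{is. length is = k}. (\<Prod>i\<leftarrow>is. v $ i) * (partials is f (x + t *\<^sub>R v) - partials is f x)\<bar>"
    by (simp add: line_deriv_def sum_subtractf right_diff_distrib)
  also have "\<dots> \<le> (\<Sum>is\<in>{is. length is = k}. \<bar>(\<Prod>i\<leftarrow>is. v $ i) * (partials is f (x + t *\<^sub>R v) - partials is f x)\<bar>)"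
    by (rule sum_abs)
  also have "\<dots> \<le> (\<Sum>is\<in>{is :: 'n list. length is = k}. norm v ^ k * (L * norm v powr (\<beta> - real k)))"
  proof (rule sum_mono)
    fix "is" :: "'n list" assume "is \<in> {is. length is = k}"
    then have len: "length is = k" by simp
    show "\<bar>(\<Prod>i\<leftarrow>is. v $ i) * (partials is f (x + t *\<^sub>R v) - partials is f x)\<bar>
        \<le> norm v ^ k * (L * norm v powr (\<beta> - real k))"
      unfolding abs_mult using part[OF len] prod[of "is"] len by (intro mult_mono) auto
  qed
  also have "\<dots> = L * real CARD('n) ^ k * (norm v ^ k * norm v powr (\<beta> - real k))"
    using card_lists_length_eq[of "UNIV :: 'n set" k] by simp
  also have "norm v ^ k * norm v powr (\<beta> - real k) = norm v powr \<beta>"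
    by (cases "v = 0") (use k in \<open>auto simp: powr_diff powr_realpow\<close>)
  finally show ?thesis .
qed


lemma prod_list_eq_monomial_fun: "(\<Prod>i\<leftarrow>is. v $ i) = monomial_fun (count_list is) v"
proof (induction "is")
  case (Cons j "is")
  have "monomial_fun (count_list (j # is)) v
      = (\<Prod>i\<in>UNIV. (if i = j then v $ j else 1) * (v $ i) ^ count_list is i)"
    unfolding monomial_fun_def by (intro prod.cong) auto
  also have "\<dots> = v $ j * monomial_fun (count_list is) v"
    by (simp add: prod.distrib monomial_fun_def)
  finally show ?case using Cons by (simp only: list.map prod_list.Cons)
qed (simp add: monomial_fun_def)

lemma sum_count_list: "(\<Sum>i\<in>UNIV. count_list is i) = length (is :: 'n::finite list)"
proof (induction "is")
  case (Cons j "is")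
  have "(\<Sum>i\<in>UNIV. count_list (j # is) i) = (\<Sum>i\<in>UNIV. (if i = j then 1 else 0) + count_list is i)"
    by (intro sum.cong) auto
  then show ?case using Cons by (simp add: sum.distrib)
qed simp

lemma prod_list_scaleR: "(\<Prod>i\<leftarrow>is. (c *\<^sub>R v) $ i) = c ^ length is * (\<Prod>i\<leftarrow>is. v $ i)"
  by (induction "is") (auto simp: mult_ac)

lemma line_deriv_scaleR: "line_deriv f m y (c *\<^sub>R v) = c ^ m * line_deriv f m y v"
  unfolding line_deriv_def sum_distrib_left
  by (rule sum.cong) (auto simp: prod_list_scaleR mult_ac)

locale order_kernel =
  fixes K :: "real ^ 'n::finite \<Rightarrow> real" and l :: nat
  assumes kernel: "kernel_of_order l K"
begin

lemma kernel_measurable[measurable]: "K \<in> borel_measurable borel"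
  using kernel lipschitz_on_continuous_on unfolding kernel_of_order_def
  by (blast intro: borel_measurable_continuous_onI)

lemma kernel_support: "K u \<noteq> 0 \<Longrightarrow> norm u \<le> real CARD('n)"
proof -
  assume "K u \<noteq> 0"
  then have half: "\<bar>u $ i\<bar> \<le> 1 / 2" for i using kernel by (auto simp: kernel_of_order_def)
  have "\<bar>u $ i\<bar> \<le> 1" for i using half[of i] by simp
  then have "(\<Sum>i\<in>UNIV. \<bar>u $ i\<bar>) \<le> (\<Sum>i\<in>(UNIV :: 'n set). 1)"
    by (intro sum_mono)
  then show "norm u \<le> real CARD('n)" using norm_le_l1_cart[of u] by simp
qed

lemma kernel_bounded: obtains \<kappa> where "0 < \<kappa>" "\<And>u. \<bar>K u\<bar> \<le> \<kappa>"
proof -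
  obtain C where C: "C-lipschitz_on UNIV K" using kernel by (auto simp: kernel_of_order_def)
  have C0: "0 \<le> C" using C by (rule lipschitz_on_nonneg)
  have "\<bar>K u\<bar> \<le> \<bar>K 0\<bar> + C * real CARD('n) + 1" for u
  proof (cases "K u = 0")
    case True
    then show ?thesis using C0 by (simp add: add_nonneg_nonneg)
  next
    case False
    have "\<bar>K u - K 0\<bar> \<le> C * norm u"
      using lipschitz_onD[OF C, of u 0] by (simp add: dist_norm)
    also have "\<dots> \<le> C * real CARD('n)" by (intro mult_left_mono kernel_support[OF False] C0)
    finally show ?thesis by linarith
  qed
  moreover have "0 < \<bar>K 0\<bar> + C * real CARD('n) + 1" using C0 by (simp add: add_nonneg_pos)
  ultimately show thesis using that by blast
qed

lemma kernel_monomial_integrable: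
  "(\<Sum>i\<in>UNIV. \<alpha> i) \<le> l \<Longrightarrow> integrable lborel (\<lambda>u. monomial_fun \<alpha> u * K u)"
  using kernel by (simp add: kernel_of_order_def)

lemma kernel_moment_vanishes:
  "1 \<le> (\<Sum>i\<in>UNIV. \<alpha> i) \<Longrightarrow> (\<Sum>i\<in>UNIV. \<alpha> i) \<le> l \<Longrightarrow> (\<integral>u. K u * monomial_fun \<alpha> u \<partial>lborel) = 0"
  using kernel unfolding kernel_of_order_def by blast

lemma kernel_integrable: "integrable lborel K"
  using kernel_monomial_integrable[of "\<lambda>_. 0"] by (simp add: monomial_fun_def)

lemma kernel_integral: "(\<integral>u. K u \<partial>lborel) = 1"
  using kernel by (simp add: kernel_of_order_def)

text \<open>
  A list of coordinates gives the monomial whose exponents count its entries, so the product belongs to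
  the monomial of the same degree, where the moments of the kernel are known.
\<close>

lemma kernel_prod_list:
  assumes "length is \<le> l"
  shows "has_bochner_integral lborel (\<lambda>u. K u * (\<Prod>i\<leftarrow>is. u $ i)) (if is = [] then 1 else 0)"
proof (cases "is = []")
  case True
  then show ?thesis by (simp add: has_bochner_integral_iff kernel_integrable kernel_integral)
next
  case False
  let ?\<alpha> = "count_list is"
  have "integrable lborel (\<lambda>u. monomial_fun ?\<alpha> u * K u)" "(\<integral>u. K u * monomial_fun ?\<alpha> u \<partial>lborel) = 0"
    using assms False
    by (auto intro!: kernel_monomial_integrable kernel_moment_vanishes simp: sum_count_list Suc_le_eq)
  then show ?thesis
    using False by (simp add: has_bochner_integral_iff prod_list_eq_monomial_fun mult.commute)
qed

lemma kernel_line_deriv: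
  assumes "m \<le> l"
  shows "has_bochner_integral lborel (\<lambda>u. K u * line_deriv f m x (c *\<^sub>R u)) (if m = 0 then f x else 0)"
proof -
  have "has_bochner_integral lborel
      (\<lambda>u. \<Sum>is\<in>{is. length is = m}. (K u * (\<Prod>i\<leftarrow>is. u $ i)) * (c ^ m * partials is f x))
      (\<Sum>is\<in>{is. length is = m}. (if is = [] then 1 else 0) * (c ^ m * partials is f x))"
    by (intro has_bochner_integral_sum has_bochner_integral_mult_left kernel_prod_list) (use assms in auto)
  also have "(\<lambda>u. \<Sum>is\<in>{is. length is = m}. (K u * (\<Prod>i\<leftarrow>is. u $ i)) * (c ^ m * partials is f x))
      = (\<lambda>u. K u * line_deriv f m x (c *\<^sub>R u))"
    unfolding line_deriv_scaleR by (simp add: line_deriv_def sum_distrib_left mult_ac)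
  also have "(\<Sum>is\<in>{is. length is = m}. (if is = [] then 1 else 0) * (c ^ m * partials is f x))
      = (if m = 0 then f x else 0)"
    by (auto simp: partials_def intro!: sum.neutral)
  finally show ?thesis .
qed

text \<open>
  Since \<open>\<beta> \<le> l + 1\<close>, the Taylor polynomial has degree at most \<open>l\<close>, and integrating it against the kernel
  leaves \<open>f x\<close>.  What remains is the Taylor error at distance at most \<open>h CARD('n)\<close> from \<open>x\<close>.
\<close>

lemma kernel_smoothing_bias:
  assumes f: "f \<in> holder_class D \<beta> L" and [measurable]: "f \<in> borel_measurable borel"
    and D: "open D" and \<beta>: "0 < \<beta>" "\<beta> \<le> real l + 1"
    and r: "0 < r" and ball: "cball x r \<subseteq> D" and h: "0 < h" "h * real CARD('n) \<le> r"
  shows "\<bar>(\<integral>u. K u * f (x - h *\<^sub>R u) \<partial>lborel) - f x\<bar>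
    \<le> L * real CARD('n) ^ strict_floor \<beta> * real CARD('n) powr \<beta> * (\<integral>u. \<bar>K u\<bar> \<partial>lborel) * h powr \<beta>"
proof -
  let ?d = "real CARD('n)"
  define k where "k = strict_floor \<beta>"
  have kl: "k \<le> l" using \<beta> unfolding k_def strict_floor_def by linarith
  define T where "T u = (\<Sum>m\<le>k. line_deriv f m x ((- h) *\<^sub>R u) / fact m)" for u
  have "has_bochner_integral lborel (\<lambda>u. \<Sum>m\<le>k. (K u * line_deriv f m x ((- h) *\<^sub>R u)) / fact m)
      (\<Sum>m\<le>k. (if m = 0 then f x else 0) / fact m)"
    by (intro has_bochner_integral_sum has_bochner_integral_divide kernel_line_deriv) (use kl in auto)
  also have "(\<lambda>u. \<Sum>m\<le>k. (K u * line_deriv f m x ((- h) *\<^sub>R u)) / fact m) = (\<lambda>u. K u * T u)"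
    by (simp add: T_def sum_distrib_left)
  also have "(\<Sum>m\<le>k. (if m = 0 then f x else 0) / fact m) = f x"
    by (simp add: if_distrib[of "\<lambda>a. a / _"] cong: if_cong)
  finally have KT: "integrable lborel (\<lambda>u. K u * T u)" "(\<integral>u. K u * T u \<partial>lborel) = f x"
    by (auto simp: has_bochner_integral_iff)
  have small: "norm ((- h) *\<^sub>R u) \<le> r" "norm ((- h) *\<^sub>R u) \<le> h * ?d" if "K u \<noteq> 0" for u
  proof -
    show "norm ((- h) *\<^sub>R u) \<le> h * ?d" using kernel_support[OF that] h by simp
    then show "norm ((- h) *\<^sub>R u) \<le> r" using h by linarith
  qed
  have fL: "\<bar>f y\<bar> \<le> L" if "y \<in> D" for y using f that by (auto simp: holder_class_def)
  have "x \<in> D" using ball r by auto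
  then have L: "0 \<le> L" using fL[of x] by linarith
  have KfL: "\<bar>K u * f (x - h *\<^sub>R u)\<bar> \<le> \<bar>K u\<bar> * L" for u
  proof (cases "K u = 0")
    case False
    then have "x - h *\<^sub>R u \<in> D" using small[OF False] ball by (auto simp: dist_norm subset_iff)
    then show ?thesis unfolding abs_mult by (intro mult_left_mono fL) auto
  qed simp
  have Kf: "integrable lborel (\<lambda>u. K u * f (x - h *\<^sub>R u))"
  proof (rule Bochner_Integration.integrable_bound)
    show "integrable lborel (\<lambda>u. \<bar>K u\<bar> * L)" using kernel_integrable by simp
  qed (use KfL L in \<open>auto simp: abs_mult\<close>)
  have diff: "\<bar>K u * f (x - h *\<^sub>R u) - K u * T u\<bar> \<le> \<bar>K u\<bar> * (L * ?d ^ k * (h * ?d) powr \<beta>)" for u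
  proof (cases "K u = 0")
    case False
    have "\<bar>f (x + (- h) *\<^sub>R u) - T u\<bar> \<le> L * ?d ^ k * norm ((- h) *\<^sub>R u) powr \<beta>"
      unfolding T_def k_def by (rule holder_taylor[OF f D \<beta>(1) r ball small(1)[OF False]])
    also have "\<dots> \<le> L * ?d ^ k * (h * ?d) powr \<beta>"
      using small(2)[OF False] \<beta> L by (intro mult_left_mono powr_mono2) auto
    finally show ?thesis
      unfolding right_diff_distrib[symmetric] abs_mult by (intro mult_left_mono) auto
  qed simp
  have "(\<integral>u. K u * f (x - h *\<^sub>R u) \<partial>lborel) - f x = (\<integral>u. K u * f (x - h *\<^sub>R u) - K u * T u \<partial>lborel)"
    using Kf KT by simp
  also have "\<bar>\<dots>\<bar> \<le> (\<integral>u. \<bar>K u * f (x - h *\<^sub>R u) - K u * T u\<bar> \<partial>lborel)"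
    by (rule integral_abs_bound)
  also have "\<dots> \<le> (\<integral>u. \<bar>K u\<bar> * (L * ?d ^ k * (h * ?d) powr \<beta>) \<partial>lborel)"
    by (intro integral_mono diff) (use Kf KT kernel_integrable in auto)
  also have "\<dots> = L * ?d ^ k * ?d powr \<beta> * (\<integral>u. \<bar>K u\<bar> \<partial>lborel) * h powr \<beta>"
    using h by (simp add: powr_mult mult_ac)
  finally show ?thesis by (simp add: k_def)
qed

lemma integral_scaled_kernel:
  assumes [measurable]: "g \<in> borel_measurable borel" and h: "0 < h"
  shows "(\<integral>y. scaled_kernel K h (x - y) * g y \<partial>lborel) = (\<integral>u. K u * g (x - h *\<^sub>R u) \<partial>lborel)"
proof -
  have [measurable]: "scaled_kernel K h \<in> borel_measurable borel"
    unfolding scaled_kernel_def by measurable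
  have "(\<integral>y. scaled_kernel K h (x - y) * g y \<partial>lborel)
      = (\<integral>y. scaled_kernel K h (x - y) * g y
          \<partial>density (distr lborel borel (\<lambda>u. x + (- h) *\<^sub>R u)) (\<lambda>_. ennreal (\<bar>- h\<bar> ^ DIM(real ^ 'n))))"
    using h by (subst lborel_affine[of "- h" x]) auto
  also have "\<dots> = (\<integral>u. h ^ CARD('n) * (scaled_kernel K h (h *\<^sub>R u) * g (x - h *\<^sub>R u)) \<partial>lborel)"
    using h by (subst integral_density) (auto simp: integral_distr)
  also have "\<dots> = (\<integral>u. K u * g (x - h *\<^sub>R u) \<partial>lborel)"
    using h by (simp add: scaled_kernel_def)
  finally show ?thesis .
qed

lemma nn_integral_scaled_kernel:
  assumes h: "0 < h"
  shows "(\<integral>\<^sup>+y. ennreal \<bar>scaled_kernel K h (x - y)\<bar> \<partial>lborel) = ennreal (\<integral>u. \<bar>K u\<bar> \<partial>lborel)"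
proof -
  have [measurable]: "scaled_kernel K h \<in> borel_measurable borel"
    unfolding scaled_kernel_def by measurable
  have "(\<integral>\<^sup>+y. ennreal \<bar>scaled_kernel K h (x - y)\<bar> \<partial>lborel)
      = (\<integral>\<^sup>+y. ennreal \<bar>scaled_kernel K h (x - y)\<bar>
          \<partial>density (distr lborel borel (\<lambda>u. x + (- h) *\<^sub>R u)) (\<lambda>_. ennreal (\<bar>- h\<bar> ^ DIM(real ^ 'n))))"
    using h by (subst lborel_affine[of "- h" x]) auto
  also have "\<dots> = (\<integral>\<^sup>+u. ennreal (h ^ CARD('n)) * ennreal \<bar>scaled_kernel K h (h *\<^sub>R u)\<bar> \<partial>lborel)"
    using h by (subst nn_integral_density) (auto simp: nn_integral_distr)
  also have "\<dots> = (\<integral>\<^sup>+u. ennreal \<bar>K u\<bar> \<partial>lborel)"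
    using h by (simp add: scaled_kernel_def ennreal_mult[symmetric] abs_divide)
  also have "\<dots> = ennreal (\<integral>u. \<bar>K u\<bar> \<partial>lborel)"
    by (rule nn_integral_eq_integral) (use kernel_integrable in auto)
  finally show ?thesis .
qed

end

section \<open>Rates of convergence\<close>

lemma bandwidth_bounds:
  fixes h :: "real \<Rightarrow> real"
  assumes h: "\<forall>T>0. 0 < h T" and \<Theta>: "h \<in> \<Theta>(\<lambda>T. T powr (- a))"
  obtains c1 c2 where "0 < c1" "0 < c2"
    and "\<forall>\<^sub>F T in at_top. c1 * T powr (- a) \<le> h T \<and> h T \<le> c2 * T powr (- a)"
proof -
  obtain c2 where c2: "0 < c2" "\<forall>\<^sub>F T in at_top. norm (h T) \<le> c2 * norm (T powr (- a))"
    using bigthetaD1[OF \<Theta>] by (rule landau_o.bigE)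
  obtain c1 where c1: "0 < c1" "\<forall>\<^sub>F T in at_top. norm (h T) \<ge> c1 * norm (T powr (- a))"
    using bigthetaD2[OF \<Theta>] by (rule landau_omega.bigE)
  have "\<forall>\<^sub>F T in at_top. c1 * T powr (- a) \<le> h T \<and> h T \<le> c2 * T powr (- a)"
    using c1(2) c2(2) eventually_gt_at_top[of 0]
  proof eventually_elim
    case (elim T)
    then show ?case using h by (simp add: less_imp_le)
  qed
  then show thesis using that c1(1) c2(1) by blast
qed

lemma bandwidth_tendsto_0:
  fixes h :: "real \<Rightarrow> real"
  assumes h: "\<forall>T>0. 0 < h T" and \<Theta>: "h \<in> \<Theta>(\<lambda>T. T powr (- a))" and a: "0 < a"
  shows "(h \<longlongrightarrow> 0) at_top"
proof -
  obtain c1 c2 where "0 < c1" "0 < c2"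
    and ev: "\<forall>\<^sub>F T in at_top. c1 * T powr (- a) \<le> h T \<and> h T \<le> c2 * T powr (- a)"
    using bandwidth_bounds[OF h \<Theta>] by blast
  have "((\<lambda>T. c2 * T powr (- a)) \<longlongrightarrow> c2 * 0) at_top"
    by (intro tendsto_mult tendsto_const tendsto_neg_powr filterlim_ident) (use a in simp)
  then have lim: "((\<lambda>T. c2 * T powr (- a)) \<longlongrightarrow> 0) at_top" by simp
  show ?thesis
  proof (rule tendsto_sandwich[OF _ _ tendsto_const lim])
    show "\<forall>\<^sub>F T in at_top. 0 \<le> h T"
      using eventually_gt_at_top[of 0] by eventually_elim (use h in \<open>auto intro: less_imp_le\<close>)
    show "\<forall>\<^sub>F T in at_top. h T \<le> c2 * T powr (- a)"
      using ev by eventually_elim simp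
  qed
qed

lemma bandwidth_powr_bigo:
  fixes h :: "real \<Rightarrow> real"
  assumes h: "\<forall>T>0. 0 < h T" and \<Theta>: "h \<in> \<Theta>(\<lambda>T. T powr (- a))" and b: "0 \<le> b"
  shows "(\<lambda>T. h T powr b) \<in> O(\<lambda>T. T powr (- (a * b)))"
proof -
  obtain c1 c2 where c: "0 < c1" "0 < c2"
    and ev: "\<forall>\<^sub>F T in at_top. c1 * T powr (- a) \<le> h T \<and> h T \<le> c2 * T powr (- a)"
    using bandwidth_bounds[OF h \<Theta>] by blast
  show ?thesis
  proof (rule bigoI[where c="c2 powr b"])
    show "\<forall>\<^sub>F T in at_top. norm (h T powr b) \<le> c2 powr b * norm (T powr (- (a * b)))"
      using ev eventually_gt_at_top[of 0]
    proof eventually_elim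
      case (elim T)
      then have "h T powr b \<le> (c2 * T powr (- a)) powr b"
        using h b by (intro powr_mono2) (auto intro: less_imp_le)
      also have "\<dots> = c2 powr b * T powr (- (a * b))"
        using c elim by (simp add: powr_mult powr_powr)
      finally show ?case by simp
    qed
  qed
qed

lemma bandwidth_neg_powr_bigo:
  fixes h :: "real \<Rightarrow> real"
  assumes h: "\<forall>T>0. 0 < h T" and \<Theta>: "h \<in> \<Theta>(\<lambda>T. T powr (- a))" and b: "b \<le> 0"
  shows "(\<lambda>T. h T powr b) \<in> O(\<lambda>T. T powr (- (a * b)))"
proof -
  obtain c1 c2 where c: "0 < c1" "0 < c2"
    and ev: "\<forall>\<^sub>F T in at_top. c1 * T powr (- a) \<le> h T \<and> h T \<le> c2 * T powr (- a)"
    using bandwidth_bounds[OF h \<Theta>] by blast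
  show ?thesis
  proof (rule bigoI[where c="c1 powr b"])
    show "\<forall>\<^sub>F T in at_top. norm (h T powr b) \<le> c1 powr b * norm (T powr (- (a * b)))"
      using ev eventually_gt_at_top[of 0]
    proof eventually_elim
      case (elim T)
      then have "h T powr b \<le> (c1 * T powr (- a)) powr b"
        using h b c by (intro powr_mono2') auto
      also have "\<dots> = c1 powr b * T powr (- (a * b))"
        using c elim by (simp add: powr_mult powr_powr)
      finally show ?case by simp
    qed
  qed
qed

lemma ln_inverse_bandwidth_bigo:
  fixes h :: "real \<Rightarrow> real"
  assumes h: "\<forall>T>0. 0 < h T" and \<Theta>: "h \<in> \<Theta>(\<lambda>T. T powr (- a))" and a: "0 < a"
  shows "(\<lambda>T. 1 + ln (1 / h T)) \<in> O(\<lambda>T. ln T)"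
proof -
  obtain c1 c2 where c: "0 < c1" "0 < c2"
    and ev: "\<forall>\<^sub>F T in at_top. c1 * T powr (- a) \<le> h T \<and> h T \<le> c2 * T powr (- a)"
    using bandwidth_bounds[OF h \<Theta>] by blast
  have small: "\<forall>\<^sub>F T in at_top. h T < 1"
    using order_tendstoD(2)[OF bandwidth_tendsto_0[OF h \<Theta> a]] by simp
  show ?thesis
  proof (rule bigoI[where c="1 + a + \<bar>ln c1\<bar>"])
    show "\<forall>\<^sub>F T in at_top. norm (1 + ln (1 / h T)) \<le> (1 + a + \<bar>ln c1\<bar>) * norm (ln T)"
      using ev small eventually_ge_at_top[of "exp 1"]
    proof eventually_elim
      case (elim T)
      have T: "0 < T" using elim(3) exp_gt_zero[of 1] by linarith
      have lnT: "1 \<le> ln T" using elim(3) T by (simp add: ln_ge_iff)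
      have hT: "0 < h T" using h T by simp
      have "ln c1 - a * ln T = ln (c1 * T powr (- a))"
        using c T by (simp add: ln_mult ln_powr)
      also have "\<dots> \<le> ln (h T)" using elim(1) hT c T by (intro ln_mono) auto
      finally have "1 + ln (1 / h T) \<le> 1 + a * ln T + \<bar>ln c1\<bar>"
        using hT by (simp add: ln_div)
      also have "\<dots> \<le> 1 * ln T + a * ln T + \<bar>ln c1\<bar> * ln T"
        using lnT by (intro add_mono) (auto simp: mult_le_cancel_left1)
      finally have "1 + ln (1 / h T) \<le> (1 + a + \<bar>ln c1\<bar>) * ln T" by (simp add: distrib_right)
      moreover have "0 \<le> ln (1 / h T)" using hT elim(2) by (simp add: ln_div)
      ultimately show ?case using lnT by simp
    qed
  qed
qed

text \<open>
  With \<open>h\<close> of the order \<open>T\<^sup>-\<^sup>a\<close> one has \<open>a \<beta> \<ge> 1\<close> for \<open>d \<le> 2\<close>, so the squared bias is even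
  \<open>O(T\<^sup>-\<^sup>2)\<close>, and \<open>a (2 \<beta> + d - 2) = 1\<close> for \<open>d \<ge> 3\<close>, where \<open>h\<^bsup>2-d\<^esup> / T\<close> and \<open>h\<^bsup>2\<beta>\<^esup>\<close> have the
  same order.
\<close>

lemma mean_square_rate:
  fixes h :: "real \<Rightarrow> real"
  assumes d: "0 < d" and \<beta>: "0 < \<beta>" and h: "\<forall>T>0. 0 < h T"
    and bandwidth: "if d \<le> 2 then \<exists>\<gamma>. 0 < \<gamma> \<and> \<gamma> \<le> \<beta> \<and> h \<in> \<Theta>(\<lambda>T. T powr (- 1 / \<gamma>))
      else h \<in> \<Theta>(\<lambda>T. T powr (- 1 / (2 * \<beta> + real d - 2)))"
  shows "(h \<longlongrightarrow> 0) at_top"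
    and "(\<lambda>T. variance_factor d (h T) / T) \<in> O(\<lambda>T. (rate_\<Phi> d \<beta> T)\<^sup>2)"
    and "(\<lambda>T. h T powr (2 * \<beta>)) \<in> O(\<lambda>T. (rate_\<Phi> d \<beta> T)\<^sup>2)"
proof -
  have "\<exists>a. 0 < a \<and> h \<in> \<Theta>(\<lambda>T. T powr (- a)) \<and>
      (if d \<le> 2 then 1 \<le> a * \<beta> else a = 1 / (2 * \<beta> + real d - 2))"
  proof (cases "d \<le> 2")
    case True
    then obtain \<gamma> where \<gamma>: "0 < \<gamma>" "\<gamma> \<le> \<beta>" "h \<in> \<Theta>(\<lambda>T. T powr (- 1 / \<gamma>))"
      using bandwidth by auto
    then show ?thesis using True by (intro exI[of _ "1 / \<gamma>"]) (auto simp: field_simps)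
  next
    case False
    then show ?thesis using bandwidth \<beta> by (intro exI[of _ "1 / (2 * \<beta> + real d - 2)"]) auto
  qed
  then obtain a where a: "0 < a" and \<Theta>: "h \<in> \<Theta>(\<lambda>T. T powr (- a))"
    and a_small: "d \<le> 2 \<Longrightarrow> 1 \<le> a * \<beta>" and a_large: "3 \<le> d \<Longrightarrow> a = 1 / (2 * \<beta> + real d - 2)"
    by (auto split: if_splits)
  show "(h \<longlongrightarrow> 0) at_top" by (rule bandwidth_tendsto_0[OF h \<Theta> a])
  have bias: "(\<lambda>T. h T powr (2 * \<beta>)) \<in> O(\<lambda>T. T powr (- (a * (2 * \<beta>))))"
    by (rule bandwidth_powr_bigo[OF h \<Theta>]) (use \<beta> in simp)
  have inverse_bias: "(\<lambda>T. h T powr (2 * \<beta>)) \<in> O(\<lambda>T. 1 / T)" if "d \<le> 2"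
  proof (rule landau_o.big_trans[OF bias], rule bigoI[where c=1])
    show "\<forall>\<^sub>F T in at_top. norm (T powr (- (a * (2 * \<beta>)))) \<le> 1 * norm (1 / T :: real)"
      using eventually_ge_at_top[of 1]
    proof eventually_elim
      case (elim T)
      have "T powr (- (a * (2 * \<beta>))) \<le> T powr (- 1)"
        using a_small[OF that] elim by (intro powr_mono) auto
      then show ?case using elim by (simp add: powr_minus_divide)
    qed
  qed
  consider "d = 1" | "d = 2" | "3 \<le> d" using d by linarith
  then have "(\<lambda>T. variance_factor d (h T) / T) \<in> O(\<lambda>T. (rate_\<Phi> d \<beta> T)\<^sup>2)
      \<and> (\<lambda>T. h T powr (2 * \<beta>)) \<in> O(\<lambda>T. (rate_\<Phi> d \<beta> T)\<^sup>2)"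
  proof cases
    case 1
    have rate: "\<forall>\<^sub>F T in at_top. 1 / T = (rate_\<Phi> d \<beta> T)\<^sup>2"
      using eventually_gt_at_top[of 0] by eventually_elim (simp add: 1 rate_\<Phi>_def power_divide)
    show ?thesis
      unfolding landau_o.big.cong[OF rate, symmetric] using inverse_bias 1
      by (simp add: variance_factor_def)
  next
    case 2
    have rate: "\<forall>\<^sub>F T in at_top. ln T / T = (rate_\<Phi> d \<beta> T)\<^sup>2"
      using eventually_ge_at_top[of 1] by eventually_elim (simp add: 2 rate_\<Phi>_def)
    have "(\<lambda>T. (1 + ln (1 / h T)) / T) \<in> O(\<lambda>T. ln T / T)"
      using landau_o.big.mult[OF ln_inverse_bandwidth_bigo[OF h \<Theta> a] landau_o.big_refl[of "\<lambda>T. 1 / T"]]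
      by simp
    moreover have "(\<lambda>T :: real. 1 / T) \<in> O(\<lambda>T. ln T / T)"
    proof (rule bigoI[where c=1])
      show "\<forall>\<^sub>F T in at_top. norm (1 / T :: real) \<le> 1 * norm (ln T / T)"
        using eventually_ge_at_top[of "exp 1"]
      proof eventually_elim
        case (elim T)
        have T: "0 < T" using elim exp_gt_zero[of 1] by linarith
        then have "1 \<le> ln T" using elim by (simp add: ln_ge_iff)
        then show ?case using T by (simp add: divide_right_mono)
      qed
    qed
    ultimately show ?thesis
      unfolding landau_o.big.cong[OF rate, symmetric] using landau_o.big_trans[OF inverse_bias] 2
      by (simp add: variance_factor_def)
  next
    case 3
    have rate: "\<forall>\<^sub>F T in at_top. T powr (- (a * (2 * \<beta>))) = (rate_\<Phi> d \<beta> T)\<^sup>2"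
      using eventually_gt_at_top[of 0]
    proof eventually_elim
      case (elim T)
      then show ?case using 3
        by (simp add: rate_\<Phi>_def a_large powr_realpow[symmetric] powr_powr mult.commute powr_gt_zero)
    qed
    have "(\<lambda>T. h T powr (2 - real d)) \<in> O(\<lambda>T. T powr (- (a * (2 - real d))))"
      by (rule bandwidth_neg_powr_bigo[OF h \<Theta>]) (use 3 in simp)
    from landau_o.big.mult[OF this landau_o.big_refl[of "\<lambda>T. 1 / T"]]
    have "(\<lambda>T. h T powr (2 - real d) / T) \<in> O(\<lambda>T. T powr (- (a * (2 - real d))) / T)" by simp
    also have "(\<lambda>T. T powr (- (a * (2 - real d))) / T) \<in> \<Theta>(\<lambda>T. T powr (- (a * (2 * \<beta>))))"
    proof (rule bigthetaI_cong)
      have exponent: "- (a * (2 - real d)) - 1 = - (a * (2 * \<beta>))"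
        using a_large[OF 3] 3 \<beta> by (simp add: field_simps)
      show "\<forall>\<^sub>F T in at_top. T powr (- (a * (2 - real d))) / T = T powr (- (a * (2 * \<beta>)))"
        using eventually_gt_at_top[of 0]
      proof eventually_elim
        case (elim T)
        then show ?case unfolding exponent[symmetric] by (subst powr_diff) simp
      qed
    qed
    finally show ?thesis
      unfolding landau_o.big.cong[OF rate, symmetric] using bias 3
      by (simp add: variance_factor_def)
  qed
  then show "(\<lambda>T. variance_factor d (h T) / T) \<in> O(\<lambda>T. (rate_\<Phi> d \<beta> T)\<^sup>2)"
    and "(\<lambda>T. h T powr (2 * \<beta>)) \<in> O(\<lambda>T. (rate_\<Phi> d \<beta> T)\<^sup>2)" by auto
qed

theorem corollary4p1:
  fixes M :: "'w measure"
    and F :: "ennreal \<Rightarrow> 'w measure"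
    and X :: "real \<Rightarrow> 'w \<Rightarrow> real ^ 'n::finite"
    and P :: "real ^ 'n \<Rightarrow> 'w measure"
    and \<rho> :: "real ^ 'n \<Rightarrow> real"
    and K :: "real ^ 'n \<Rightarrow> real"
    and l :: nat
    and x :: "real ^ 'n"
    and D :: "(real ^ 'n) set"
    and \<beta> L :: real
    and h :: "real \<Rightarrow> real"
  assumes "class_\<Sigma> M F X P \<rho> \<or> class_\<Theta> M F X P \<rho>"
    and "kernel_of_order l K"
    and "open D" and "x \<in> D"
    and "0 < \<beta>" and "\<beta> \<le> real l + 1"
    and "\<rho> \<in> holder_class D \<beta> L"
    and "\<forall>T>0. 0 < h T"
    and "if CARD('n) \<le> 2
         then \<exists>\<gamma>. 0 < \<gamma> \<and> \<gamma> \<le> \<beta> \<and> h \<in> \<Theta>(\<lambda>T. T powr (- 1 / \<gamma>))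
         else h \<in> \<Theta>(\<lambda>T. T powr (- 1 / (2 * \<beta> + real CARD('n) - 2)))"
  shows "(\<lambda>T. \<integral>\<omega>. (density_estimator K X (h T) T x \<omega> - \<rho> x)\<^sup>2 \<partial>(density_measure \<rho> \<bind> P))
           \<in> O(\<lambda>T. (rate_\<Phi> CARD('n) \<beta> T)\<^sup>2)"
proof -
  let ?d = "CARD('n)"
  have dim: "DIM(real ^ 'n) = ?d" by simp
  interpret order_kernel K l by unfold_locales fact
  obtain r where r: "0 < r" "cball x r \<subseteq> D"
    using \<open>open D\<close> \<open>x \<in> D\<close> open_contains_cball by blast
  obtain \<kappa> where \<kappa>: "0 < \<kappa>" "\<And>u. \<bar>K u\<bar> \<le> \<kappa>" using kernel_bounded by blast
  define k1 where "k1 = (\<integral>u. \<bar>K u\<bar> \<partial>lborel)"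
  have k1: "0 \<le> k1" by (simp add: k1_def)
  have \<rho>L: "\<bar>\<rho> y\<bar> \<le> L" if "y \<in> D" for y
    using assms(7) that by (auto simp: holder_class_def)
  have L: "0 \<le> L" using \<rho>L[OF \<open>x \<in> D\<close>] by linarith
  have \<rho>S: "\<rho> y \<le> L" if "y \<in> cball x r" for y using \<rho>L[of y] that r by force
  obtain p where "basic_assumption X P p \<rho>"
    using assms(1) unfolding class_\<Sigma>_def class_\<Theta>_def by blast
  then have \<rho>_meas[measurable]: "\<rho> \<in> borel_measurable borel" and \<rho>_nonneg: "\<And>y. 0 \<le> \<rho> y"
    unfolding basic_assumption_def by blast+
  obtain C where C: "0 \<le> C" and mse: "\<And>h f T a. 0 < h \<Longrightarrow> h \<le> 1 \<Longrightarrow> concentrated (cball x r) \<kappa> k1 h f \<Longrightarrow> 0 < T \<Longrightarrow>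
      (\<integral>\<omega>. ((1 / T) * (LBINT s:{0..T}. f (X s \<omega>)) - a)\<^sup>2 \<partial>(density_measure \<rho> \<bind> P))
        \<le> C * (variance_factor DIM(real ^ 'n) h / T) + 2 * ((\<integral>y. f y \<partial>density_measure \<rho>) - a)\<^sup>2"
    using mean_square_error_of_time_average[OF assms(1) compact_cball \<rho>S L \<kappa>(1) k1] by blast
  define B where "B = L * real ?d ^ strict_floor \<beta> * real ?d powr \<beta> * k1"
  have B: "0 \<le> B" using L k1 by (simp add: B_def)
  have bound: "(\<integral>\<omega>. (density_estimator K X \<eta> T x \<omega> - \<rho> x)\<^sup>2 \<partial>(density_measure \<rho> \<bind> P))
      \<le> C * (variance_factor ?d \<eta> / T) + 2 * B\<^sup>2 * \<eta> powr (2 * \<beta>)"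
    if \<eta>: "0 < \<eta>" "\<eta> \<le> 1" "\<eta> * real ?d \<le> r" and T: "0 < T" for \<eta> T
  proof -
    define f where "f y = scaled_kernel K \<eta> (x - y)" for y
    have f_meas[measurable]: "f \<in> borel_measurable borel"
      unfolding f_def scaled_kernel_def by measurable
    have conc: "concentrated (cball x r) \<kappa> k1 \<eta> f"
      unfolding concentrated_def
    proof (intro conjI allI impI)
      show "\<bar>f y\<bar> \<le> \<kappa> / \<eta> ^ DIM(real ^ 'n)" for y
        using \<kappa>(2) \<eta>(1) by (simp add: f_def scaled_kernel_def abs_divide divide_right_mono)
      show "y \<in> cball x r" if "f y \<noteq> 0" for y
      proof -
        have "norm ((x - y) /\<^sub>R \<eta>) \<le> real ?d"
          using that by (intro kernel_support) (auto simp: f_def scaled_kernel_def)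
        moreover have "norm ((x - y) /\<^sub>R \<eta>) = norm (x - y) / \<eta>"
          using \<eta>(1) unfolding norm_scaleR by (simp add: divide_inverse mult.commute)
        ultimately have "norm (x - y) \<le> \<eta> * real ?d"
          using \<eta>(1) by (simp add: pos_divide_le_eq mult.commute)
        then show ?thesis using \<eta>(3) by (simp add: dist_norm)
      qed
      show "(\<integral>\<^sup>+y. ennreal \<bar>f y\<bar> \<partial>lborel) \<le> ennreal k1"
        unfolding f_def k1_def using nn_integral_scaled_kernel[OF \<eta>(1)] by simp
    qed fact
    have "(\<integral>y. f y \<partial>density_measure \<rho>) = (\<integral>y. f y * \<rho> y \<partial>lborel)"
      by (subst integral_density) (auto simp: \<rho>_nonneg mult.commute)
    also have "\<dots> = (\<integral>u. K u * \<rho> (x - \<eta> *\<^sub>R u) \<partial>lborel)"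
      unfolding f_def by (rule integral_scaled_kernel[OF \<rho>_meas \<eta>(1)])
    finally have "\<bar>(\<integral>y. f y \<partial>density_measure \<rho>) - \<rho> x\<bar> \<le> B * \<eta> powr \<beta>"
      using kernel_smoothing_bias[OF assms(7) \<rho>_meas assms(3,5,6) r \<eta>(1,3)] by (simp add: B_def k1_def)
    then have "((\<integral>y. f y \<partial>density_measure \<rho>) - \<rho> x)\<^sup>2 \<le> (B * \<eta> powr \<beta>)\<^sup>2"
      using B by (simp add: abs_le_square_iff[symmetric] abs_mult)
    also have "\<dots> = B\<^sup>2 * \<eta> powr (2 * \<beta>)"
      using \<eta>(1) by (simp add: power_mult_distrib power2_eq_square powr_add[symmetric])
    finally show ?thesis
      using mse[OF \<eta>(1,2) conc T, of "\<rho> x"] by (simp add: density_estimator_def f_def)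
  qed
  have d: "0 < ?d" by simp
  note rates = mean_square_rate[OF d assms(5,8,9)]
  have "(\<lambda>T. C * (variance_factor ?d (h T) / T) + 2 * B\<^sup>2 * h T powr (2 * \<beta>)) \<in> O(\<lambda>T. (rate_\<Phi> ?d \<beta> T)\<^sup>2)"
  proof (rule sum_in_bigo)
    show "(\<lambda>T. C * (variance_factor ?d (h T) / T)) \<in> O(\<lambda>T. (rate_\<Phi> ?d \<beta> T)\<^sup>2)"
      using rates(2) by (cases "C = 0") (simp_all del: times_divide_eq_right)
    show "(\<lambda>T. 2 * B\<^sup>2 * h T powr (2 * \<beta>)) \<in> O(\<lambda>T. (rate_\<Phi> ?d \<beta> T)\<^sup>2)"
      using rates(3) by (cases "B = 0") simp_all
  qed
  moreover have "(\<lambda>T. \<integral>\<omega>. (density_estimator K X (h T) T x \<omega> - \<rho> x)\<^sup>2 \<partial>(density_measure \<rho> \<bind> P))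
      \<in> O(\<lambda>T. C * (variance_factor ?d (h T) / T) + 2 * B\<^sup>2 * h T powr (2 * \<beta>))"
  proof (rule bigoI[where c=1])
    have small: "\<forall>\<^sub>F T in at_top. h T < min 1 (r / real ?d)"
      by (rule order_tendstoD(2)[OF rates(1)]) (use r(1) in simp)
    show "\<forall>\<^sub>F T in at_top. norm (\<integral>\<omega>. (density_estimator K X (h T) T x \<omega> - \<rho> x)\<^sup>2 \<partial>(density_measure \<rho> \<bind> P))
        \<le> 1 * norm (C * (variance_factor ?d (h T) / T) + 2 * B\<^sup>2 * h T powr (2 * \<beta>))"
      using small eventually_gt_at_top[of 0]
    proof eventually_elim
      case (elim T)
      have "h T * real ?d \<le> r" using elim(1) by (simp add: field_simps)
      then have "(\<integral>\<omega>. (density_estimator K X (h T) T x \<omega> - \<rho> x)\<^sup>2 \<partial>(density_measure \<rho> \<bind> P))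
          \<le> C * (variance_factor ?d (h T) / T) + 2 * B\<^sup>2 * h T powr (2 * \<beta>)"
        using elim assms(8) by (intro bound) auto
      moreover have "0 \<le> (\<integral>\<omega>. (density_estimator K X (h T) T x \<omega> - \<rho> x)\<^sup>2 \<partial>(density_measure \<rho> \<bind> P))"
        by simp
      ultimately show ?case by simp
    qed
  qed
  ultimately show ?thesis by (rule landau_o.big_trans[rotated])
qed

end
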